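(* There is an algorithm solving the problem \textsc{Distinct Shortest Walks} (given a database $\mathcal{D}$, two vertices $s,t$ of $\mathcal{D}$ and a nondeterministic finite automaton $\mathcal{A}$, enumerate without duplicates the set $[\![\mathcal{A}]\!](\mathcal{D},s,t)$ of all shortest walks from $s$ to $t$ that match $\mathcal{A}$) with preprocessing time in $O(|\mathcal{D}|\times|\mathcal{A}|)$ and delay in $O(\lambda\times|\mathcal{A}|)$, where $\lambda$ is the length of a shortest walk from $s$ to $t$ matching $\mathcal{A}$.
   Context: A database is a tuple $\mathcal{D}=(\Sigma,V,E,\mathrm{src},\mathrm{tgt},\mathrm{lbl})$ where $\Sigma$ is a finite set of labels, $V$ a finite set of vertices, $E$ a finite set of edges, $\mathrm{src},\mathrm{tgt}:E\to V$ the source and target functions, and $\mathrm{lbl}:E\to 2^\Sigma$ a labelling function (edges may carry several labels, and several edges may share the same endpoints). A walk is a sequence $w=\langle v_0,e_0,v_1,\dots,e_{k-1},v_k\rangle$ with $k\ge 0$, $\mathrm{src}(e_i)=v_i$, $\mathrm{tgt}(e_i)=v_{i+1}$; its length is $k$, $\mathrm{src}(w)=v_0$, $\mathrm{tgt}(w)=v_k$, and $\mathrm{lbl}(w)=\{a_0\cdots a_{k-1} : a_i\in\mathrm{lbl}(e_i)\}$. Two walks are distinct if their sequences of edges differ. A nondeterministic automaton is $\mathcal{A}=(\Sigma,Q,\Delta,I,F)$ with $\Delta\subseteq Q\times\Sigma\times Q$ (no $\varepsilon$-transitions), initial states $I$ and final states $F$; $L(\mathcal{A})$ is its language. A walk $w$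 matches $\mathcal{A}$ if $L(\mathcal{A})\cap\mathrm{lbl}(w)\neq\emptyset$. Given $s,t$, $\lambda$ is the minimal length of a walk from $s$ to $t$ matching $\mathcal{A}$, and $[\![\mathcal{A}]\!](\mathcal{D},s,t)$ is the set of walks from $s$ to $t$ matching $\mathcal{A}$ of length $\lambda$. Complexity model: $|\mathcal{D}|=O(|V|+|E|+\sum_{e\in E}|\mathrm{lbl}(e)|)$ and $|\mathcal{A}|=O(|\Sigma|+|Q|+|\Delta|)$. Labels take constant space and label equality is checked in constant time; each vertex $v$ gives in constant time an array $\mathrm{In}(v)$ of its incoming edges, an array $\mathrm{Out}(v)$ of its outgoing edges, and their sizes; each edge $e$ gives in constant time $\mathrm{src}(e)$, $\mathrm{tgt}(e)$, its label set (browsable in time $O(|\mathrm{lbl}(e)|)$) and $\mathrm{tgtidx}(e)$, the position of $e$ in $\mathrm{In}(\mathrm{tgt}(e))$. States are integers $0,\dots,|Q|-1$ and for a state $q$ and label $a$, the (non-repeating) list $\Delta(q,a)=\{q' : (q,a,q')\in\Delta\}$ is accessible in constant time. Enumeration complexity: preprocessing is the time before the first output; delay is the maximal time between two consecutive outputs (and after the last output until termination). *)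

theory Defs
  imports Main
begin

section \<open>Databases, walks, automata\<close>

record ('v, 'e, 'l) database =
  labels :: "'l set"
  verts :: "'v set"
  edges :: "'e set"
  src :: "'e \<Rightarrow> 'v"
  tgt :: "'e \<Rightarrow> 'v"
  lbl :: "'e \<Rightarrow> 'l set"

definition database :: "('v, 'e, 'l) database \<Rightarrow> bool" where
  "database D \<longleftrightarrow>
     finite (labels D) \<and> finite (verts D) \<and> finite (edges D) \<and>
     (\<forall>e\<in>edges D. src D e \<in> verts D \<and> tgt D e \<in> verts D \<and> lbl D e \<subseteq> labels D)"

record ('q, 'l) nfa =
  alphabet :: "'l set"
  states :: "'q set"
  trans :: "('q \<times> 'l \<times> 'q) set"
  initials :: "'q set"
  finals :: "'q set"

definition nfa :: "('q, 'l) nfa \<Rightarrow> bool" where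
  "nfa A \<longleftrightarrow>
     finite (alphabet A) \<and> finite (states A) \<and>
     trans A \<subseteq> states A \<times> alphabet A \<times> states A \<and>
     initials A \<subseteq> states A \<and> finals A \<subseteq> states A"

definition lang :: "('q, 'l) nfa \<Rightarrow> 'l list set" where
  "lang A = {as. \<exists>qs. length qs = Suc (length as) \<and>
                   hd qs \<in> initials A \<and> last qs \<in> finals A \<and>
                   (\<forall>i<length as. (qs ! i, as ! i, qs ! Suc i) \<in> trans A)}"

text \<open>The walk \<open>\<langle>v\<^sub>0, e\<^sub>0, v\<^sub>1, \<dots>, e\<^sub>k\<^sub>-\<^sub>1, v\<^sub>k\<rangle>\<close> is the pair \<open>([v\<^sub>0, \<dots>, v\<^sub>k], [e\<^sub>0, \<dots>, e\<^sub>k\<^sub>-\<^sub>1])\<close>.\<close>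

type_synonym ('v, 'e) walk = "'v list \<times> 'e list"

definition walk :: "('v, 'e, 'l) database \<Rightarrow> ('v, 'e) walk \<Rightarrow> bool" where
  "walk D w \<longleftrightarrow> (case w of (vs, es) \<Rightarrow>
     length vs = Suc (length es) \<and> set vs \<subseteq> verts D \<and> set es \<subseteq> edges D \<and>
     (\<forall>i<length es. src D (es ! i) = vs ! i \<and> tgt D (es ! i) = vs ! Suc i))"

definition walk_length :: "('v, 'e) walk \<Rightarrow> nat" where
  "walk_length w = length (snd w)"

definition walk_src :: "('v, 'e) walk \<Rightarrow> 'v" where
  "walk_src w = hd (fst w)"

definition walk_tgt :: "('v, 'e) walk \<Rightarrow> 'v" where
  "walk_tgt w = last (fst w)"

definition walk_lbl :: "('v, 'e, 'l) database \<Rightarrow> ('v, 'e) walk \<Rightarrow> 'l list set" where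
  "walk_lbl D w = {as. length as = length (snd w) \<and>
                       (\<forall>i<length as. as ! i \<in> lbl D (snd w ! i))}"

definition matches :: "('v, 'e, 'l) database \<Rightarrow> ('q, 'l) nfa \<Rightarrow> ('v, 'e) walk \<Rightarrow> bool" where
  "matches D A w \<longleftrightarrow> lang A \<inter> walk_lbl D w \<noteq> {}"

definition matching_walks ::
  "('v, 'e, 'l) database \<Rightarrow> ('q, 'l) nfa \<Rightarrow> 'v \<Rightarrow> 'v \<Rightarrow> ('v, 'e) walk set" where
  "matching_walks D A s t =
     {w. walk D w \<and> walk_src w = s \<and> walk_tgt w = t \<and> matches D A w}"

text \<open>Meaningful only if there is a matching walk from \<open>s\<close> to \<open>t\<close>.\<close>

definition shortest_length ::
  "('v, 'e, 'l) database \<Rightarrow> ('q, 'l) nfa \<Rightarrow> 'v \<Rightarrow> 'v \<Rightarrow> nat" where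
  "shortest_length D A s t = (LEAST k. \<exists>w\<in>matching_walks D A s t. walk_length w = k)"

definition shortest_walks ::
  "('v, 'e, 'l) database \<Rightarrow> ('q, 'l) nfa \<Rightarrow> 'v \<Rightarrow> 'v \<Rightarrow> ('v, 'e) walk set" where
  "shortest_walks D A s t =
     {w \<in> matching_walks D A s t. walk_length w = shortest_length D A s t}"

definition database_size :: "('v, 'e, 'l) database \<Rightarrow> nat" where
  "database_size D = card (verts D) + card (edges D) + (\<Sum>e\<in>edges D. card (lbl D e))"

definition nfa_size :: "('q, 'l) nfa \<Rightarrow> nat" where
  "nfa_size A = card (alphabet A) + card (states A) + card (trans A)"


section \<open>Presentation of the input\<close>

text \<open>
  Vertices, edges, labels and states are single machine words, i.e. natural numbers. States
  are \<open>0, \<dots>, |Q| - 1\<close>; the other identifiers are arbitrary, the machine knows them only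
  through the tables below. Every array comes with its size.
\<close>

record input =
  source :: nat
  target :: nat
  in_arr :: "nat \<Rightarrow> nat list"
  out_arr :: "nat \<Rightarrow> nat list"
  src_of :: "nat \<Rightarrow> nat"
  tgt_of :: "nat \<Rightarrow> nat"
  tgtidx :: "nat \<Rightarrow> nat"
  lbl_arr :: "nat \<Rightarrow> nat list"
  num_states :: nat
  delta_arr :: "nat \<Rightarrow> nat \<Rightarrow> nat list"
  init_arr :: "nat list"
  final_arr :: "nat list"

definition lists_set :: "'a list \<Rightarrow> 'a set \<Rightarrow> bool" where
  "lists_set xs X \<longleftrightarrow> distinct xs \<and> set xs = X"

text \<open>Nothing is assumed about the entries of the tables at numbers that are not identifiers.\<close>

definition presents ::
  "input \<Rightarrow> (nat, nat, nat) database \<Rightarrow> (nat, nat) nfa \<Rightarrow> nat \<Rightarrow> nat \<Rightarrow> bool" where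
  "presents x D A s t \<longleftrightarrow>
     source x = s \<and> target x = t \<and>
     (\<forall>v\<in>verts D. lists_set (in_arr x v) {e \<in> edges D. tgt D e = v} \<and>
                  lists_set (out_arr x v) {e \<in> edges D. src D e = v}) \<and>
     (\<forall>e\<in>edges D. src_of x e = src D e \<and> tgt_of x e = tgt D e \<and>
                  tgtidx x e < length (in_arr x (tgt D e)) \<and>
                  in_arr x (tgt D e) ! tgtidx x e = e \<and>
                  lists_set (lbl_arr x e) (lbl D e)) \<and>
     states A = {0..<num_states x} \<and>
     (\<forall>q\<in>states A. \<forall>a\<in>alphabet A. lists_set (delta_arr x q a) {q'. (q, a, q') \<in> trans A}) \<and>
     lists_set (init_arr x) (initials A) \<and>
     lists_set (final_arr x) (finals A)"


section \<open>The machine\<close>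

text \<open>
  A random access machine with uniform cost, given as a structured language. It has registers,
  a memory consisting of two-dimensional arrays (a program mentions only finitely many of them,
  as their names occur literally in the program), all initially zero, and read-only access to
  the input tables. The only arithmetic is increment and (truncated) decrement, so unit cost
  cannot be exploited by computing with huge numbers: a stored number exceeds the constants
  and input words by at most the running time.
\<close>

datatype exp =
    Const nat
  | Reg nat
  | Mem nat exp exp
  | Inc exp
  | Dec exp
  | Source
  | Target
  | InLen exp
  | InAt exp exp
  | OutLen exp
  | OutAt exp exp
  | SrcOf exp
  | TgtOf exp
  | TgtIdx exp
  | LblLen exp
  | LblAt exp exp
  | NumStates
  | DeltaLen exp exp
  | DeltaAt exp exp exp
  | InitLen
  | InitAt exp
  | FinalLen
  | FinalAt exp

datatype bexp =
    Less exp exp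
  | Equal exp exp
  | Neg bexp
  | Conj bexp bexp

text \<open>
  \<open>Emit a\<close> appends the word \<open>a\<close> to the output under construction and \<open>Finish\<close> delivers that
  output and starts a new, empty one.
\<close>

datatype com =
    Skip
  | SetReg nat exp
  | SetMem nat exp exp exp
  | Emit exp
  | Finish
  | Seq com com
  | Cond bexp com com
  | While bexp com

text \<open>\<open>outputs\<close> holds the outputs delivered so far, each with the time of its delivery.\<close>

record config =
  reg :: "nat \<Rightarrow> nat"
  mem :: "nat \<Rightarrow> nat \<Rightarrow> nat \<Rightarrow> nat"
  clock :: nat
  pending :: "nat list"
  outputs :: "(nat \<times> nat list) list"

definition start :: config where
  "start = \<lparr>reg = (\<lambda>_. 0), mem = (\<lambda>_ _ _. 0), clock = 0, pending = [], outputs = []\<rparr>"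

definition entry :: "nat list \<Rightarrow> nat \<Rightarrow> nat" where
  "entry xs i = (if i < length xs then xs ! i else 0)"

primrec val :: "input \<Rightarrow> config \<Rightarrow> exp \<Rightarrow> nat" where
  "val x \<sigma> (Const n) = n"
| "val x \<sigma> (Reg r) = reg \<sigma> r"
| "val x \<sigma> (Mem m a b) = mem \<sigma> m (val x \<sigma> a) (val x \<sigma> b)"
| "val x \<sigma> (Inc a) = val x \<sigma> a + 1"
| "val x \<sigma> (Dec a) = val x \<sigma> a - 1"
| "val x \<sigma> Source = source x"
| "val x \<sigma> Target = target x"
| "val x \<sigma> (InLen v) = length (in_arr x (val x \<sigma> v))"
| "val x \<sigma> (InAt v i) = entry (in_arr x (val x \<sigma> v)) (val x \<sigma> i)"
| "val x \<sigma> (OutLen v) = length (out_arr x (val x \<sigma> v))"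
| "val x \<sigma> (OutAt v i) = entry (out_arr x (val x \<sigma> v)) (val x \<sigma> i)"
| "val x \<sigma> (SrcOf e) = src_of x (val x \<sigma> e)"
| "val x \<sigma> (TgtOf e) = tgt_of x (val x \<sigma> e)"
| "val x \<sigma> (TgtIdx e) = tgtidx x (val x \<sigma> e)"
| "val x \<sigma> (LblLen e) = length (lbl_arr x (val x \<sigma> e))"
| "val x \<sigma> (LblAt e i) = entry (lbl_arr x (val x \<sigma> e)) (val x \<sigma> i)"
| "val x \<sigma> NumStates = num_states x"
| "val x \<sigma> (DeltaLen q a) = length (delta_arr x (val x \<sigma> q) (val x \<sigma> a))"
| "val x \<sigma> (DeltaAt q a i) = entry (delta_arr x (val x \<sigma> q) (val x \<sigma> a)) (val x \<sigma> i)"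
| "val x \<sigma> InitLen = length (init_arr x)"
| "val x \<sigma> (InitAt i) = entry (init_arr x) (val x \<sigma> i)"
| "val x \<sigma> FinalLen = length (final_arr x)"
| "val x \<sigma> (FinalAt i) = entry (final_arr x) (val x \<sigma> i)"

primrec bval :: "input \<Rightarrow> config \<Rightarrow> bexp \<Rightarrow> bool" where
  "bval x \<sigma> (Less a b) \<longleftrightarrow> val x \<sigma> a < val x \<sigma> b"
| "bval x \<sigma> (Equal a b) \<longleftrightarrow> val x \<sigma> a = val x \<sigma> b"
| "bval x \<sigma> (Neg b) \<longleftrightarrow> \<not> bval x \<sigma> b"
| "bval x \<sigma> (Conj b c) \<longleftrightarrow> bval x \<sigma> b \<and> bval x \<sigma> c"

text \<open>Evaluating an expression takes one time unit per node.\<close>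

primrec cost :: "exp \<Rightarrow> nat" where
  "cost (Const n) = 1"
| "cost (Reg r) = 1"
| "cost (Mem m a b) = 1 + cost a + cost b"
| "cost (Inc a) = 1 + cost a"
| "cost (Dec a) = 1 + cost a"
| "cost Source = 1"
| "cost Target = 1"
| "cost (InLen v) = 1 + cost v"
| "cost (InAt v i) = 1 + cost v + cost i"
| "cost (OutLen v) = 1 + cost v"
| "cost (OutAt v i) = 1 + cost v + cost i"
| "cost (SrcOf e) = 1 + cost e"
| "cost (TgtOf e) = 1 + cost e"
| "cost (TgtIdx e) = 1 + cost e"
| "cost (LblLen e) = 1 + cost e"
| "cost (LblAt e i) = 1 + cost e + cost i"
| "cost NumStates = 1"
| "cost (DeltaLen q a) = 1 + cost q + cost a"
| "cost (DeltaAt q a i) = 1 + cost q + cost a + cost i"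
| "cost InitLen = 1"
| "cost (InitAt i) = 1 + cost i"
| "cost FinalLen = 1"
| "cost (FinalAt i) = 1 + cost i"

primrec bcost :: "bexp \<Rightarrow> nat" where
  "bcost (Less a b) = 1 + cost a + cost b"
| "bcost (Equal a b) = 1 + cost a + cost b"
| "bcost (Neg b) = 1 + bcost b"
| "bcost (Conj b c) = 1 + bcost b + bcost c"

definition tick :: "nat \<Rightarrow> config \<Rightarrow> config" where
  "tick n \<sigma> = \<sigma>\<lparr>clock := clock \<sigma> + n\<rparr>"

definition set_reg :: "nat \<Rightarrow> nat \<Rightarrow> config \<Rightarrow> config" where
  "set_reg r n \<sigma> = \<sigma>\<lparr>reg := (reg \<sigma>)(r := n)\<rparr>"

definition set_mem :: "nat \<Rightarrow> nat \<Rightarrow> nat \<Rightarrow> nat \<Rightarrow> config \<Rightarrow> config" where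
  "set_mem m i j n \<sigma> =
     \<sigma>\<lparr>mem := (mem \<sigma>)(m := (mem \<sigma> m)(i := (mem \<sigma> m i)(j := n)))\<rparr>"

definition emit :: "nat \<Rightarrow> config \<Rightarrow> config" where
  "emit n \<sigma> = \<sigma>\<lparr>pending := pending \<sigma> @ [n]\<rparr>"

definition finish :: "config \<Rightarrow> config" where
  "finish \<sigma> = \<sigma>\<lparr>pending := [], outputs := outputs \<sigma> @ [(clock \<sigma>, pending \<sigma>)]\<rparr>"

text \<open>\<open>exec x c \<sigma> \<sigma>'\<close>: on input \<open>x\<close>, command \<open>c\<close> started in \<open>\<sigma>\<close> terminates in \<open>\<sigma>'\<close>.\<close>

inductive exec :: "input \<Rightarrow> com \<Rightarrow> config \<Rightarrow> config \<Rightarrow> bool" for x :: input where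
  Skip: "exec x Skip \<sigma> (tick (Suc 0) \<sigma>)"
| SetReg: "exec x (SetReg r a) \<sigma> (tick (Suc (cost a)) (set_reg r (val x \<sigma> a) \<sigma>))"
| SetMem: "exec x (SetMem m a b c) \<sigma>
     (tick (Suc (cost a + cost b + cost c)) (set_mem m (val x \<sigma> a) (val x \<sigma> b) (val x \<sigma> c) \<sigma>))"
| Emit: "exec x (Emit a) \<sigma> (tick (Suc (cost a)) (emit (val x \<sigma> a) \<sigma>))"
| Finish: "exec x Finish \<sigma> (finish (tick (Suc 0) \<sigma>))"
| Seq: "exec x c \<sigma> \<sigma>' \<Longrightarrow> exec x d \<sigma>' \<sigma>'' \<Longrightarrow> exec x (Seq c d) \<sigma> \<sigma>''"
| CondTrue: "bval x \<sigma> b \<Longrightarrow> exec x c (tick (Suc (bcost b)) \<sigma>) \<sigma>' \<Longrightarrow> exec x (Cond b c d) \<sigma> \<sigma>'"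
| CondFalse: "\<not> bval x \<sigma> b \<Longrightarrow> exec x d (tick (Suc (bcost b)) \<sigma>) \<sigma>' \<Longrightarrow> exec x (Cond b c d) \<sigma> \<sigma>'"
| WhileTrue: "bval x \<sigma> b \<Longrightarrow> exec x c (tick (Suc (bcost b)) \<sigma>) \<sigma>' \<Longrightarrow>
     exec x (While b c) \<sigma>' \<sigma>'' \<Longrightarrow> exec x (While b c) \<sigma> \<sigma>''"
| WhileFalse: "\<not> bval x \<sigma> b \<Longrightarrow> exec x (While b c) \<sigma> (tick (Suc (bcost b)) \<sigma>)"

inductive_cases exec_elims:
  "exec x Skip \<sigma> \<tau>" "exec x (SetReg r a) \<sigma> \<tau>" "exec x (SetMem m a b c) \<sigma> \<tau>"
  "exec x (Emit a) \<sigma> \<tau>" "exec x Finish \<sigma> \<tau>" "exec x (Seq c d) \<sigma> \<tau>"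
  "exec x (Cond b c d) \<sigma> \<tau>"
inductive_cases exec_WhileE: "exec x (While b c) \<sigma> \<tau>"

lemma exec_deterministic: "exec x c \<sigma> \<tau> \<Longrightarrow> exec x c \<sigma> \<tau>' \<Longrightarrow> \<tau>' = \<tau>"
proof (induction arbitrary: \<tau>' rule: exec.induct)
  case (WhileTrue \<sigma> b c \<sigma>' \<sigma>'')
  from WhileTrue.prems show ?case
    by (rule exec_WhileE) (use WhileTrue.hyps(1) WhileTrue.IH in blast)+
next
  case (WhileFalse \<sigma> b c)
  from WhileFalse.prems WhileFalse.hyps show ?case
    by (blast elim: exec_WhileE)
qed (blast elim: exec_elims)+


section \<open>Enumeration and its complexity\<close>

primrec walk_word :: "nat list \<Rightarrow> nat list \<Rightarrow> nat list" where
  "walk_word vs [] = [hd vs]"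
| "walk_word vs (e # es) = hd vs # e # walk_word (tl vs) es"

text \<open>
  The outputs of a finished run are the sequences \<open>v\<^sub>0, e\<^sub>0, v\<^sub>1, \<dots>, v\<^sub>k\<close> of the given walks,
  each of them once, where walks count as equal if they have the same edges.
\<close>

definition enumerates :: "config \<Rightarrow> (nat, nat) walk set \<Rightarrow> bool" where
  "enumerates \<sigma> W \<longleftrightarrow> pending \<sigma> = [] \<and>
     (\<exists>ws. map snd (outputs \<sigma>) = map (\<lambda>(vs, es). walk_word vs es) ws \<and>
           set ws = W \<and> distinct (map snd ws))"

text \<open>Without any output, the whole run is preprocessing.\<close>

definition preprocessing_time :: "config \<Rightarrow> nat" where
  "preprocessing_time \<sigma> = hd (map fst (outputs \<sigma>) @ [clock \<sigma>])"

text \<open>The time from each output to the next one, and from the last output to termination.\<close>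

definition delays :: "config \<Rightarrow> nat set" where
  "delays \<sigma> = (let ts = map fst (outputs \<sigma>) @ [clock \<sigma>]
              in {ts ! Suc i - ts ! i | i. Suc i < length ts})"

end

(* A breadth-first search from (s, q), q initial, in the product of database and automaton finds
   the level of every pair (v, q) and, for every edge e and state q, the predecessors p from which
   some transition reads a label of e and rises by exactly one level. Shortest matching walks are
   then generated backwards from t: a partial walk is kept together with the set S of all states
   from which its remaining part is accepted at the right level, so that every walk is generated
   once, however many runs it has. Every S that occurs is nonempty and consists of states of the
   current level, so there are no dead ends, and between two outputs the stack is climbed and
   descended once, at a cost of O(|A|) per level.

   Since lambda * |A| may exceed |D| * |A|, the first descent needs a finer bound: it is paid for
   by the pairs and predecessor entries of the levels it passes, and each of these belongs to one
   level only. *)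

theory Submission
  imports Defs
begin

text \<open>The O(|A|) cost per level depends on finding the next usable incoming edge without
  scanning the incoming array, whose length is not bounded by |A|. An edge is usable for a set of
  states iff it is usable for one of its members, so the next usable position for \<open>S\<close>
  is the minimum of the positions for its single states. These are tabulated after the search by a
  backward pass over the incoming array for each reached pair, in total O((|V| + |E|) |Q|); a lookup
  then costs one read per state of \<open>S\<close>. Correctness of the enumeration is an equation
  between lists: the words delivered so far, followed by the words of \<open>remaining\<close> (the
  sequences still encoded in the stack), are always the words of \<open>branches\<close>, a
  recursively defined list. Descending leaves \<open>remaining\<close> unchanged, and each delivery
  takes off its head. Distinctness and completeness are therefore proved for \<open>branches\<close>
  alone. As for the clock, a round of the main loop delivers its single output somewhere inside the
  round, so consecutive outputs are at most two rounds apart.\<close>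

lemma distinct_concat_map:
  assumes "distinct xs" "\<And>e. e \<in> set xs \<Longrightarrow> distinct (f e)" "\<And>e z. e \<in> set xs \<Longrightarrow> z \<in> set (f e) \<Longrightarrow> h z = e"
  shows "distinct (concat (map f xs))"
  using assms
proof (induction xs)
  case (Cons e xs)
  have "set (f e) \<inter> set (concat (map f xs)) = {}"
  proof (intro equals0I, elim IntE)
    fix z assume z: "z \<in> set (f e)" "z \<in> set (concat (map f xs))"
    then obtain a where "a \<in> set xs" "z \<in> set (f a)" by auto
    with z Cons.prems(1) Cons.prems(3)[of e z] Cons.prems(3)[of a z] show False by auto
  qed
  with Cons show ?case by simp
qed simp

text \<open>The queue and the stack rows are arrays with a counter \<open>n\<close> that represent a
  set without repetition; this is the effect of writing a new element at position \<open>n\<close>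
  and incrementing the counter.\<close>

lemma bij_betw_snoc:
  fixes f :: "nat \<Rightarrow> 'a"
  assumes "bij_betw f {..<n} Y" "y \<notin> Y"
  shows "bij_betw (f(n := y)) {..<Suc n} (insert y Y)"
proof -
  have "bij_betw (f(n := y)) {..<n} Y"
    by (rule bij_betw_cong[THEN iffD1, OF _ assms(1)]) auto
  then have "bij_betw (f(n := y)) ({..<n} \<union> {n}) (Y \<union> {y})"
    by (rule bij_betw_combine) (use assms in \<open>auto simp: bij_betw_def\<close>)
  then show ?thesis by (simp add: lessThan_Suc)
qed

section \<open>Total correctness with running times\<close>

text \<open>Existential over final configurations, so termination is included; running times are
  stated in the postcondition through \<open>clock\<close>.\<close>

definition wp :: "input \<Rightarrow> com \<Rightarrow> (config \<Rightarrow> bool) \<Rightarrow> config \<Rightarrow> bool" where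
  "wp x c Q \<sigma> \<longleftrightarrow> (\<exists>\<tau>. exec x c \<sigma> \<tau> \<and> Q \<tau>)"

lemma wp_simps [simp]:
  "wp x Skip Q \<sigma> \<longleftrightarrow> Q (tick (Suc 0) \<sigma>)"
  "wp x (SetReg r a) Q \<sigma> \<longleftrightarrow> Q (tick (Suc (cost a)) (set_reg r (val x \<sigma> a) \<sigma>))"
  "wp x (SetMem m a b c) Q \<sigma> \<longleftrightarrow>
     Q (tick (Suc (cost a + cost b + cost c)) (set_mem m (val x \<sigma> a) (val x \<sigma> b) (val x \<sigma> c) \<sigma>))"
  "wp x (Emit a) Q \<sigma> \<longleftrightarrow> Q (tick (Suc (cost a)) (emit (val x \<sigma> a) \<sigma>))"
  "wp x Finish Q \<sigma> \<longleftrightarrow> Q (finish (tick (Suc 0) \<sigma>))"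
  "wp x (Seq c1 c2) Q \<sigma> \<longleftrightarrow> wp x c1 (wp x c2 Q) \<sigma>"
  "wp x (Cond p c1 c2) Q \<sigma> \<longleftrightarrow>
     (if bval x \<sigma> p then wp x c1 Q (tick (Suc (bcost p)) \<sigma>) else wp x c2 Q (tick (Suc (bcost p)) \<sigma>))"
  unfolding wp_def by (auto intro: exec.intros elim!: exec_elims)

lemma wp_mono: "wp x c Q \<sigma> \<Longrightarrow> (\<And>\<tau>. Q \<tau> \<Longrightarrow> Q' \<tau>) \<Longrightarrow> wp x c Q' \<sigma>"
  unfolding wp_def by blast

lemma wp_While:
  fixes f :: "config \<Rightarrow> nat"
  assumes "I \<sigma>"
    and step: "\<And>\<sigma>. I \<sigma> \<Longrightarrow> bval x \<sigma> b \<Longrightarrow> wp x c (\<lambda>\<tau>. I \<tau> \<and> f \<tau> < f \<sigma>) (tick (Suc (bcost b)) \<sigma>)"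
    and stop: "\<And>\<sigma>. I \<sigma> \<Longrightarrow> \<not> bval x \<sigma> b \<Longrightarrow> Q (tick (Suc (bcost b)) \<sigma>)"
  shows "wp x (While b c) Q \<sigma>"
  using \<open>I \<sigma>\<close>
proof (induction "f \<sigma>" arbitrary: \<sigma> rule: less_induct)
  case less
  show ?case
  proof (cases "bval x \<sigma> b")
    case True
    with step[OF less.prems] obtain \<tau> where
      \<tau>: "exec x c (tick (Suc (bcost b)) \<sigma>) \<tau>" "I \<tau>" "f \<tau> < f \<sigma>"
      unfolding wp_def by blast
    from less.hyps[OF \<tau>(3,2)] \<tau>(1) True show ?thesis
      unfolding wp_def by (blast intro: WhileTrue)
  next
    case False
    with stop[OF less.prems] show ?thesis
      unfolding wp_def by (blast intro: WhileFalse)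
  qed
qed

definition For :: "nat \<Rightarrow> exp \<Rightarrow> com \<Rightarrow> com" where
  "For r b c = Seq (SetReg r (Const 0))
     (While (Less (Reg r) b) (Seq c (SetReg r (Inc (Reg r)))))"

lemma config_simps [simp]:
  "reg (tick n \<sigma>) = reg \<sigma>" "mem (tick n \<sigma>) = mem \<sigma>" "clock (tick n \<sigma>) = clock \<sigma> + n"
  "pending (tick n \<sigma>) = pending \<sigma>" "outputs (tick n \<sigma>) = outputs \<sigma>"
  "reg (set_reg r n \<sigma>) = (reg \<sigma>)(r := n)" "mem (set_reg r n \<sigma>) = mem \<sigma>"
  "clock (set_reg r n \<sigma>) = clock \<sigma>" "pending (set_reg r n \<sigma>) = pending \<sigma>"
  "outputs (set_reg r n \<sigma>) = outputs \<sigma>"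
  "reg (set_mem m i j n \<sigma>) = reg \<sigma>"
  "mem (set_mem m i j n \<sigma>) = (mem \<sigma>)(m := (mem \<sigma> m)(i := (mem \<sigma> m i)(j := n)))"
  "clock (set_mem m i j n \<sigma>) = clock \<sigma>" "pending (set_mem m i j n \<sigma>) = pending \<sigma>"
  "outputs (set_mem m i j n \<sigma>) = outputs \<sigma>"
  "reg (emit n \<sigma>) = reg \<sigma>" "mem (emit n \<sigma>) = mem \<sigma>" "clock (emit n \<sigma>) = clock \<sigma>"
  "pending (emit n \<sigma>) = pending \<sigma> @ [n]" "outputs (emit n \<sigma>) = outputs \<sigma>"
  "reg (finish \<sigma>) = reg \<sigma>" "mem (finish \<sigma>) = mem \<sigma>" "clock (finish \<sigma>) = clock \<sigma>"
  "pending (finish \<sigma>) = []" "outputs (finish \<sigma>) = outputs \<sigma> @ [(clock \<sigma>, pending \<sigma>)]"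
  "reg start = (\<lambda>_. 0)" "mem start = (\<lambda>_ _ _. 0)" "clock start = 0"
  "pending start = []" "outputs start = []"
  by (simp_all add: tick_def set_reg_def set_mem_def emit_def finish_def start_def)

text \<open>\<open>J\<close> speaks of the number of finished rounds and is insensitive to the clock
  and to the loop register, which hides the loop overhead. That overhead is
  \<open>cost b + 3\<close> per guard, 3 per increment and 2 for the initial assignment, whence
  \<open>cost b + 6\<close> per round and \<open>cost b + 5\<close> once.\<close>

lemma wp_For:
  assumes "J 0 \<sigma>"
    and tick: "\<And>i \<sigma> k. J i \<sigma> \<Longrightarrow> J i (tick k \<sigma>)"
    and index: "\<And>i \<sigma> k. J i \<sigma> \<Longrightarrow> J i (set_reg r k \<sigma>)"
    and bound: "\<And>i \<sigma>. J i \<sigma> \<Longrightarrow> val x \<sigma> b = n"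
    and step: "\<And>i \<sigma>. i < n \<Longrightarrow> J i \<sigma> \<Longrightarrow> reg \<sigma> r = i \<Longrightarrow>
       wp x c (\<lambda>\<tau>. J (Suc i) \<tau> \<and> reg \<tau> r = i \<and> clock \<tau> \<le> clock \<sigma> + f i) \<sigma>"
    and post: "\<And>\<tau>. J n \<tau> \<Longrightarrow> clock \<tau> \<le> clock \<sigma> + (\<Sum>i<n. f i + cost b + 6) + cost b + 5 \<Longrightarrow> Q \<tau>"
  shows "wp x (For r b c) Q \<sigma>"
proof -
  define I where "I \<tau> \<longleftrightarrow> reg \<tau> r \<le> n \<and> J (reg \<tau> r) \<tau> \<and>
    clock \<tau> \<le> clock \<sigma> + (\<Sum>i<reg \<tau> r. f i + cost b + 6) + 2" for \<tau>
  show ?thesis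
    unfolding For_def wp_simps
  proof (rule wp_While[where I = I and f = "\<lambda>\<tau>. n - reg \<tau> r"])
    show "I (tick (Suc (cost (Const 0))) (set_reg r (val x \<sigma> (Const 0)) \<sigma>))"
      using assms(1) tick index by (simp add: I_def)
  next
    fix \<tau> assume \<tau>: "I \<tau>" "bval x \<tau> (Less (Reg r) b)"
    let ?i = "reg \<tau> r" and ?\<tau> = "tick (Suc (bcost (Less (Reg r) b))) \<tau>"
    have i: "?i < n" and J: "J ?i ?\<tau>"
      using \<tau> bound tick by (auto simp: I_def)
    have "wp x c (\<lambda>\<rho>. J (Suc ?i) \<rho> \<and> reg \<rho> r = ?i \<and> clock \<rho> \<le> clock ?\<tau> + f ?i) ?\<tau>"
      using step[OF i J] by simp
    then show "wp x (Seq c (SetReg r (Inc (Reg r)))) (\<lambda>\<rho>. I \<rho> \<and> n - reg \<rho> r < n - reg \<tau> r) ?\<tau>"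
      unfolding wp_simps
      by (rule wp_mono) (use \<tau> i tick index in \<open>auto simp: I_def\<close>)
  next
    fix \<tau> assume \<tau>: "I \<tau>" "\<not> bval x \<tau> (Less (Reg r) b)"
    then have "reg \<tau> r = n" using bound by (auto simp: I_def)
    with \<tau> show "Q (tick (Suc (bcost (Less (Reg r) b))) \<tau>)"
      by (intro post) (auto simp: I_def intro: tick)
  qed
qed

text \<open>Loops over input arrays are described by the set \<open>Y\<close> of elements seen
  instead of by positions: distinctness of the array supplies \<open>y \<notin> Y\<close> and turns
  a sum over positions into a sum over the set.\<close>

lemma wp_For_list:
  fixes J :: "nat set \<Rightarrow> config \<Rightarrow> bool" and F :: "nat \<Rightarrow> nat"
  assumes "distinct xs" "J {} \<sigma>"
    and tick: "\<And>Y \<tau> k. J Y \<tau> \<Longrightarrow> J Y (tick k \<tau>)"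
    and index: "\<And>Y \<tau> k. J Y \<tau> \<Longrightarrow> J Y (set_reg r k \<tau>)"
    and bound: "\<And>Y \<tau>. J Y \<tau> \<Longrightarrow> val x \<tau> b = length xs"
    and step: "\<And>y Y \<tau>. y \<in> set xs \<Longrightarrow> y \<notin> Y \<Longrightarrow> J Y \<tau> \<Longrightarrow> entry xs (reg \<tau> r) = y \<Longrightarrow>
       wp x c (\<lambda>\<rho>. J (insert y Y) \<rho> \<and> reg \<rho> r = reg \<tau> r \<and> clock \<rho> \<le> clock \<tau> + F y) \<tau>"
    and post: "\<And>\<tau>. J (set xs) \<tau> \<Longrightarrow>
       clock \<tau> \<le> clock \<sigma> + (\<Sum>y\<in>set xs. F y + cost b + 6) + cost b + 5 \<Longrightarrow> Q \<tau>"
  shows "wp x (For r b c) Q \<sigma>"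
proof (rule wp_For[where J = "\<lambda>i. J (set (take i xs))" and n = "length xs" and f = "\<lambda>i. F (xs ! i)"])
  fix i \<tau> assume i: "i < length xs" "J (set (take i xs)) \<tau>" "reg \<tau> r = i"
  have "xs ! i \<notin> set (take i xs)"
    using \<open>distinct xs\<close> i(1) by (auto simp: in_set_conv_nth nth_eq_iff_index_eq)
  with step[of "xs ! i" "set (take i xs)" \<tau>] i
  show "wp x c (\<lambda>\<rho>. J (set (take (Suc i) xs)) \<rho> \<and> reg \<rho> r = i \<and> clock \<rho> \<le> clock \<tau> + F (xs ! i)) \<tau>"
    by (simp add: entry_def take_Suc_conv_app_nth)
next
  fix \<tau> assume "J (set (take (length xs) xs)) \<tau>"
    and clock: "clock \<tau> \<le> clock \<sigma> + (\<Sum>i<length xs. F (xs ! i) + cost b + 6) + cost b + 5"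
  moreover have "(\<Sum>i<length xs. F (xs ! i) + cost b + 6) = (\<Sum>y\<in>set xs. F y + cost b + 6)"
    by (rule sum.reindex_bij_betw[OF bij_betw_nth]) (use \<open>distinct xs\<close> in auto)
  ultimately show "Q \<tau>" by (intro post) auto
qed (use assms in auto)

lemma exec_clock: "exec x c \<sigma> \<tau> \<Longrightarrow> clock \<sigma> \<le> clock \<tau>"
  by (induction rule: exec.induct) auto

lemma wp_clock: "wp x c Q \<sigma> \<Longrightarrow> wp x c (\<lambda>\<tau>. Q \<tau> \<and> clock \<sigma> \<le> clock \<tau>) \<sigma>"
  unfolding wp_def using exec_clock by blast

text \<open>Moves clock advances outwards and merges them into one, which normalises a straight-line
  prefix such as that of \<open>descend\<close>.\<close>

lemma tick_commute:
  "tick m (tick n \<sigma>) = tick (n + m) \<sigma>"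
  "set_reg r k (tick n \<sigma>) = tick n (set_reg r k \<sigma>)"
  "set_mem m i j k (tick n \<sigma>) = tick n (set_mem m i j k \<sigma>)"
  by (simp_all add: tick_def set_reg_def set_mem_def)

text \<open>\<open>R\<close> and \<open>M\<close> are the registers and arrays that may have
  changed. The clock is left out, so time bounds are stated separately.\<close>

definition frame :: "nat set \<Rightarrow> nat set \<Rightarrow> config \<Rightarrow> config \<Rightarrow> bool" where
  "frame R M \<sigma> \<tau> \<longleftrightarrow> (\<forall>r. r \<notin> R \<longrightarrow> reg \<tau> r = reg \<sigma> r) \<and> (\<forall>m. m \<notin> M \<longrightarrow> mem \<tau> m = mem \<sigma> m) \<and>
     pending \<tau> = pending \<sigma> \<and> outputs \<tau> = outputs \<sigma>"

lemma frame_refl [simp]: "frame R M \<sigma> \<sigma>"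
  by (simp add: frame_def)

lemma frame_trans: "frame R M \<sigma> \<tau> \<Longrightarrow> frame R' M' \<tau> \<rho> \<Longrightarrow> R \<subseteq> R'' \<Longrightarrow> R' \<subseteq> R'' \<Longrightarrow> M \<subseteq> M'' \<Longrightarrow> M' \<subseteq> M'' \<Longrightarrow>
  frame R'' M'' \<sigma> \<rho>"
  unfolding frame_def by (metis (no_types, lifting) subsetD)

lemma frame_update [simp]:
  "frame R M \<sigma> \<tau> \<Longrightarrow> frame R M \<sigma> (tick n \<tau>)"
  "frame R M \<sigma> \<tau> \<Longrightarrow> r \<in> R \<Longrightarrow> frame R M \<sigma> (set_reg r n \<tau>)"
  "frame R M \<sigma> \<tau> \<Longrightarrow> m \<in> M \<Longrightarrow> frame R M \<sigma> (set_mem m i j n \<tau>)"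
  by (auto simp: frame_def)

lemma frame_reg: "frame R M \<sigma> \<tau> \<Longrightarrow> r \<notin> R \<Longrightarrow> reg \<tau> r = reg \<sigma> r"
  and frame_mem: "frame R M \<sigma> \<tau> \<Longrightarrow> m \<notin> M \<Longrightarrow> mem \<tau> m = mem \<sigma> m"
  and frame_output: "frame R M \<sigma> \<tau> \<Longrightarrow> pending \<tau> = pending \<sigma>"
    "frame R M \<sigma> \<tau> \<Longrightarrow> outputs \<tau> = outputs \<sigma>"
  by (auto simp: frame_def)

section \<open>Shortest runs\<close>

locale problem =
  fixes x :: input and D :: "(nat, nat, nat) database" and A :: "(nat, nat) nfa" and s t :: nat
  assumes database: "database D" and nfa: "nfa A" and alphabet: "alphabet A = labels D"
    and s: "s \<in> verts D" and t: "t \<in> verts D" and presents: "presents x D A s t"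
begin

text \<open>The label is part of a move because the search meets an edge and two states once per
  suitable label; each meeting is a unit of work and a possible predecessor entry of its
  own.\<close>

definition moves :: "(nat \<times> nat \<times> nat \<times> nat) set" where
  "moves = {(e, p, a, q). e \<in> edges D \<and> a \<in> lbl D e \<and> (p, a, q) \<in> trans A}"

text \<open>The enumeration builds walks from their end, so edge sequences are listed last edge first.\<close>

primrec run :: "nat list \<Rightarrow> nat \<Rightarrow> nat \<Rightarrow> bool" where
  "run [] v q \<longleftrightarrow> v = s \<and> q \<in> initials A"
| "run (e # es) v q \<longleftrightarrow> tgt D e = v \<and> (\<exists>p a. (e, p, a, q) \<in> moves \<and> run es (src D e) p)"

definition reach :: "nat \<Rightarrow> nat \<Rightarrow> nat \<Rightarrow> bool" where
  "reach k v q \<longleftrightarrow> (\<exists>es. length es = k \<and> run es v q)"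

lemma reach_0 [simp]: "reach 0 v q \<longleftrightarrow> v = s \<and> q \<in> initials A"
  by (simp add: reach_def)

lemma reach_Suc: "reach (Suc k) v q \<longleftrightarrow>
    (\<exists>e p a. (e, p, a, q) \<in> moves \<and> tgt D e = v \<and> reach k (src D e) p)"
proof
  assume "reach (Suc k) v q"
  then obtain e es where "length es = k" "run (e # es) v q"
    by (auto simp: reach_def length_Suc_conv)
  then show "\<exists>e p a. (e, p, a, q) \<in> moves \<and> tgt D e = v \<and> reach k (src D e) p"
    by (auto simp: reach_def)
next
  assume "\<exists>e p a. (e, p, a, q) \<in> moves \<and> tgt D e = v \<and> reach k (src D e) p"
  then obtain e p a es where "(e, p, a, q) \<in> moves" "tgt D e = v" "length es = k" "run es (src D e) p"
    by (auto simp: reach_def)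
  then have "length (e # es) = Suc k \<and> run (e # es) v q" by auto
  then show "reach (Suc k) v q" unfolding reach_def by blast
qed

definition lev :: "nat \<Rightarrow> nat \<Rightarrow> nat \<Rightarrow> bool" where
  "lev k v q \<longleftrightarrow> reach k v q \<and> (\<forall>j<k. \<not> reach j v q)"

lemma lev_unique: "lev k v q \<Longrightarrow> lev l v q \<Longrightarrow> k = l"
  unfolding lev_def by (meson linorder_neqE_nat)

lemma reach_lev: "reach k v q \<Longrightarrow> \<exists>l\<le>k. lev l v q"
  unfolding lev_def
  by (intro exI[of _ "LEAST l. reach l v q"]) (auto intro: LeastI Least_le dest: not_less_Least)

text \<open>A shorter run to the source, prolonged by the move, would reach the target below its
  level. Hence runs of minimal length use only moves that rise by one level.\<close>

lemma lev_pred: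
  assumes "lev (Suc k) (tgt D e) q" "(e, p, a, q) \<in> moves" "reach k (src D e) p"
  shows "lev k (src D e) p"
proof -
  have "\<not> reach j (src D e) p" if "j < k" for j
  proof
    assume "reach j (src D e) p"
    then have "reach (Suc j) (tgt D e) q" using assms(2) by (auto simp: reach_Suc)
    with assms(1) that show False by (auto simp: lev_def)
  qed
  with assms(3) show ?thesis by (simp add: lev_def)
qed

lemma run_verts: "run es v q \<Longrightarrow> v \<in> verts D \<and> q \<in> states A"
  using database nfa s
  by (cases es) (force simp: database_def nfa_def moves_def)+

lemma lev_verts: "lev k v q \<Longrightarrow> v \<in> verts D \<and> q \<in> states A"
  by (auto simp: lev_def reach_def dest: run_verts)

text \<open>Predecessors keep their label: the machine stores one entry per pair
  \<open>(p, a)\<close>, and for a fixed edge the triples \<open>(p, a, q)\<close> are distinct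
  transitions, which is what \<open>sum_tight\<close> counts.\<close>

definition tight :: "nat \<Rightarrow> nat \<Rightarrow> (nat \<times> nat) set" where
  "tight e q = {(p, a). (e, p, a, q) \<in> moves \<and> (\<exists>k. lev k (src D e) p \<and> lev (Suc k) (tgt D e) q)}"

text \<open>A backward step of the subset construction, confined to tight moves.\<close>

definition stp :: "nat set \<Rightarrow> nat \<Rightarrow> nat set" where
  "stp S e = (\<Union>q\<in>S. fst ` tight e q)"

lemma stp_lev: "S \<subseteq> {q. lev (Suc l) (tgt D e) q} \<Longrightarrow> stp S e \<subseteq> {p. lev l (src D e) p}"
  unfolding stp_def tight_def by (auto dest: lev_unique)

text \<open>Reference list for the enumeration. It fixes the order of the outputs by the incoming
  arrays, so that the machine can be compared with it as a list.\<close>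

primrec branches :: "nat \<Rightarrow> nat \<Rightarrow> nat set \<Rightarrow> nat list list" where
  "branches 0 v S = [[]]"
| "branches (Suc l) v S = concat (map (\<lambda>e. if stp S e = {} then []
     else map ((#) e) (branches l (src D e) (stp S e))) (in_arr x v))"

lemma in_arr: "v \<in> verts D \<Longrightarrow> distinct (in_arr x v) \<and> set (in_arr x v) = {e \<in> edges D. tgt D e = v}"
  using presents by (auto simp: presents_def lists_set_def)

lemma out_arr: "v \<in> verts D \<Longrightarrow> distinct (out_arr x v) \<and> set (out_arr x v) = {e \<in> edges D. src D e = v}"
  using presents by (auto simp: presents_def lists_set_def)

lemma edge: "e \<in> edges D \<Longrightarrow> src D e \<in> verts D \<and> tgt D e \<in> verts D \<and> lbl D e \<subseteq> labels D"
  using database by (auto simp: database_def)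

text \<open>Since \<open>S\<close> lies on level \<open>l\<close>, a run of length \<open>l\<close>
  into \<open>S\<close> can use only tight moves by \<open>lev_pred\<close>, so nothing is lost by
  following \<open>stp\<close>. Nonemptiness of \<open>S\<close> matters at \<open>l = 0\<close>,
  where \<open>branches\<close> yields the empty sequence whatever \<open>S\<close> is.\<close>

lemma set_branches:
  assumes "S \<noteq> {}" "S \<subseteq> {q. lev l v q}"
  shows "set (branches l v S) = {es. length es = l \<and> (\<exists>q\<in>S. run es v q)}"
  using assms
proof (induction l arbitrary: v S)
  case 0
  then show ?case by (force simp: lev_def)
next
  case (Suc l)
  have v: "v \<in> verts D" using Suc.prems lev_verts by blast
  have *: "set (if stp S e = {} then [] else map ((#) e) (branches l (src D e) (stp S e))) =
    {es. \<exists>es'. es = e # es' \<and> length es' = l \<and> (\<exists>q\<in>S. run es v q)}" if e: "e \<in> set (in_arr x v)" for e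
  proof -
    have tgt: "tgt D e = v" "e \<in> edges D" using in_arr[OF v] e by auto
    have stp: "stp S e \<subseteq> {p. lev l (src D e) p}"
      using stp_lev[of S l e] Suc.prems tgt by simp
    have eq: "p \<in> stp S e \<longleftrightarrow> (\<exists>q\<in>S. \<exists>a. (e, p, a, q) \<in> moves \<and> lev l (src D e) p)" for p
    proof
      assume p: "p \<in> stp S e"
      then show "\<exists>q\<in>S. \<exists>a. (e, p, a, q) \<in> moves \<and> lev l (src D e) p"
        using stp by (force simp: stp_def tight_def)
    next
      assume "\<exists>q\<in>S. \<exists>a. (e, p, a, q) \<in> moves \<and> lev l (src D e) p"
      then show "p \<in> stp S e"
        using Suc.prems(2) tgt(1) by (force simp: stp_def tight_def)
    qed
    have run: "(\<exists>q\<in>S. run (e # es) v q) \<longleftrightarrow> (\<exists>p\<in>stp S e. run es (src D e) p)" if "length es = l" for es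
    proof -
      have "lev l (src D e) p" if "q \<in> S" "(e, p, a, q) \<in> moves" "run es (src D e) p" for p a q
        using lev_pred[of l e q p a] that Suc.prems tgt \<open>length es = l\<close> by (auto simp: reach_def)
      then show ?thesis using eq tgt by auto blast+
    qed
    have "set (if stp S e = {} then [] else map ((#) e) (branches l (src D e) (stp S e))) =
      {es. \<exists>es'. es = e # es' \<and> length es' = l \<and> (\<exists>p\<in>stp S e. run es' (src D e) p)}"
      using Suc.IH[of "stp S e" "src D e"] stp by (auto simp: image_iff)
    also have "\<dots> = {es. \<exists>es'. es = e # es' \<and> length es' = l \<and> (\<exists>q\<in>S. run es v q)}"
      by (intro Collect_cong ex_cong1 conj_cong refl) (simp only: run)
    finally show ?thesis .
  qed
  have "set (branches (Suc l) v S) = (\<Union>e\<in>set (in_arr x v). {es. \<exists>es'. es = e # es' \<and> length es' = l \<and> (\<exists>q\<in>S. run es v q)})"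
    unfolding branches.simps set_concat set_map image_image by (rule SUP_cong) (simp_all only: *)
  also have "\<dots> = {es. length es = Suc l \<and> (\<exists>q\<in>S. run es v q)}"
  proof -
    have "e \<in> set (in_arr x v)" if "run (e # es) v q" for e es q
      using that in_arr[OF v] by (auto simp: moves_def)
    then show ?thesis by (auto simp: length_Suc_conv simp del: run.simps)
  qed
  finally show ?case .
qed

text \<open>Blocks of different edges differ in the head of their sequences, and an edge occurs once
  in its incoming array. Sequences consist of edges alone, so several runs over the same edges give
  a single entry.\<close>

lemma distinct_branches: "S \<noteq> {} \<Longrightarrow> S \<subseteq> {q. lev l v q} \<Longrightarrow> distinct (branches l v S)"
proof (induction l arbitrary: v S)
  case (Suc l)
  have v: "v \<in> verts D" using Suc.prems lev_verts by blast
  have "distinct (branches l (src D e) (stp S e))" if "e \<in> set (in_arr x v)" "stp S e \<noteq> {}" for e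
    using that stp_lev[of S l e] Suc in_arr[OF v] by auto
  then show ?case
    unfolding branches.simps
    by (intro distinct_concat_map[where h = hd]) (auto simp: in_arr[OF v] distinct_map split: if_splits)
qed simp

text \<open>Each state of \<open>S\<close> has a run of length \<open>l\<close>, because
  \<open>lev\<close> contains \<open>reach\<close>. This is why the descent of the enumeration
  cannot fail.\<close>

lemma branches_nonempty: "S \<noteq> {} \<Longrightarrow> S \<subseteq> {q. lev l v q} \<Longrightarrow> branches l v S \<noteq> []"
proof -
  assume S: "S \<noteq> {}" "S \<subseteq> {q. lev l v q}"
  then obtain q es where "q \<in> S" "length es = l" "run es v q"
    by (force simp: lev_def reach_def)
  with set_branches[OF S] show ?thesis by force
qed

text \<open>Follows a run of minimal length backwards. That no level is skipped is what bounds
  \<open>l\<close> in \<open>level_bound\<close>.\<close>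

lemma lev_below: "lev l v q \<Longrightarrow> m \<le> l \<Longrightarrow> \<exists>v q. lev m v q"
proof (induction l arbitrary: v q)
  case (Suc l)
  show ?case
  proof (cases "m = Suc l")
    case False
    obtain e p a where "(e, p, a, q) \<in> moves" "tgt D e = v" "reach l (src D e) p"
      using Suc.prems by (auto simp: lev_def reach_Suc)
    then have "lev l (src D e) p" using lev_pred Suc.prems by blast
    with Suc False show ?thesis by (meson le_SucE)
  qed (use Suc in auto)
qed auto

section \<open>Edge sequences versus walks and automaton runs\<close>

definition path :: "nat list \<Rightarrow> nat list" where
  "path es = rev (t # map (src D) es)"

text \<open>Position-wise counterpart of \<open>run\<close> in the terms of \<open>lang\<close> and
  \<open>walk_lbl\<close>; the last state is a parameter, so that edges can be taken off one by one
  at the end.\<close>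

definition autorun :: "nat list \<Rightarrow> nat \<Rightarrow> bool" where
  "autorun es q \<longleftrightarrow> (\<exists>as qs. length as = length es \<and> (\<forall>i<length as. as ! i \<in> lbl D (es ! i)) \<and>
     length qs = Suc (length as) \<and> hd qs \<in> initials A \<and> last qs = q \<and>
     (\<forall>i<length as. (qs ! i, as ! i, qs ! Suc i) \<in> trans A))"

lemma autorun_Nil: "autorun [] q \<longleftrightarrow> q \<in> initials A"
proof
  assume "q \<in> initials A"
  then show "autorun [] q" unfolding autorun_def
    by (intro exI[of _ "[]"] exI[of _ "[q]"]) simp
qed (auto simp: autorun_def length_Suc_conv)

lemma autorun_snoc:
  "autorun (es @ [e]) q \<longleftrightarrow> (\<exists>p a. autorun es p \<and> a \<in> lbl D e \<and> (p, a, q) \<in> trans A)"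
proof
  assume "autorun (es @ [e]) q"
  then obtain as qs where *: "length as = Suc (length es)" "\<forall>i<length as. as ! i \<in> lbl D ((es @ [e]) ! i)"
    "length qs = Suc (length as)" "hd qs \<in> initials A" "last qs = q"
    "\<forall>i<length as. (qs ! i, as ! i, qs ! Suc i) \<in> trans A"
    by (auto simp: autorun_def)
  obtain as' a where as: "as = as' @ [a]" using *(1) by (cases as rule: rev_cases) auto
  obtain qs' q' where qs: "qs = qs' @ [q']" using *(3) by (cases qs rule: rev_cases) auto
  have len: "length as' = length es" "length qs' = Suc (length as')" using * as qs by auto
  then have ne: "qs' \<noteq> []" by auto
  have "as' ! i \<in> lbl D (es ! i) \<and> (qs' ! i, as' ! i, qs' ! Suc i) \<in> trans A" if "i < length as'" for i
    using *(2)[rule_format, of i] *(6)[rule_format, of i] len as qs that by (auto simp: nth_append)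
  then have "autorun es (last qs')"
    unfolding autorun_def using *(4) qs ne len
    by (intro exI[of _ as'] exI[of _ qs']) simp
  moreover have "a \<in> lbl D e" using *(2)[rule_format, of "length es"] as len by (simp add: nth_append)
  moreover have "(last qs', a, q) \<in> trans A"
    using *(6)[rule_format, of "length es"] *(5) as qs len ne by (simp add: nth_append last_conv_nth)
  ultimately show "\<exists>p a. autorun es p \<and> a \<in> lbl D e \<and> (p, a, q) \<in> trans A" by blast
next
  assume "\<exists>p a. autorun es p \<and> a \<in> lbl D e \<and> (p, a, q) \<in> trans A"
  then obtain p a as qs where *: "length as = length es" "\<forall>i<length as. as ! i \<in> lbl D (es ! i)"
     "length qs = Suc (length as)" "hd qs \<in> initials A" "last qs = p"
     "\<forall>i<length as. (qs ! i, as ! i, qs ! Suc i) \<in> trans A" "a \<in> lbl D e" "(p, a, q) \<in> trans A"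
    by (auto simp: autorun_def)
  then have ne: "qs \<noteq> []" by auto
  with * have p: "qs ! length es = p" by (simp add: last_conv_nth)
  have "(as @ [a]) ! i \<in> lbl D ((es @ [e]) ! i) \<and>
      ((qs @ [q]) ! i, (as @ [a]) ! i, (qs @ [q]) ! Suc i) \<in> trans A" if "i < length (as @ [a])" for i
    using that * p by (auto simp: nth_append less_Suc_eq)
  then show "autorun (es @ [e]) q"
    unfolding autorun_def using * ne
    by (intro exI[of _ "as @ [a]"] exI[of _ "qs @ [q]"]) simp
qed

lemma walk_snoc:
  assumes "vs \<noteq> []"
  shows "walk D (vs @ [v], es @ [e]) \<longleftrightarrow> walk D (vs, es) \<and> e \<in> edges D \<and> src D e = last vs \<and> tgt D e = v"
proof (cases "length vs = Suc (length es)")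
  case True
  then have last: "last vs = vs ! length es" using assms by (simp add: last_conv_nth)
  have all: "(\<forall>i<Suc (length es). P i) \<longleftrightarrow> (\<forall>i<length es. P i) \<and> P (length es)" for P
    by (auto simp: less_Suc_eq)
  have nth: "(\<forall>i<length es. src D ((es @ [e]) ! i) = (vs @ [v]) ! i \<and> tgt D ((es @ [e]) ! i) = (vs @ [v]) ! Suc i) \<longleftrightarrow>
    (\<forall>i<length es. src D (es ! i) = vs ! i \<and> tgt D (es ! i) = vs ! Suc i)"
    using True by (simp add: nth_append)
  show ?thesis
    using True edge unfolding walk_def last prod.case length_append_singleton all nth
    by (auto simp: nth_append)
qed (simp add: walk_def)

text \<open>The vertices of a walk are the sources of its edges followed by its end, so edges and
  end vertex determine the walk. The induction appends edges at the end because \<open>run\<close>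
  takes off the last one.\<close>

lemma run_iff:
  "walk D (vs, es) \<and> hd vs = s \<and> last vs = v \<and> autorun es q \<longleftrightarrow>
     vs = rev (v # map (src D) (rev es)) \<and> run (rev es) v q"
proof (induction es arbitrary: vs v q rule: rev_induct)
  case Nil
  show ?case using s by (auto simp: walk_def autorun_Nil length_Suc_conv)
next
  case (snoc e es)
  show ?case
  proof (cases "\<exists>vs'. vs = vs' @ [v] \<and> vs' \<noteq> []")
    case True
    then obtain vs' where vs: "vs = vs' @ [v]" "vs' \<noteq> []" by blast
    have "walk D (vs, es @ [e]) \<and> hd vs = s \<and> last vs = v \<and> autorun (es @ [e]) q \<longleftrightarrow>
      (\<exists>p a. (walk D (vs', es) \<and> hd vs' = s \<and> last vs' = src D e \<and> autorun es p) \<and> tgt D e = v \<and> (e, p, a, q) \<in> moves)"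
      using vs by (auto simp: walk_snoc autorun_snoc moves_def)
    also have "\<dots> \<longleftrightarrow> vs = rev (v # map (src D) (rev (es @ [e]))) \<and> run (rev (es @ [e])) v q"
      unfolding snoc.IH using vs by auto
    finally show ?thesis .
  next
    case False
    have "\<not> (walk D (vs, es @ [e]) \<and> last vs = v)"
      using False by (cases vs rule: rev_cases) (auto simp: walk_def)
    with False show ?thesis by auto
  qed
qed

lemma matches_iff: "matches D A (vs, es) \<longleftrightarrow> (\<exists>q\<in>finals A. autorun es q)"
proof -
  have "as \<in> lang A \<inter> walk_lbl D (vs, es) \<longleftrightarrow> (\<exists>q\<in>finals A. \<exists>qs. length as = length es \<and>
     (\<forall>i<length as. as ! i \<in> lbl D (es ! i)) \<and> length qs = Suc (length as) \<and> hd qs \<in> initials A \<and>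
     last qs = q \<and> (\<forall>i<length as. (qs ! i, as ! i, qs ! Suc i) \<in> trans A))" for as
    unfolding lang_def walk_lbl_def by auto
  then show ?thesis unfolding matches_def autorun_def ex_in_conv[symmetric] by blast
qed

lemma matching_walks_eq:
  "matching_walks D A s t = (\<lambda>es. (path es, rev es)) ` {es. \<exists>q\<in>finals A. run es t q}"
proof (intro set_eqI iffI)
  fix w assume "w \<in> matching_walks D A s t"
  moreover obtain vs es where "w = (vs, es)" by force
  ultimately obtain q where "q \<in> finals A" "walk D (vs, es) \<and> hd vs = s \<and> last vs = t \<and> autorun es q"
    by (auto simp: matching_walks_def matches_iff walk_src_def walk_tgt_def)
  with \<open>w = (vs, es)\<close> show "w \<in> (\<lambda>es. (path es, rev es)) ` {es. \<exists>q\<in>finals A. run es t q}"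
    unfolding run_iff by (intro image_eqI[of _ _ "rev es"]) (auto simp: path_def)
next
  fix w assume "w \<in> (\<lambda>es. (path es, rev es)) ` {es. \<exists>q\<in>finals A. run es t q}"
  then obtain es q where *: "w = (path es, rev es)" "q \<in> finals A" "run es t q" by blast
  then have "walk D w \<and> hd (fst w) = s \<and> last (fst w) = t \<and> autorun (snd w) q"
    using run_iff[of "path es" "rev es" t q] by (simp add: path_def)
  with * show "w \<in> matching_walks D A s t"
    by (auto simp: matching_walks_def matches_iff walk_src_def walk_tgt_def)
qed

lemma no_shortest_walks:
  assumes "\<And>q k. q \<in> finals A \<Longrightarrow> \<not> reach k t q"
  shows "shortest_walks D A s t = {}"
  using assms by (auto simp: shortest_walks_def matching_walks_eq reach_def)

text \<open>A run of length \<open>l\<close> to \<open>t\<close> into a final state puts that state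
  on a level at most \<open>l\<close>, and \<open>min\<close> forbids a smaller one. So exactly the
  states of \<open>S\<close> can accept a shortest walk, and \<open>set_branches\<close>
  applies.\<close>

lemma shortest_walks_eq:
  assumes q: "q \<in> finals A" "lev l t q" and min: "\<And>q k. q \<in> finals A \<Longrightarrow> lev k t q \<Longrightarrow> l \<le> k"
  defines "S \<equiv> {q \<in> finals A. lev l t q}"
  shows "shortest_length D A s t = l"
    and "shortest_walks D A s t = (\<lambda>es. (path es, rev es)) ` set (branches l t S)"
proof -
  have iff: "(\<exists>w\<in>matching_walks D A s t. walk_length w = k) \<longleftrightarrow> (\<exists>q\<in>finals A. reach k t q)" for k
    by (auto simp: matching_walks_eq walk_length_def reach_def)
  show len: "shortest_length D A s t = l"
    unfolding shortest_length_def iff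
  proof (rule Least_equality)
    show "\<exists>q\<in>finals A. reach l t q" using q by (auto simp: lev_def)
    fix k assume "\<exists>q\<in>finals A. reach k t q"
    then show "l \<le> k" using min reach_lev by (meson le_trans)
  qed
  have "lev l t q" if "length es = l" "run es t q" "q \<in> finals A" for es q
  proof -
    have "reach l t q" using that by (auto simp: reach_def)
    then obtain k where "k \<le> l" "lev k t q" using reach_lev by blast
    with min[OF that(3)] show ?thesis by (metis le_antisym)
  qed
  moreover have "set (branches l t S) = {es. length es = l \<and> (\<exists>q\<in>S. run es t q)}"
    by (rule set_branches) (use q in \<open>auto simp: S_def\<close>)
  ultimately have "set (branches l t S) = {es. (\<exists>q\<in>finals A. run es t q) \<and> length es = l}"
    by (auto simp: S_def)
  then show "shortest_walks D A s t = (\<lambda>es. (path es, rev es)) ` set (branches l t S)"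
    by (auto simp: shortest_walks_def len matching_walks_eq walk_length_def)
qed

section \<open>Invariants of the breadth-first search\<close>

text \<open>
  \<open>d\<close> holds the distance plus one, as memory is initially zero; \<open>P\<close> is the set of moves
  processed so far.
\<close>

definition queue_inv :: "(nat \<Rightarrow> nat \<Rightarrow> nat) \<Rightarrow> (nat \<Rightarrow> nat \<Rightarrow> nat) \<Rightarrow> (nat \<Rightarrow> nat \<Rightarrow> nat) \<Rightarrow>
    nat \<Rightarrow> nat \<Rightarrow> (nat \<times> nat \<times> nat \<times> nat) set \<Rightarrow> bool" where
  "queue_inv d qv qq n h P \<longleftrightarrow>
     (\<forall>v q. d v q > 0 \<longleftrightarrow> (\<exists>k<n. qv k 0 = v \<and> qq k 0 = q)) \<and>
     inj_on (\<lambda>k. (qv k 0, qq k 0)) {..<n} \<and>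
     (\<forall>i j. i \<le> j \<longrightarrow> j < n \<longrightarrow> d (qv i 0) (qq i 0) \<le> d (qv j 0) (qq j 0)) \<and>
     (h < n \<longrightarrow> (\<forall>j<n. d (qv j 0) (qq j 0) \<le> Suc (d (qv h 0) (qq h 0)))) \<and>
     (\<forall>v q. d v q > 0 \<longrightarrow> reach (d v q - 1) v q) \<and>
     (\<forall>q\<in>initials A. d s q = 1) \<and>
     P \<subseteq> moves \<and>
     (\<forall>e p a q. (e, p, a, q) \<in> P \<longrightarrow>
        d (src D e) p > 0 \<and> d (tgt D e) q > 0 \<and> d (tgt D e) q \<le> Suc (d (src D e) p))"

text \<open>The new pair gets the distance of the head plus one, the largest value that the
  invariant allows in the queue, so appending it keeps the queue sorted. The written cell was zero,
  so neither older pairs nor processed moves see a change.\<close>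

lemma queue_inv_new:
  assumes inv: "queue_inv d qv qq n h P" and h: "h < n" and new: "d (tgt D e) q = 0"
    and move: "(e, p, a, q) \<in> moves" "qv h 0 = src D e" "qq h 0 = p"
  shows "queue_inv (d(tgt D e := (d (tgt D e))(q := Suc (d (src D e) p))))
    (qv(n := (qv n)(0 := tgt D e))) (qq(n := (qq n)(0 := q))) (Suc n) h P"
proof -
  let ?v = "tgt D e" and ?d = "d(tgt D e := (d (tgt D e))(q := Suc (d (src D e) p)))"
  let ?qv = "qv(n := (qv n)(0 := tgt D e))" and ?qq = "qq(n := (qq n)(0 := q))"
  note inv = inv[unfolded queue_inv_def]
  have dh: "d (src D e) p > 0" using inv h move by metis
  have old: "\<not> (qv k 0 = ?v \<and> qq k 0 = q)" if "k < n" for k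
    using inv new that by (metis less_numeral_extra(3))
  have d_old: "?d (?qv k 0) (?qq k 0) = d (qv k 0) (qq k 0)" if "k < n" for k
    using old[OF that] that by auto
  have d_new: "?d (?qv n 0) (?qq n 0) = Suc (d (src D e) p)" by simp
  have d_eq: "?d v' q' = (if v' = ?v \<and> q' = q then Suc (d (src D e) p) else d v' q')" for v' q' by auto
  have pos: "?d v' q' > 0 \<longleftrightarrow> v' = ?v \<and> q' = q \<or> d v' q' > 0" for v' q' by auto
  show ?thesis
    unfolding queue_inv_def
  proof (intro conjI allI impI ballI)
    fix v' q'
    have "?d v' q' > 0 \<longleftrightarrow> v' = ?v \<and> q' = q \<or> (\<exists>k<n. qv k 0 = v' \<and> qq k 0 = q')"
      unfolding pos using inv by simp
    also have "\<dots> \<longleftrightarrow> (\<exists>k<Suc n. ?qv k 0 = v' \<and> ?qq k 0 = q')"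
      by (auto simp: less_Suc_eq)
    finally show "?d v' q' > 0 \<longleftrightarrow> (\<exists>k<Suc n. ?qv k 0 = v' \<and> ?qq k 0 = q')" .
  next
    show "inj_on (\<lambda>k. (?qv k 0, ?qq k 0)) {..<Suc n}"
      unfolding lessThan_Suc inj_on_insert
    proof
      have "inj_on (\<lambda>k. (qv k 0, qq k 0)) {..<n}" using inv by blast
      then show "inj_on (\<lambda>k. (?qv k 0, ?qq k 0)) {..<n}" by (rule inj_on_cong[THEN iffD1, rotated]) auto
      show "(?qv n 0, ?qq n 0) \<notin> (\<lambda>k. (?qv k 0, ?qq k 0)) ` ({..<n} - {n})"
        using old by force
    qed
  next
    fix i j :: nat assume ij: "i \<le> j" "j < Suc n"
    show "?d (?qv i 0) (?qq i 0) \<le> ?d (?qv j 0) (?qq j 0)"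
    proof (cases "j = n")
      case True
      show ?thesis
      proof (cases "i = n")
        case False
        then have "i < n" using ij True by simp
        have "d (qv i 0) (qq i 0) \<le> Suc (d (qv h 0) (qq h 0))" using inv h \<open>i < n\<close> by blast
        then show ?thesis using d_old[OF \<open>i < n\<close>] d_new move True by simp
      qed (use True in simp)
    next
      case False
      then have "i < n" "j < n" using ij by auto
      moreover have "d (qv i 0) (qq i 0) \<le> d (qv j 0) (qq j 0)" using inv ij \<open>j < n\<close> by blast
      ultimately show ?thesis using d_old by simp
    qed
  next
    fix j assume j: "j < Suc n"
    show "?d (?qv j 0) (?qq j 0) \<le> Suc (?d (?qv h 0) (?qq h 0))"
    proof (cases "j = n")
      case False
      then have "j < n" using j by simp
      moreover from this have "d (qv j 0) (qq j 0) \<le> Suc (d (qv h 0) (qq h 0))" using inv h by blast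
      ultimately show ?thesis using d_old h by simp
    qed (use d_old[OF h] d_new move in simp)
  next
    fix v' q' assume v': "?d v' q' > 0"
    show "reach (?d v' q' - 1) v' q'"
    proof (cases "v' = ?v \<and> q' = q")
      case True
      have "reach (d (src D e) p - 1) (src D e) p" using inv dh by blast
      then have "reach (Suc (d (src D e) p - 1)) ?v q" using move by (auto simp: reach_Suc)
      then show ?thesis using True dh by simp
    next
      case False
      then have "d v' q' > 0" using v' pos by blast
      then have "reach (d v' q' - 1) v' q'" using inv by blast
      then show ?thesis using False by (simp only: d_eq if_False)
    qed
  next
    fix q' assume "q' \<in> initials A"
    then have "d s q' = 1" using inv by blast
    then show "?d s q' = 1" using new by auto
  next
    show "P \<subseteq> moves" using inv by blast
  next
    fix e' p' a' q' assume "(e', p', a', q') \<in> P"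
    then have *: "d (src D e') p' > 0 \<and> d (tgt D e') q' > 0 \<and> d (tgt D e') q' \<le> Suc (d (src D e') p')"
      using inv by blast
    then have "\<not> (src D e' = ?v \<and> p' = q)" "\<not> (tgt D e' = ?v \<and> q' = q)" using new by auto
    then have "?d (src D e') p' = d (src D e') p'" "?d (tgt D e') q' = d (tgt D e') q'" by auto
    with * show "?d (src D e') p' > 0" "?d (tgt D e') q' > 0" "?d (tgt D e') q' \<le> Suc (?d (src D e') p')"
      by simp_all
  qed
qed

text \<open>The inequality for the new move holds because its target is already in the queue, where
  no distance exceeds that of the head by more than one.\<close>

lemma queue_inv_move:
  assumes inv: "queue_inv d qv qq n h P" and h: "h < n" and "d (tgt D e) q > 0"
    and move: "(e, p, a, q) \<in> moves" "qv h 0 = src D e" "qq h 0 = p"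
  shows "queue_inv d qv qq n h (insert (e, p, a, q) P)"
proof -
  note inv' = inv[unfolded queue_inv_def]
  have "d (src D e) p > 0" using inv' h move by metis
  moreover obtain k where "k < n" "qv k 0 = tgt D e" "qq k 0 = q" using inv' assms(3) by blast
  then have "d (tgt D e) q \<le> Suc (d (src D e) p)" using inv' h move by metis
  ultimately show ?thesis using inv assms(3) move(1) unfolding queue_inv_def by auto
qed

lemma queue_inv_next:
  assumes inv: "queue_inv d qv qq n h P" and h: "h < n"
  shows "queue_inv d qv qq n (Suc h) P"
proof -
  note inv' = inv[unfolded queue_inv_def]
  have "d (qv j 0) (qq j 0) \<le> Suc (d (qv (Suc h) 0) (qq (Suc h) 0))" if "j < n" "Suc h < n" for j
  proof -
    have "d (qv j 0) (qq j 0) \<le> Suc (d (qv h 0) (qq h 0))" using inv' h that by blast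
    also have "\<dots> \<le> Suc (d (qv (Suc h) 0) (qq (Suc h) 0))" using inv' that by simp
    finally show ?thesis .
  qed
  then have "Suc h < n \<longrightarrow> (\<forall>j<n. d (qv j 0) (qq j 0) \<le> Suc (d (qv (Suc h) 0) (qq (Suc h) 0)))"
    by blast
  with inv show ?thesis unfolding queue_inv_def by (elim conjE, intro conjI)
qed

text \<open>\<open>d v q - 1\<close> is always the length of some run, hence not below the level.
  Conversely, induction along a run bounds \<open>d\<close> by its length plus one, since each of
  its moves has been processed.\<close>

lemma queue_inv_final:
  assumes inv: "queue_inv d qv qq n h P"
    and all: "\<And>e p a q. (e, p, a, q) \<in> moves \<Longrightarrow> d (src D e) p > 0 \<Longrightarrow> (e, p, a, q) \<in> P"
  shows "d v q = Suc k \<longleftrightarrow> lev k v q"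
proof -
  note inv = inv[unfolded queue_inv_def]
  have complete: "d v q > 0 \<and> d v q \<le> Suc k" if "reach k v q" for k v q
    using that
  proof (induction k arbitrary: v q)
    case 0
    then show ?case using inv by auto
  next
    case (Suc k)
    then obtain e p a where *: "(e, p, a, q) \<in> moves" "tgt D e = v" "reach k (src D e) p"
      by (auto simp: reach_Suc)
    with Suc.IH have d: "d (src D e) p > 0" "d (src D e) p \<le> Suc k" by auto
    with all * have "(e, p, a, q) \<in> P" by blast
    then have "d (tgt D e) q > 0 \<and> d (tgt D e) q \<le> Suc (d (src D e) p)" using inv by blast
    with d * show ?case by auto
  qed
  show ?thesis
  proof
    assume d: "d v q = Suc k"
    then have "reach k v q" using inv by (metis diff_Suc_1 zero_less_Suc)
    with d complete show "lev k v q" unfolding lev_def by (metis Suc_le_mono not_le)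
  next
    assume "lev k v q"
    then have lev: "reach k v q" "\<And>j. j < k \<Longrightarrow> \<not> reach j v q" by (auto simp: lev_def)
    with complete have d: "d v q > 0" "d v q \<le> Suc k" by auto
    then have "reach (d v q - 1) v q" using inv by blast
    with lev have "\<not> d v q - 1 < k" by blast
    with d show "d v q = Suc k" by simp
  qed
qed

text \<open>Queue entries are distinct pairs of the product, so a cost charged per entry is bounded
  by a sum over the product; the bound on the queue length also gives termination of the
  search.\<close>

lemma queue_inv_card:
  fixes f :: "nat \<Rightarrow> nat \<Rightarrow> nat"
  assumes "queue_inv d qv qq n h P"
  shows "(\<lambda>k. (qv k 0, qq k 0)) ` {..<n} \<subseteq> verts D \<times> states A" (is "?f ` _ \<subseteq> _")
    and "n \<le> card (verts D \<times> states A)"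
    and "(\<Sum>k<n. f (qv k 0) (qq k 0)) \<le> (\<Sum>v\<in>verts D. \<Sum>q\<in>states A. f v q)"
proof -
  note inv = assms[unfolded queue_inv_def]
  have fin: "finite (verts D \<times> states A)" using database nfa by (auto simp: database_def nfa_def)
  show sub: "?f ` {..<n} \<subseteq> verts D \<times> states A"
  proof (rule image_subsetI)
    fix k assume "k \<in> {..<n}"
    then have "k < n" by simp
    then have "d (qv k 0) (qq k 0) > 0" using inv by blast
    then have "reach (d (qv k 0) (qq k 0) - 1) (qv k 0) (qq k 0)" using inv by blast
    then show "(qv k 0, qq k 0) \<in> verts D \<times> states A" by (auto simp: reach_def dest: run_verts)
  qed
  have inj: "inj_on ?f {..<n}" using inv by blast
  show "n \<le> card (verts D \<times> states A)"
    using card_inj_on_le[OF inj sub fin] by simp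
  have "(\<Sum>k<n. f (qv k 0) (qq k 0)) = (\<Sum>(v, q)\<in>?f ` {..<n}. f v q)"
    by (simp add: sum.reindex[OF inj])
  also have "\<dots> \<le> (\<Sum>(v, q)\<in>verts D \<times> states A. f v q)"
    by (rule sum_mono2[OF fin sub]) simp
  finally show "(\<Sum>k<n. f (qv k 0) (qq k 0)) \<le> (\<Sum>v\<in>verts D. \<Sum>q\<in>states A. f v q)"
    by (simp add: sum.cartesian_product)
qed

text \<open>Approximates \<open>tight\<close> during the search from the distances and moves known
  so far; the two agree at the end by \<open>good_final\<close>.\<close>

definition good :: "(nat \<Rightarrow> nat \<Rightarrow> nat) \<Rightarrow> (nat \<times> nat \<times> nat \<times> nat) set \<Rightarrow> nat \<Rightarrow> nat \<Rightarrow> (nat \<times> nat) set" where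
  "good d P e q = {(p, a). (e, p, a, q) \<in> P \<and> d (tgt D e) q = Suc (d (src D e) p)}"

text \<open>
  Predecessor lists are indexed by an edge and a state, which leaves no dimension for the position
  in the list; \<open>ids\<close> numbers the pairs with a nonempty list. The number 0 stands for the
  empty list, so loops over a list need no case distinction.
\<close>

definition store_inv :: "(nat \<Rightarrow> nat \<Rightarrow> nat) \<Rightarrow> (nat \<Rightarrow> nat \<Rightarrow> nat) \<Rightarrow> nat \<Rightarrow> (nat \<Rightarrow> nat \<Rightarrow> nat) \<Rightarrow>
    (nat \<Rightarrow> nat \<Rightarrow> nat) \<Rightarrow> (nat \<times> nat \<times> nat \<times> nat) set \<Rightarrow> bool" where
  "store_inv d ids c K B P \<longleftrightarrow>
     (\<forall>e q. ids e q \<le> c) \<and>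
     (\<forall>e q e' q'. ids e q = ids e' q' \<longrightarrow> ids e q \<noteq> 0 \<longrightarrow> e = e' \<and> q = q') \<and>
     (\<forall>i. i = 0 \<or> c < i \<longrightarrow> K i 0 = 0) \<and>
     (\<forall>e q. ids e q = 0 \<longleftrightarrow> good d P e q = {}) \<and>
     (\<forall>e q. K (ids e q) 0 = card (good d P e q)) \<and>
     (\<forall>e q. B (ids e q) ` {..<K (ids e q) 0} = fst ` good d P e q)"

lemma store_inv_cong:
  assumes "store_inv d ids c K B P" "good d' P' = good d P"
  shows "store_inv d' ids c K B P'"
  using assms(1) unfolding store_inv_def assms(2) .

lemma finite_moves: "finite moves"
proof -
  have "moves \<subseteq> edges D \<times> states A \<times> alphabet A \<times> states A"
    using nfa by (auto simp: moves_def nfa_def)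
  moreover have "finite (edges D \<times> states A \<times> alphabet A \<times> states A)"
    using database nfa by (auto simp: database_def nfa_def)
  ultimately show ?thesis by (rule finite_subset)
qed

lemma finite_good: "P \<subseteq> moves \<Longrightarrow> finite (good d P e q)"
  by (rule finite_subset[OF _ finite_imageI[of moves "\<lambda>(e, p, a, q). (p, a)"]])
    (force simp: good_def finite_moves)+

text \<open>A first predecessor and a further one are treated alike: the fresh number
  \<open>Suc c\<close> has an empty row because counts beyond \<open>c\<close> are zero.
  \<open>fresh\<close> makes the count grow together with the cardinality.\<close>

lemma store_inv_push:
  assumes inv: "store_inv d ids c K B P" and P: "P \<subseteq> moves" and fresh: "(e, p, a, q) \<notin> P"
    and tight: "d (tgt D e) q = Suc (d (src D e) p)"
    and ids': "ids' = (if ids e q = 0 then ids(e := (ids e)(q := Suc c)) else ids)"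
    and c': "c' = (if ids e q = 0 then Suc c else c)"
    and i: "i = ids' e q"
  shows "store_inv d ids' c' (K(i := (K i)(0 := Suc (K i 0)))) (B(i := (B i)(K i 0 := p)))
    (insert (e, p, a, q) P)"
proof -
  from inv have
    "\<forall>e q. ids e q \<le> c"
    "\<forall>e q e' q'. ids e q = ids e' q' \<longrightarrow> ids e q \<noteq> 0 \<longrightarrow> e = e' \<and> q = q'"
    "\<forall>i. i = 0 \<or> c < i \<longrightarrow> K i 0 = 0"
    "\<forall>e q. ids e q = 0 \<longleftrightarrow> good d P e q = {}"
    "\<forall>e q. K (ids e q) 0 = card (good d P e q)"
    "\<forall>e q. B (ids e q) ` {..<K (ids e q) 0} = fst ` good d P e q"
    unfolding store_inv_def by - (elim conjE, assumption)+
  note le = this(1)[rule_format] and inj = this(2)[rule_format] and unused = this(3)[rule_format]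
    and nil = this(4)[rule_format] and count = this(5)[rule_format] and entries = this(6)[rule_format]
  let ?P = "insert (e, p, a, q) P"
  let ?K = "K(i := (K i)(0 := Suc (K i 0)))" and ?B = "B(i := (B i)(K i 0 := p))"
  have good: "good d ?P e' q' = (if e' = e \<and> q' = q then insert (p, a) (good d P e q) else good d P e' q')" for e' q'
    using tight by (auto simp: good_def)
  have new: "(p, a) \<notin> good d P e q" using fresh by (simp add: good_def)
  have fin: "finite (good d P e q)" by (rule finite_good[OF P])
  have ids_other: "ids' e' q' = ids e' q'" if "\<not> (e' = e \<and> q' = q)" for e' q'
    using that by (auto simp: ids')
  have i_pos: "i \<noteq> 0" by (auto simp: i ids')
  have neq: "ids e' q' \<noteq> i" if "\<not> (e' = e \<and> q' = q)" for e' q'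
  proof (cases "ids e q = 0")
    case True
    then have "i = Suc c" by (simp add: i ids')
    with le[of e' q'] show ?thesis by simp
  next
    case False
    then have "i = ids e q" by (simp add: i ids')
    then show ?thesis using inj[of e q e' q'] False that by auto
  qed
  have K_i: "K i 0 = card (good d P e q)" and B_i: "B i ` {..<K i 0} = fst ` good d P e q"
  proof -
    have "K i 0 = card (good d P e q) \<and> B i ` {..<K i 0} = fst ` good d P e q"
    proof (cases "ids e q = 0")
      case True
      then have "i = Suc c" by (simp add: i ids')
      then have "K i 0 = 0" using unused by simp
      moreover have "good d P e q = {}" using nil True by simp
      ultimately show ?thesis by simp
    next
      case False
      then have "i = ids e q" by (simp add: i ids')
      then show ?thesis using count entries by simp
    qed
    then show "K i 0 = card (good d P e q)" "B i ` {..<K i 0} = fst ` good d P e q"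
      by - (elim conjE, assumption)+
  qed
  show ?thesis
    unfolding store_inv_def
  proof (intro conjI allI impI)
    fix e' q' show "ids' e' q' \<le> c'" using le by (auto simp: ids' c' le_SucI)
  next
    fix e1 q1 e2 q2 assume *: "ids' e1 q1 = ids' e2 q2" "ids' e1 q1 \<noteq> 0"
    have "(e1 = e \<and> q1 = q) = (e2 = e \<and> q2 = q)"
      using * neq[of e1 q1] neq[of e2 q2] ids_other[of e1 q1] ids_other[of e2 q2] i
      by (cases "e1 = e \<and> q1 = q"; cases "e2 = e \<and> q2 = q"; force)
    moreover have "e1 = e2 \<and> q1 = q2" if "\<not> (e1 = e \<and> q1 = q)" "\<not> (e2 = e \<and> q2 = q)"
      using inj[of e1 q1 e2 q2] * ids_other that by auto
    ultimately show "e1 = e2" "q1 = q2" by blast+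
  next
    fix j assume "j = 0 \<or> c' < j"
    moreover have "i \<le> c'" using le by (auto simp: i ids' c')
    ultimately have "j \<noteq> i" "j = 0 \<or> c < j" using i_pos by (auto simp: c' split: if_splits)
    then show "?K j 0 = 0" using unused by simp
  next
    fix e' q' show "ids' e' q' = 0 \<longleftrightarrow> good d ?P e' q' = {}"
      using i i_pos ids_other nil by (cases "e' = e \<and> q' = q") (auto simp: good)
  next
    fix e' q' show "?K (ids' e' q') 0 = card (good d ?P e' q')"
    proof (cases "e' = e \<and> q' = q")
      case True
      then show ?thesis using i K_i new fin by (auto simp: good)
    next
      case False
      then show ?thesis using ids_other[of e' q'] neq[of e' q'] count[of e' q'] by (auto simp: good)
    qed
  next
    fix e' q' show "?B (ids' e' q') ` {..<?K (ids' e' q') 0} = fst ` good d ?P e' q'"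
    proof (cases "e' = e \<and> q' = q")
      case True
      have "?B i ` {..<Suc (K i 0)} = insert p (B i ` {..<K i 0})"
        unfolding lessThan_Suc by auto
      then show ?thesis using True i B_i by (auto simp: good)
    next
      case False
      then show ?thesis using ids_other[of e' q'] neq[of e' q'] entries[of e' q'] by (auto simp: good)
    qed
  qed
qed

lemma good_skip: "d (tgt D e) q \<noteq> Suc (d (src D e) p) \<Longrightarrow> good d (insert (e, p, a, q) P) = good d P"
  by (auto simp: good_def fun_eq_iff)

text \<open>Processed moves have positive distances at both ends, so writing a cell that was zero
  cannot affect them.\<close>

lemma good_new:
  assumes "queue_inv d qv qq n h P" "d v q = 0"
  shows "good (d(v := (d v)(q := k))) P = good d P"
proof -
  let ?d = "d(v := (d v)(q := k))"
  have eq: "?d (src D e) p = d (src D e) p" "?d (tgt D e) q' = d (tgt D e) q'" if "(e, p, a, q') \<in> P" for e p a q'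
  proof -
    have "d (src D e) p > 0" "d (tgt D e) q' > 0"
      using assms(1) that unfolding queue_inv_def by blast+
    then show "?d (src D e) p = d (src D e) p" "?d (tgt D e) q' = d (tgt D e) q'"
      using assms(2) by auto
  qed
  show ?thesis
    by (intro ext) (use eq in \<open>auto simp: good_def simp del: fun_upd_apply\<close>)
qed

lemma good_final:
  assumes inv: "queue_inv d qv qq n h P"
    and all: "\<And>e p a q. (e, p, a, q) \<in> moves \<Longrightarrow> d (src D e) p > 0 \<Longrightarrow> (e, p, a, q) \<in> P"
  shows "good d P e q = tight e q"
proof -
  note final = queue_inv_final[OF inv all]
  have P: "P \<subseteq> moves" "(e, p, a, q) \<in> P \<Longrightarrow> d (src D e) p > 0" for e p a q
    using inv unfolding queue_inv_def by blast+
  show ?thesis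
  proof (intro set_eqI iffI; clarify)
    fix p a assume "(p, a) \<in> good d P e q"
    then have *: "(e, p, a, q) \<in> P" "d (tgt D e) q = Suc (d (src D e) p)" by (auto simp: good_def)
    then obtain k where "d (src D e) p = Suc k" using P(2) gr0_implies_Suc by blast
    with * P(1) show "(p, a) \<in> tight e q" unfolding tight_def using final by auto
  next
    fix p a assume "(p, a) \<in> tight e q"
    then obtain k where *: "(e, p, a, q) \<in> moves" "lev k (src D e) p" "lev (Suc k) (tgt D e) q"
      by (auto simp: tight_def)
    then have "d (src D e) p = Suc k" "d (tgt D e) q = Suc (Suc k)" using final by auto
    with * all show "(p, a) \<in> good d P e q" by (auto simp: good_def)
  qed
qed

section \<open>Counting: input sizes, transitions and levels\<close>

lemma finite_input: "finite (verts D)" "finite (edges D)" "finite (states A)" "finite (trans A)"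
    "e \<in> edges D \<Longrightarrow> finite (lbl D e)"
proof -
  show "finite (verts D)" "finite (edges D)" "finite (states A)"
    using database nfa by (auto simp: database_def nfa_def)
  show "finite (trans A)"
    using nfa finite_subset[of "trans A" "states A \<times> alphabet A \<times> states A"] by (auto simp: nfa_def)
  show "e \<in> edges D \<Longrightarrow> finite (lbl D e)"
    using database edge finite_subset[of "lbl D e" "labels D"] by (auto simp: database_def)
qed

text \<open>Up to a constant, the work of expanding \<open>(v, q)\<close>: a unit each for the pair,
  an outgoing edge, a label on it and a transition for that label.\<close>

definition node_cost :: "nat \<Rightarrow> nat \<Rightarrow> nat" where
  "node_cost v q = 1 + (\<Sum>e | e \<in> edges D \<and> src D e = v.
     1 + (\<Sum>a\<in>lbl D e. 1 + card {q'. (q, a, q') \<in> trans A}))"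

text \<open>The slices indexed by label and state are disjoint parts of
  \<open>trans A\<close>.\<close>

lemma card_trans_le: "(\<Sum>a\<in>L. \<Sum>q\<in>states A. card {q'. (q, a, q') \<in> trans A}) \<le> card (trans A)"
  if "finite L"
proof -
  have fin: "finite {q'. (q, a, q') \<in> trans A}" for q a
    by (rule finite_subset[OF _ finite_imageI[OF finite_input(4), of "\<lambda>(q, a, q'). q'"]]) force
  have "(\<Sum>a\<in>L. \<Sum>q\<in>states A. card {q'. (q, a, q') \<in> trans A}) =
      card (SIGMA (a, q) : L \<times> states A. {q'. (q, a, q') \<in> trans A})"
    using that fin finite_input by (simp add: sum.cartesian_product case_prod_beta)
  also have "\<dots> \<le> card (trans A)"
    by (rule card_inj_on_le[where f = "\<lambda>((a, q), q'). (q, a, q')"])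
      (auto simp: inj_on_def finite_input)
  finally show ?thesis .
qed

text \<open>These monomials all occur in the expanded product and suffice for every later count of
  work.\<close>

lemma size_bounds:
  "card (verts D) * card (states A) + card (edges D) * card (states A) +
     (\<Sum>e\<in>edges D. card (lbl D e)) * card (states A) + card (edges D) * card (trans A) \<le>
   database_size D * nfa_size A"
  by (simp add: database_size_def nfa_size_def algebra_simps)

text \<open>Edges are regrouped by their source, so each edge is charged once per state, and over
  all states its labels meet at most all transitions.\<close>

lemma sum_node_cost: "(\<Sum>v\<in>verts D. \<Sum>q\<in>states A. node_cost v q) \<le> database_size D * nfa_size A"
proof -
  let ?N = "\<lambda>q a. card {q'. (q, a, q') \<in> trans A}"
  define f where "f q e = 1 + (\<Sum>a\<in>lbl D e. 1 + ?N q a)" for q e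
  have "(\<Sum>v\<in>verts D. \<Sum>q\<in>states A. node_cost v q) =
      (\<Sum>v\<in>verts D. \<Sum>q\<in>states A. 1 + (\<Sum>e | e \<in> edges D \<and> src D e = v. f q e))"
    by (simp only: node_cost_def f_def)
  also have "\<dots> = card (verts D) * card (states A) +
     (\<Sum>v\<in>verts D. \<Sum>q\<in>states A. \<Sum>e | e \<in> edges D \<and> src D e = v. f q e)"
    by (simp only: sum.distrib sum_constant of_nat_id mult_1_right)
  also have "(\<Sum>v\<in>verts D. \<Sum>q\<in>states A. \<Sum>e | e \<in> edges D \<and> src D e = v. f q e) =
     (\<Sum>q\<in>states A. \<Sum>v\<in>verts D. \<Sum>e | e \<in> edges D \<and> src D e = v. f q e)"
    by (rule sum.swap)
  also have "\<dots> = (\<Sum>q\<in>states A. \<Sum>e\<in>edges D. f q e)"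
    by (intro sum.cong refl sum.group) (use finite_input edge in auto)
  also have "\<dots> = (\<Sum>e\<in>edges D. \<Sum>q\<in>states A. f q e)"
    by (rule sum.swap)
  also have "\<dots> = card (edges D) * card (states A) + (\<Sum>e\<in>edges D. card (lbl D e)) * card (states A) +
     (\<Sum>e\<in>edges D. \<Sum>q\<in>states A. \<Sum>a\<in>lbl D e. ?N q a)"
    by (simp add: f_def sum.distrib sum_Suc sum_distrib_left sum_distrib_right mult.commute)
  also have "(\<Sum>e\<in>edges D. \<Sum>q\<in>states A. \<Sum>a\<in>lbl D e. ?N q a) \<le> (\<Sum>e\<in>edges D. card (trans A))"
  proof (rule sum_mono)
    fix e assume "e \<in> edges D"
    then show "(\<Sum>q\<in>states A. \<Sum>a\<in>lbl D e. ?N q a) \<le> card (trans A)"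
      using card_trans_le[OF finite_input(5)] by (subst sum.swap) simp
  qed
  finally show ?thesis using size_bounds by simp
qed

lemma finite_tight: "finite (tight e q)"
  by (rule finite_subset[OF _ finite_imageI[OF finite_moves, of "\<lambda>(e, p, a, q). (p, a)"]])
    (force simp: tight_def)

lemma sum_tight: "finite S \<Longrightarrow> (\<Sum>q\<in>S. card (tight e q)) \<le> card (trans A)"
proof -
  assume "finite S"
  then have "(\<Sum>q\<in>S. card (tight e q)) = card (SIGMA q : S. tight e q)"
    using finite_tight by simp
  also have "\<dots> \<le> card (trans A)"
    by (rule card_inj_on_le[where f = "\<lambda>(q, p, a). (p, a, q)"])
      (auto simp: inj_on_def tight_def moves_def finite_input)
  finally show ?thesis .
qed

text \<open>Taken over all vertices and edges of the level, not only those of the walk being built;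
  this makes the load independent of the walk and hence summable.\<close>

definition level_load :: "nat \<Rightarrow> nat" where
  "level_load m = card {(v, q). lev m v q} + (\<Sum>e\<in>edges D. \<Sum>q | lev m (tgt D e) q. card (tight e q))"

text \<open>
  The first component bounds the delays; the second one sums to \<open>O(|D| |A|)\<close> over all levels and
  bounds the first descent.
\<close>

definition level_cost :: "nat \<Rightarrow> nat" where
  "level_cost m = min (1 + card (states A) + card (trans A)) (1 + level_load m)"

lemma finite_lev: "finite {(v, q). lev m v q}" "finite {q. lev m v q}"
  by (rule finite_subset[of _ "verts D \<times> states A"], use finite_input lev_verts in auto)
    (rule finite_subset[of _ "states A"], use finite_input lev_verts in auto)

lemma card_level:
  assumes "S \<subseteq> {q. lev m v q}"
  shows "card S \<le> card (states A)" "card S \<le> card {(v, q). lev m v q}"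
proof -
  show "card S \<le> card (states A)"
    by (rule card_mono) (use assms lev_verts finite_input in auto)
  show "card S \<le> card {(v, q). lev m v q}"
    by (rule card_inj_on_le[where f = "Pair v"]) (use assms finite_lev in \<open>auto simp: inj_on_def\<close>)
qed

text \<open>The work of a descent from level \<open>m\<close> along \<open>e\<close>. The bound by
  |A| comes from \<open>sum_tight\<close>, the bound by the load from monotonicity in
  \<open>S\<close> and from \<open>e\<close> being one of the summed edges.\<close>

lemma level_cost_step:
  assumes S: "S \<subseteq> {q. lev m (tgt D e) q}" and e: "e \<in> edges D"
  shows "1 + card S + (\<Sum>q\<in>S. card (tight e q)) \<le> level_cost m"
proof -
  have fin: "finite S" using S finite_lev finite_subset by blast
  have "(\<Sum>q\<in>S. card (tight e q)) \<le> (\<Sum>q | lev m (tgt D e) q. card (tight e q))"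
    by (intro sum_mono2) (use S finite_lev in auto)
  also have "\<dots> \<le> (\<Sum>e\<in>edges D. \<Sum>q | lev m (tgt D e) q. card (tight e q))"
    by (rule member_le_sum[OF e]) (auto simp: finite_input)
  finally show ?thesis
    using card_level[OF S] sum_tight[OF fin, of e] by (simp add: level_cost_def level_load_def)
qed

lemma level_cost_next: "S \<subseteq> {q. lev m v q} \<Longrightarrow> 1 + card S \<le> level_cost m"
  using card_level[of S m v] by (simp add: level_cost_def level_load_def)

text \<open>By \<open>lev_unique\<close> the index sets of different levels are disjoint, so the
  total is at most all pairs plus, for each edge, all transitions.\<close>

lemma sum_level_load: "finite M \<Longrightarrow> (\<Sum>m\<in>M. level_load m) \<le>
    card (verts D) * card (states A) + card (edges D) * card (trans A)"
proof -
  assume M: "finite M"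
  have "(\<Sum>m\<in>M. card {(v, q). lev m v q}) = card (\<Union>m\<in>M. {(v, q). lev m v q})"
    by (rule card_UN_disjoint[symmetric]) (use M finite_lev lev_unique in auto)
  also have "\<dots> \<le> card (verts D \<times> states A)"
    by (rule card_mono) (use finite_input lev_verts in auto)
  finally have 1: "(\<Sum>m\<in>M. card {(v, q). lev m v q}) \<le> card (verts D) * card (states A)"
    by (simp add: card_cartesian_product)
  have "(\<Sum>m\<in>M. \<Sum>q | lev m (tgt D e) q. card (tight e q)) \<le> card (trans A)" for e
  proof -
    have "(\<Sum>m\<in>M. \<Sum>q | lev m (tgt D e) q. card (tight e q)) =
      (\<Sum>q\<in>(\<Union>m\<in>M. {q. lev m (tgt D e) q}). card (tight e q))"
      by (rule sum.UNION_disjoint[symmetric]) (use M finite_lev lev_unique in auto)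
    also have "\<dots> \<le> card (trans A)"
      by (rule sum_tight) (use M finite_lev in auto)
    finally show ?thesis .
  qed
  then have "(\<Sum>e\<in>edges D. \<Sum>m\<in>M. \<Sum>q | lev m (tgt D e) q. card (tight e q)) \<le> (\<Sum>e\<in>edges D. card (trans A))"
    by (rule sum_mono)
  then have "(\<Sum>e\<in>edges D. \<Sum>m\<in>M. \<Sum>q | lev m (tgt D e) q. card (tight e q)) \<le> card (edges D) * card (trans A)"
    by simp
  then have 2: "(\<Sum>m\<in>M. \<Sum>e\<in>edges D. \<Sum>q | lev m (tgt D e) q. card (tight e q)) \<le> card (edges D) * card (trans A)"
    by (subst sum.swap)
  show ?thesis using 1 2 by (simp add: level_load_def sum.distrib)
qed

text \<open>The levels from 1 to \<open>l\<close> are inhabited and disjoint, so they use up at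
  least \<open>l\<close> pairs.\<close>

lemma level_bound:
  assumes "lev l v q"
  shows "l \<le> card (verts D) * card (states A)"
proof -
  have "1 \<le> card {(v, q). lev m v q}" if m: "m \<in> {1..l}" for m
  proof -
    obtain v' q' where "lev m v' q'" using lev_below[OF assms, of m] m by (auto simp only: atLeastAtMost_iff)
    then have "{(v, q). lev m v q} \<noteq> {}" by auto
    then show ?thesis using finite_lev(1)[of m] by (simp add: Suc_le_eq card_gt_0_iff)
  qed
  then have "(\<Sum>m\<in>{1..l}. 1) \<le> (\<Sum>m\<in>{1..l}. card {(v, q). lev m v q})" by (rule sum_mono)
  also have "\<dots> = card (\<Union>m\<in>{1..l}. {(v, q). lev m v q})"
    by (rule card_UN_disjoint[symmetric]) (use finite_lev lev_unique in auto)
  also have "\<dots> \<le> card (verts D \<times> states A)"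
    by (rule card_mono) (use finite_input lev_verts in auto)
  finally show ?thesis by (simp add: card_cartesian_product)
qed

text \<open>The delays use the first bound, preprocessing the second. In the first, the factor 2
  absorbs the summand 1 because there is at least one state; in the second it absorbs the
  \<open>l\<close> summands 1 through \<open>level_bound\<close>.\<close>

lemma sum_level_cost:
  assumes "lev l v q"
  shows "(\<Sum>m\<in>{1..l}. level_cost m) \<le> 2 * (l * nfa_size A)"
    and "(\<Sum>m\<in>{1..l}. level_cost m) \<le> 2 * (database_size D * nfa_size A)"
proof -
  have "card (states A) \<ge> 1"
    using lev_verts[OF assms] finite_input by (metis Suc_leI card_gt_0_iff empty_iff One_nat_def)
  then have "level_cost m \<le> 2 * nfa_size A" for m
    by (auto simp: level_cost_def nfa_size_def)
  then have "(\<Sum>m\<in>{1..l}. level_cost m) \<le> (\<Sum>m\<in>{1..l}. 2 * nfa_size A)" by (rule sum_mono)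
  then show "(\<Sum>m\<in>{1..l}. level_cost m) \<le> 2 * (l * nfa_size A)" by (simp add: mult.left_commute)
  have "(\<Sum>m\<in>{1..l}. level_cost m) \<le> (\<Sum>m\<in>{1..l}. 1 + level_load m)"
    by (rule sum_mono) (simp add: level_cost_def)
  also have "\<dots> = l + (\<Sum>m\<in>{1..l}. level_load m)" by (simp add: sum_Suc)
  also have "\<dots> \<le> 2 * (card (verts D) * card (states A) + card (edges D) * card (trans A))"
    using level_bound[OF assms] sum_level_load[of "{1..l}"] by simp
  also have "card (verts D) * card (states A) + card (edges D) * card (trans A) \<le> database_size D * nfa_size A"
    by (rule order_trans[OF _ size_bounds]) simp
  finally show "(\<Sum>m\<in>{1..l}. level_cost m) \<le> 2 * (database_size D * nfa_size A)"
    by simp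
qed

end

section \<open>The preprocessing program\<close>

text \<open>
  The arrays from \<open>m_set\<close> on form the stack, whose rows are levels: the current states and
  their number, the vertex, the edge chosen to the level below, the position in the list of incoming
  edges. \<open>m_next\<close> maps an edge \<open>e\<close> and a state to the position of the first incoming edge of
  the target of \<open>e\<close>, from \<open>e\<close> on, that has a predecessor for this state.
  \<open>m_mark\<close> is never cleared: a mark counts only if it equals the current stamp.
\<close>

abbreviation (input) "r_tail \<equiv> 10 :: nat"
abbreviation (input) "r_head \<equiv> 11 :: nat"
abbreviation (input) "r_ids \<equiv> 12 :: nat"
abbreviation (input) "r_v \<equiv> 13 :: nat"
abbreviation (input) "r_q \<equiv> 14 :: nat"
abbreviation (input) "r_i \<equiv> 15 :: nat"
abbreviation (input) "r_e \<equiv> 16 :: nat"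
abbreviation (input) "r_j \<equiv> 17 :: nat"
abbreviation (input) "r_a \<equiv> 18 :: nat"
abbreviation (input) "r_k \<equiv> 19 :: nat"
abbreviation (input) "r_p \<equiv> 20 :: nat"
abbreviation (input) "r_best \<equiv> 21 :: nat"
abbreviation (input) "r_level \<equiv> 22 :: nat"
abbreviation (input) "r_stamp \<equiv> 23 :: nat"
abbreviation (input) "r_stop \<equiv> 24 :: nat"

abbreviation (input) "m_dist \<equiv> 30 :: nat"
abbreviation (input) "m_qv \<equiv> 31 :: nat"
abbreviation (input) "m_qq \<equiv> 32 :: nat"
abbreviation (input) "m_id \<equiv> 33 :: nat"
abbreviation (input) "m_count \<equiv> 34 :: nat"
abbreviation (input) "m_pred \<equiv> 35 :: nat"
abbreviation (input) "m_next \<equiv> 36 :: nat"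
abbreviation (input) "m_set \<equiv> 37 :: nat"
abbreviation (input) "m_size \<equiv> 38 :: nat"
abbreviation (input) "m_vert \<equiv> 39 :: nat"
abbreviation (input) "m_edge \<equiv> 40 :: nat"
abbreviation (input) "m_index \<equiv> 41 :: nat"
abbreviation (input) "m_mark \<equiv> 42 :: nat"

definition enqueue :: "exp \<Rightarrow> exp \<Rightarrow> exp \<Rightarrow> com" where
  "enqueue v q d = Seq (SetMem m_dist v q d)
     (Seq (SetMem m_qv (Reg r_tail) (Const 0) v)
     (Seq (SetMem m_qq (Reg r_tail) (Const 0) q)
          (SetReg r_tail (Inc (Reg r_tail)))))"

definition visit :: com where
  "visit = Cond (Equal (Mem m_dist (TgtOf (Reg r_e)) (Reg r_p)) (Const 0))
     (enqueue (TgtOf (Reg r_e)) (Reg r_p) (Inc (Mem m_dist (Reg r_v) (Reg r_q)))) Skip"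

text \<open>Runs after \<open>visit\<close>, so a target discovered by the very same move already
  has its distance and passes the test.\<close>

definition push :: com where
  "push = Cond (Equal (Mem m_dist (TgtOf (Reg r_e)) (Reg r_p)) (Inc (Mem m_dist (Reg r_v) (Reg r_q))))
     (Seq (Cond (Equal (Mem m_id (Reg r_e) (Reg r_p)) (Const 0))
            (Seq (SetReg r_ids (Inc (Reg r_ids))) (SetMem m_id (Reg r_e) (Reg r_p) (Reg r_ids))) Skip)
     (let i = Mem m_id (Reg r_e) (Reg r_p) in
       Seq (SetMem m_pred i (Mem m_count i (Const 0)) (Reg r_q))
           (SetMem m_count i (Const 0) (Inc (Mem m_count i (Const 0)))))) Skip"

definition scan_states :: com where
  "scan_states = For r_k (DeltaLen (Reg r_q) (Reg r_a))
     (Seq (SetReg r_p (DeltaAt (Reg r_q) (Reg r_a) (Reg r_k))) (Seq visit push))"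

definition scan_labels :: com where
  "scan_labels = For r_j (LblLen (Reg r_e)) (Seq (SetReg r_a (LblAt (Reg r_e) (Reg r_j))) scan_states)"

definition scan_edges :: com where
  "scan_edges = For r_i (OutLen (Reg r_v)) (Seq (SetReg r_e (OutAt (Reg r_v) (Reg r_i))) scan_labels)"

definition bfs :: com where
  "bfs = While (Less (Reg r_head) (Reg r_tail))
     (Seq (SetReg r_v (Mem m_qv (Reg r_head) (Const 0)))
     (Seq (SetReg r_q (Mem m_qq (Reg r_head) (Const 0)))
     (Seq scan_edges (SetReg r_head (Inc (Reg r_head))))))"

definition init_queue :: com where
  "init_queue = For r_i InitLen (Seq (SetReg r_p (InitAt (Reg r_i))) (enqueue Source (Reg r_p) (Const 1)))"

abbreviation (input) "bfs_regs \<equiv> {r_tail, r_head, r_ids, r_v, r_q, r_i, r_e, r_j, r_a, r_k, r_p}"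
abbreviation (input) "bfs_arrays \<equiv> {m_dist, m_qv, m_qq, m_id, m_count, m_pred}"

section \<open>Correctness and running time of the breadth-first search\<close>

context problem
begin

lemma src_of: "e \<in> edges D \<Longrightarrow> src_of x e = src D e"
  and tgt_of: "e \<in> edges D \<Longrightarrow> tgt_of x e = tgt D e"
  and lbl_arr: "e \<in> edges D \<Longrightarrow> distinct (lbl_arr x e) \<and> set (lbl_arr x e) = lbl D e"
  and init_arr: "distinct (init_arr x) \<and> set (init_arr x) = initials A"
  and final_arr: "distinct (final_arr x) \<and> set (final_arr x) = finals A"
  and source: "source x = s" and target: "target x = t"
  using presents by (auto simp: presents_def lists_set_def)

lemma delta_arr: "q \<in> states A \<Longrightarrow> e \<in> edges D \<Longrightarrow> a \<in> lbl D e \<Longrightarrow>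
    distinct (delta_arr x q a) \<and> set (delta_arr x q a) = {q'. (q, a, q') \<in> trans A}"
  using presents edge[of e] alphabet by (auto simp: presents_def lists_set_def)

definition bfs_inv :: "(nat \<times> nat \<times> nat \<times> nat) set \<Rightarrow> config \<Rightarrow> bool" where
  "bfs_inv P \<sigma> \<longleftrightarrow>
     queue_inv (mem \<sigma> m_dist) (mem \<sigma> m_qv) (mem \<sigma> m_qq) (reg \<sigma> r_tail) (reg \<sigma> r_head) P \<and>
     store_inv (mem \<sigma> m_dist) (mem \<sigma> m_id) (reg \<sigma> r_ids) (mem \<sigma> m_count) (mem \<sigma> m_pred) P \<and>
     frame bfs_regs bfs_arrays start \<sigma>"

text \<open>\<open>f\<close> and \<open>g\<close> freeze the queue up to entry \<open>h\<close>, the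
  pair being expanded. Enqueueing writes only behind it, so the set of processed moves can still be
  read off from the queue afterwards.\<close>

definition node_inv :: "(nat \<Rightarrow> nat) \<Rightarrow> (nat \<Rightarrow> nat) \<Rightarrow> nat \<Rightarrow> (nat \<times> nat \<times> nat \<times> nat) set \<Rightarrow> config \<Rightarrow> bool" where
  "node_inv f g h P \<sigma> \<longleftrightarrow> bfs_inv P \<sigma> \<and> reg \<sigma> r_head = h \<and> h < reg \<sigma> r_tail \<and>
     (\<forall>k\<le>h. mem \<sigma> m_qv k 0 = f k \<and> mem \<sigma> m_qq k 0 = g k) \<and> reg \<sigma> r_v = f h \<and> reg \<sigma> r_q = g h"

lemma node_inv_update:
  "node_inv f g h P \<sigma> \<Longrightarrow> node_inv f g h P (tick n \<sigma>)"
  "node_inv f g h P \<sigma> \<Longrightarrow> r \<in> {r_i, r_e, r_j, r_a, r_k, r_p} \<Longrightarrow> node_inv f g h P (set_reg r n \<sigma>)"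
  by (auto simp: node_inv_def bfs_inv_def)

text \<open>In either branch the target ends up discovered, which is what \<open>wp_push\<close>
  asks for.\<close>

lemma wp_visit:
  assumes inv: "node_inv f g h P \<sigma>" and e: "reg \<sigma> r_e = e" "reg \<sigma> r_p = q"
    and move: "(e, g h, a, q) \<in> moves" "src D e = f h"
  shows "wp x visit (\<lambda>\<tau>. node_inv f g h P \<tau> \<and> mem \<tau> m_dist (tgt D e) q > 0 \<and>
    frame {r_tail} {m_dist, m_qv, m_qq} \<sigma> \<tau> \<and> clock \<tau> \<le> clock \<sigma> + 30) \<sigma>"
proof -
  have tgt: "tgt_of x e = tgt D e" using move tgt_of by (simp add: moves_def)
  note inv' = inv[unfolded node_inv_def bfs_inv_def]
  show ?thesis
  proof (cases "mem \<sigma> m_dist (tgt D e) q = 0")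
    case True
    have h: "h < reg \<sigma> r_tail" "mem \<sigma> m_qv h 0 = src D e" "mem \<sigma> m_qq h 0 = g h"
      using inv' move by auto
    have q: "queue_inv (mem \<sigma> m_dist) (mem \<sigma> m_qv) (mem \<sigma> m_qq) (reg \<sigma> r_tail) h P"
      using inv' by (elim conjE) simp
    note queue = queue_inv_new[OF q h(1) True move(1) h(2,3)]
    have store: "store_inv ((mem \<sigma> m_dist)(tgt D e := (mem \<sigma> m_dist (tgt D e))(q := n)))
        (mem \<sigma> m_id) (reg \<sigma> r_ids) (mem \<sigma> m_count) (mem \<sigma> m_pred) P" for n
      by (rule store_inv_cong[OF _ good_new[OF q True]]) (use inv' in simp)
    show ?thesis
      using inv' True queue store e move tgt
      by (simp add: visit_def enqueue_def node_inv_def bfs_inv_def del: fun_upd_apply)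
        (auto simp: less_Suc_eq)
  next
    case False
    then show ?thesis
      using inv e tgt by (simp add: visit_def node_inv_update)
  qed
qed

lemma wp_push:
  assumes inv: "node_inv f g h P \<sigma>" and e: "reg \<sigma> r_e = e" "reg \<sigma> r_p = q"
    and move: "(e, g h, a, q) \<in> moves" "src D e = f h" and fresh: "(e, g h, a, q) \<notin> P"
    and pos: "mem \<sigma> m_dist (tgt D e) q > 0"
  shows "wp x push (\<lambda>\<tau>. node_inv f g h (insert (e, g h, a, q) P) \<tau> \<and>
    frame {r_ids} {m_id, m_count, m_pred} \<sigma> \<tau> \<and> clock \<tau> \<le> clock \<sigma> + 50) \<sigma>"
proof -
  have tgt: "tgt_of x e = tgt D e" using move tgt_of by (simp add: moves_def)
  note inv' = inv[unfolded node_inv_def bfs_inv_def]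
  let ?P = "insert (e, g h, a, q) P" and ?d = "mem \<sigma> m_dist"
  have h: "h < reg \<sigma> r_tail" "mem \<sigma> m_qv h 0 = src D e" "mem \<sigma> m_qq h 0 = g h"
    using inv' move by auto
  have q: "queue_inv ?d (mem \<sigma> m_qv) (mem \<sigma> m_qq) (reg \<sigma> r_tail) h P"
    using inv' by (elim conjE) simp
  note queue = queue_inv_move[OF q h(1) pos move(1) h(2,3)]
  have P: "P \<subseteq> moves" using q unfolding queue_inv_def by blast
  have S: "store_inv ?d (mem \<sigma> m_id) (reg \<sigma> r_ids) (mem \<sigma> m_count) (mem \<sigma> m_pred) P"
    using inv' by simp
  show ?thesis
  proof (cases "?d (tgt D e) q = Suc (?d (f h) (g h))")
    case True
    note store = store_inv_push[OF S P fresh True[folded move(2)] refl refl refl]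
    show ?thesis
    proof (cases "mem \<sigma> m_id e q = 0")
      case id: True
      show ?thesis
        using inv' True queue store[unfolded if_P[OF id]] e move tgt id
        by (simp add: push_def node_inv_def bfs_inv_def Let_def)
    next
      case id: False
      show ?thesis
        using inv' True queue store[unfolded if_not_P[OF id]] e move tgt id
        by (simp add: push_def node_inv_def bfs_inv_def Let_def)
    qed
  next
    case False
    have "store_inv ?d (mem \<sigma> m_id) (reg \<sigma> r_ids) (mem \<sigma> m_count) (mem \<sigma> m_pred) ?P"
      by (rule store_inv_cong[OF S good_skip]) (use False move in simp)
    then show ?thesis
      using inv' False queue e move tgt
      by (simp add: push_def node_inv_def bfs_inv_def)
  qed
qed

lemma node_inv_states: "node_inv f g h P \<sigma> \<Longrightarrow> f h \<in> verts D \<and> g h \<in> states A"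
  unfolding node_inv_def bfs_inv_def by (auto dest!: queue_inv_card(1))

text \<open>This scan and the two around it add to \<open>P\<close> exactly the moves they traverse.
  Distinctness of the input arrays keeps each move fresh, so none enters a predecessor list
  twice.\<close>

lemma wp_scan_states:
  assumes inv: "node_inv f g h P \<sigma>" and reg: "reg \<sigma> r_e = e" "reg \<sigma> r_a = a"
    and e: "e \<in> edges D" "src D e = f h" "a \<in> lbl D e" and fresh: "\<And>q. (e, g h, a, q) \<notin> P"
  shows "wp x scan_states (\<lambda>\<tau>. node_inv f g h (P \<union> {(e, g h, a, q) |q. (g h, a, q) \<in> trans A}) \<tau> \<and>
    frame {r_tail, r_ids, r_k, r_p} bfs_arrays \<sigma> \<tau> \<and>
    clock \<tau> \<le> clock \<sigma> + 100 * (1 + card {q. (g h, a, q) \<in> trans A})) \<sigma>"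
  unfolding scan_states_def
\<comment> \<open>85 is the sum of 5 for loading the state, 30 for \<open>visit\<close> and 50 for
  \<open>push\<close>.\<close>
proof (rule wp_For_list[where xs = "delta_arr x (g h) a" and F = "\<lambda>_. 85"
      and J = "\<lambda>Y \<tau>. node_inv f g h (P \<union> (\<lambda>q. (e, g h, a, q)) ` Y) \<tau> \<and>
         frame {r_tail, r_ids, r_k, r_p} bfs_arrays \<sigma> \<tau>"])
  have delta: "distinct (delta_arr x (g h) a)" "set (delta_arr x (g h) a) = {q. (g h, a, q) \<in> trans A}"
    using delta_arr e node_inv_states[OF inv] by auto
  show "distinct (delta_arr x (g h) a)" by fact
  fix \<tau>
  { fix Y
    assume J: "node_inv f g h (P \<union> (\<lambda>q. (e, g h, a, q)) ` Y) \<tau> \<and>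
       frame {r_tail, r_ids, r_k, r_p} bfs_arrays \<sigma> \<tau>"
    then have regs: "reg \<tau> r_q = g h" "reg \<tau> r_a = a" "reg \<tau> r_e = e"
      using reg by (auto simp: node_inv_def frame_def)
    then show "val x \<tau> (DeltaLen (Reg r_q) (Reg r_a)) = length (delta_arr x (g h) a)"
      by simp
    fix q assume q: "q \<in> set (delta_arr x (g h) a)" "q \<notin> Y" "entry (delta_arr x (g h) a) (reg \<tau> r_k) = q"
    then have move: "(e, g h, a, q) \<in> moves" using e delta by (simp add: moves_def)
    have fr': "frame {r_tail, r_ids, r_k, r_p} bfs_arrays \<sigma> (tick (Suc (cost (DeltaAt (Reg r_q) (Reg r_a) (Reg r_k))))
        (set_reg r_p (val x \<tau> (DeltaAt (Reg r_q) (Reg r_a) (Reg r_k))) \<tau>))"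
      using J by simp
    have fresh': "(e, g h, a, q) \<notin> P \<union> (\<lambda>q. (e, g h, a, q)) ` Y" using fresh q by auto
    show "wp x (Seq (SetReg r_p (DeltaAt (Reg r_q) (Reg r_a) (Reg r_k))) (Seq visit push))
       (\<lambda>\<rho>. (node_inv f g h (P \<union> (\<lambda>q. (e, g h, a, q)) ` insert q Y) \<rho> \<and>
         frame {r_tail, r_ids, r_k, r_p} bfs_arrays \<sigma> \<rho>) \<and> reg \<rho> r_k = reg \<tau> r_k \<and>
         clock \<rho> \<le> clock \<tau> + 85) \<tau>"
      unfolding wp_simps
    proof (rule wp_mono[OF wp_visit[where f = f and g = g and h = h and e = e and a = a and q = q and
          P = "P \<union> (\<lambda>q. (e, g h, a, q)) ` Y"]], goal_cases)
      case 1
      show ?case using J by (intro node_inv_update) auto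
    next
      case 2
      show ?case using regs by simp
    next
      case 3
      show ?case using regs q by simp
    next
      case 4
      show ?case by (rule move)
    next
      case 5
      show ?case by (rule e(2))
    next
      case (6 \<rho>)
      have r: "reg \<rho> r_e = e" "reg \<rho> r_p = q" "reg \<rho> r_k = reg \<tau> r_k"
        using 6 regs q by (auto simp: frame_def)
      have clk: "clock \<rho> \<le> clock \<tau> + 35" using 6 by simp
      have fr: "frame {r_tail, r_ids, r_k, r_p} bfs_arrays \<sigma> \<rho>"
        by (rule frame_trans[OF fr', of "{r_tail}" "{m_dist, m_qv, m_qq}"]) (use 6 in auto)
      show ?case
      proof (rule wp_mono[OF wp_push[of f g h "P \<union> (\<lambda>q. (e, g h, a, q)) ` Y" \<rho> e q a]], goal_cases)
        case (8 \<upsilon>)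
        have "frame {r_tail, r_ids, r_k, r_p} bfs_arrays \<sigma> \<upsilon>"
          by (rule frame_trans[OF fr, of "{r_ids}" "{m_id, m_count, m_pred}"]) (use 8 in auto)
        then show ?case using 8 r clk by (auto simp: frame_def)
      qed (use 6 r move e fresh' q regs in auto)
    qed
  }
  assume "node_inv f g h (P \<union> (\<lambda>q. (e, g h, a, q)) ` set (delta_arr x (g h) a)) \<tau> \<and>
      frame {r_tail, r_ids, r_k, r_p} bfs_arrays \<sigma> \<tau>"
    "clock \<tau> \<le> clock \<sigma> + (\<Sum>q\<in>set (delta_arr x (g h) a). 85 + cost (DeltaLen (Reg r_q) (Reg r_a)) + 6) +
       cost (DeltaLen (Reg r_q) (Reg r_a)) + 5"
  moreover have "(\<lambda>q. (e, g h, a, q)) ` set (delta_arr x (g h) a) = {(e, g h, a, q) |q. (g h, a, q) \<in> trans A}"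
    using delta by auto
  ultimately show "node_inv f g h (P \<union> {(e, g h, a, q) |q. (g h, a, q) \<in> trans A}) \<tau> \<and>
    frame {r_tail, r_ids, r_k, r_p} bfs_arrays \<sigma> \<tau> \<and>
    clock \<tau> \<le> clock \<sigma> + 100 * (1 + card {q. (g h, a, q) \<in> trans A})"
    by (simp add: delta)
qed (use inv in \<open>auto intro: node_inv_update\<close>)

lemma wp_scan_labels:
  assumes inv: "node_inv f g h P \<sigma>" and reg: "reg \<sigma> r_e = e"
    and e: "e \<in> edges D" "src D e = f h" and fresh: "\<And>a q. (e, g h, a, q) \<notin> P"
  shows "wp x scan_labels (\<lambda>\<tau>. node_inv f g h (P \<union> {(e, g h, a, q) |a q. (e, g h, a, q) \<in> moves}) \<tau> \<and>
    frame {r_tail, r_ids, r_j, r_a, r_k, r_p} bfs_arrays \<sigma> \<tau> \<and>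
    clock \<tau> \<le> clock \<sigma> + 120 * (1 + (\<Sum>a\<in>lbl D e. 1 + card {q. (g h, a, q) \<in> trans A}))) \<sigma>"
  unfolding scan_labels_def
proof (rule wp_For_list[where xs = "lbl_arr x e" and F = "\<lambda>a. 105 + 100 * card {q. (g h, a, q) \<in> trans A}"
      and J = "\<lambda>Y \<tau>. node_inv f g h (P \<union> {(e, g h, a, q) |a q. a \<in> Y \<and> (g h, a, q) \<in> trans A}) \<tau> \<and>
         frame {r_tail, r_ids, r_j, r_a, r_k, r_p} bfs_arrays \<sigma> \<tau>"])
  have lbl: "distinct (lbl_arr x e)" "set (lbl_arr x e) = lbl D e"
    using lbl_arr e by auto
  show "distinct (lbl_arr x e)" by fact
  fix \<tau>
  { fix Y
    let ?P = "P \<union> {(e, g h, a, q) |a q. a \<in> Y \<and> (g h, a, q) \<in> trans A}"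
    assume J: "node_inv f g h ?P \<tau> \<and> frame {r_tail, r_ids, r_j, r_a, r_k, r_p} bfs_arrays \<sigma> \<tau>"
    then have regs: "reg \<tau> r_q = g h" "reg \<tau> r_e = e"
      using reg by (auto simp: node_inv_def frame_def)
    then show "val x \<tau> (LblLen (Reg r_e)) = length (lbl_arr x e)"
      by simp
    fix a assume a: "a \<in> set (lbl_arr x e)" "a \<notin> Y" "entry (lbl_arr x e) (reg \<tau> r_j) = a"
    let ?\<tau> = "tick (Suc (cost (LblAt (Reg r_e) (Reg r_j)))) (set_reg r_a (val x \<tau> (LblAt (Reg r_e) (Reg r_j))) \<tau>)"
    have fr: "frame {r_tail, r_ids, r_j, r_a, r_k, r_p} bfs_arrays \<sigma> ?\<tau>" using J by simp
    show "wp x (Seq (SetReg r_a (LblAt (Reg r_e) (Reg r_j))) scan_states)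
       (\<lambda>\<rho>. (node_inv f g h (P \<union> {(e, g h, b, q) |b q. b \<in> insert a Y \<and> (g h, b, q) \<in> trans A}) \<rho> \<and>
         frame {r_tail, r_ids, r_j, r_a, r_k, r_p} bfs_arrays \<sigma> \<rho>) \<and> reg \<rho> r_j = reg \<tau> r_j \<and>
         clock \<rho> \<le> clock \<tau> + (105 + 100 * card {q. (g h, a, q) \<in> trans A})) \<tau>"
      unfolding wp_simps
    proof (rule wp_mono[OF wp_scan_states[where f = f and g = g and h = h and e = e and a = a and P = ?P]], goal_cases)
      case 1
      show ?case using J by (intro node_inv_update) auto
    next
      case (8 \<rho>)
      have "?P \<union> {(e, g h, a, q) |q. (g h, a, q) \<in> trans A} =
         P \<union> {(e, g h, b, q) |b q. b \<in> insert a Y \<and> (g h, b, q) \<in> trans A}" by auto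
      moreover have "frame {r_tail, r_ids, r_j, r_a, r_k, r_p} bfs_arrays \<sigma> \<rho>"
        by (rule frame_trans[OF fr, of "{r_tail, r_ids, r_k, r_p}" bfs_arrays]) (use 8 in auto)
      moreover have "reg \<rho> r_j = reg \<tau> r_j" using 8 by (auto simp: frame_def)
      ultimately show ?case using 8 by simp
    qed (use a lbl regs e fresh in auto)
  }
  assume "node_inv f g h (P \<union> {(e, g h, a, q) |a q. a \<in> set (lbl_arr x e) \<and> (g h, a, q) \<in> trans A}) \<tau> \<and>
      frame {r_tail, r_ids, r_j, r_a, r_k, r_p} bfs_arrays \<sigma> \<tau>"
    "clock \<tau> \<le> clock \<sigma> + (\<Sum>a\<in>set (lbl_arr x e). 105 + 100 * card {q. (g h, a, q) \<in> trans A} +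
       cost (LblLen (Reg r_e)) + 6) + cost (LblLen (Reg r_e)) + 5"
  moreover have "{(e, g h, a, q) |a q. a \<in> set (lbl_arr x e) \<and> (g h, a, q) \<in> trans A} =
      {(e, g h, a, q) |a q. (e, g h, a, q) \<in> moves}"
    using lbl e by (auto simp: moves_def)
  moreover have "(\<Sum>a\<in>set (lbl_arr x e). 105 + 100 * card {q. (g h, a, q) \<in> trans A} + cost (LblLen (Reg r_e)) + 6) \<le>
      120 * (\<Sum>a\<in>lbl D e. 1 + card {q. (g h, a, q) \<in> trans A})"
    unfolding sum_distrib_left lbl(2) by (rule sum_mono) simp
  ultimately show "node_inv f g h (P \<union> {(e, g h, a, q) |a q. (e, g h, a, q) \<in> moves}) \<tau> \<and>
    frame {r_tail, r_ids, r_j, r_a, r_k, r_p} bfs_arrays \<sigma> \<tau> \<and>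
    clock \<tau> \<le> clock \<sigma> + 120 * (1 + (\<Sum>a\<in>lbl D e. 1 + card {q. (g h, a, q) \<in> trans A}))"
    by simp
qed (use inv in \<open>auto intro: node_inv_update\<close>)

lemma wp_scan_edges:
  assumes inv: "node_inv f g h P \<sigma>" and fresh: "\<And>e a q. src D e = f h \<Longrightarrow> (e, g h, a, q) \<notin> P"
  shows "wp x scan_edges (\<lambda>\<tau>. node_inv f g h (P \<union> {(e, g h, a, q) |e a q. src D e = f h \<and> (e, g h, a, q) \<in> moves}) \<tau> \<and>
    clock \<tau> \<le> clock \<sigma> + 140 * node_cost (f h) (g h)) \<sigma>"
  unfolding scan_edges_def
proof (rule wp_For_list[where xs = "out_arr x (f h)"
      and F = "\<lambda>e. 125 + 120 * (\<Sum>a\<in>lbl D e. 1 + card {q. (g h, a, q) \<in> trans A})"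
      and J = "\<lambda>Y \<tau>. node_inv f g h (P \<union> {(e, g h, a, q) |e a q. e \<in> Y \<and> (e, g h, a, q) \<in> moves}) \<tau>"])
  have out: "distinct (out_arr x (f h))" "set (out_arr x (f h)) = {e \<in> edges D. src D e = f h}"
    using out_arr node_inv_states[OF inv] by auto
  show "distinct (out_arr x (f h))" by fact
  fix \<tau>
  { fix Y
    let ?P = "P \<union> {(e, g h, a, q) |e a q. e \<in> Y \<and> (e, g h, a, q) \<in> moves}"
    assume J: "node_inv f g h ?P \<tau>"
    then have regs: "reg \<tau> r_q = g h" "reg \<tau> r_v = f h"
      by (auto simp: node_inv_def)
    then show "val x \<tau> (OutLen (Reg r_v)) = length (out_arr x (f h))"
      by simp
    fix e assume e: "e \<in> set (out_arr x (f h))" "e \<notin> Y" "entry (out_arr x (f h)) (reg \<tau> r_i) = e"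
    show "wp x (Seq (SetReg r_e (OutAt (Reg r_v) (Reg r_i))) scan_labels)
       (\<lambda>\<rho>. node_inv f g h (P \<union> {(e', g h, a, q) |e' a q. e' \<in> insert e Y \<and> (e', g h, a, q) \<in> moves}) \<rho> \<and>
         reg \<rho> r_i = reg \<tau> r_i \<and>
         clock \<rho> \<le> clock \<tau> + (125 + 120 * (\<Sum>a\<in>lbl D e. 1 + card {q. (g h, a, q) \<in> trans A}))) \<tau>"
      unfolding wp_simps
    proof (rule wp_mono[OF wp_scan_labels[where f = f and g = g and h = h and e = e and P = ?P]], goal_cases)
      case 1
      show ?case using J by (intro node_inv_update) auto
    next
      case (6 \<rho>)
      have "?P \<union> {(e, g h, a, q) |a q. (e, g h, a, q) \<in> moves} =
         P \<union> {(e', g h, a, q) |e' a q. e' \<in> insert e Y \<and> (e', g h, a, q) \<in> moves}" by auto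
      moreover have "reg \<rho> r_i = reg \<tau> r_i" using 6 by (auto simp: frame_def)
      ultimately show ?case using 6 by simp
    qed (use out regs e fresh in auto)
  }
  assume "node_inv f g h (P \<union> {(e, g h, a, q) |e a q. e \<in> set (out_arr x (f h)) \<and> (e, g h, a, q) \<in> moves}) \<tau>"
    "clock \<tau> \<le> clock \<sigma> + (\<Sum>e\<in>set (out_arr x (f h)). 125 + 120 * (\<Sum>a\<in>lbl D e. 1 + card {q. (g h, a, q) \<in> trans A}) +
       cost (OutLen (Reg r_v)) + 6) + cost (OutLen (Reg r_v)) + 5"
  moreover have "{(e, g h, a, q) |e a q. e \<in> set (out_arr x (f h)) \<and> (e, g h, a, q) \<in> moves} =
      {(e, g h, a, q) |e a q. src D e = f h \<and> (e, g h, a, q) \<in> moves}"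
    using out by (auto simp: moves_def)
  moreover have "(\<Sum>e\<in>set (out_arr x (f h)). 125 + 120 * (\<Sum>a\<in>lbl D e. 1 + card {q. (g h, a, q) \<in> trans A}) +
       cost (OutLen (Reg r_v)) + 6) \<le>
      140 * (\<Sum>e | e \<in> edges D \<and> src D e = f h. 1 + (\<Sum>a\<in>lbl D e. 1 + card {q. (g h, a, q) \<in> trans A}))"
    unfolding sum_distrib_left[of 140] out(2) by (rule sum_mono) simp
  ultimately show "node_inv f g h (P \<union> {(e, g h, a, q) |e a q. src D e = f h \<and> (e, g h, a, q) \<in> moves}) \<tau> \<and>
    clock \<tau> \<le> clock \<sigma> + 140 * node_cost (f h) (g h)"
    by (simp add: node_cost_def)
qed (use inv in \<open>auto intro: node_inv_update\<close>)

text \<open>A ghost set that is a function of the configuration, so the invariant of the outer loop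
  can mention it without a further parameter.\<close>

definition processed :: "config \<Rightarrow> (nat \<times> nat \<times> nat \<times> nat) set" where
  "processed \<sigma> = {(e, p, a, q) \<in> moves. \<exists>k<reg \<sigma> r_head. mem \<sigma> m_qv k 0 = src D e \<and> mem \<sigma> m_qq k 0 = p}"

lemma wp_bfs:
  assumes inv: "bfs_inv {} \<sigma>" and head: "reg \<sigma> r_head = 0"
  shows "wp x bfs (\<lambda>\<tau>. bfs_inv (processed \<tau>) \<tau> \<and> reg \<tau> r_head = reg \<tau> r_tail \<and>
    clock \<tau> \<le> clock \<sigma> + 170 * (database_size D * nfa_size A) + 10) \<sigma>"
  unfolding bfs_def
\<comment> \<open>The head is below the tail during a round and the tail is at most the number of
  pairs, so the measure decreases. The clock is charged to the queue entries already
  expanded.\<close>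
proof (rule wp_While[where f = "\<lambda>\<tau>. card (verts D \<times> states A) - reg \<tau> r_head" and
      I = "\<lambda>\<tau>. bfs_inv (processed \<tau>) \<tau> \<and> reg \<tau> r_head \<le> reg \<tau> r_tail \<and>
        clock \<tau> \<le> clock \<sigma> + (\<Sum>k<reg \<tau> r_head. 170 * node_cost (mem \<tau> m_qv k 0) (mem \<tau> m_qq k 0))"])
  show "bfs_inv (processed \<sigma>) \<sigma> \<and> reg \<sigma> r_head \<le> reg \<sigma> r_tail \<and>
      clock \<sigma> \<le> clock \<sigma> + (\<Sum>k<reg \<sigma> r_head. 170 * node_cost (mem \<sigma> m_qv k 0) (mem \<sigma> m_qq k 0))"
  proof -
    have "processed \<sigma> = {}" using head by (auto simp: processed_def)
    then show ?thesis using inv head by simp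
  qed
next
  fix \<tau> assume \<tau>: "bfs_inv (processed \<tau>) \<tau> \<and> reg \<tau> r_head \<le> reg \<tau> r_tail \<and>
        clock \<tau> \<le> clock \<sigma> + (\<Sum>k<reg \<tau> r_head. 170 * node_cost (mem \<tau> m_qv k 0) (mem \<tau> m_qq k 0))"
    and "bval x \<tau> (Less (Reg r_head) (Reg r_tail))"
  then have h: "reg \<tau> r_head < reg \<tau> r_tail" by simp
  define h f g where "h = reg \<tau> r_head" and "f = (\<lambda>k. mem \<tau> m_qv k 0)" and "g = (\<lambda>k. mem \<tau> m_qq k 0)"
  have inj: "inj_on (\<lambda>k. (f k, g k)) {..<reg \<tau> r_tail}"
    using \<tau> unfolding bfs_inv_def queue_inv_def f_def g_def by blast
  have le: "reg \<tau> r_tail \<le> card (verts D \<times> states A)"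
    using \<tau> queue_inv_card(2) unfolding bfs_inv_def by blast
  \<comment> \<open>Queue entries are pairwise distinct, so the pair at the head has not been
    expanded before.\<close>
  have fresh: "(e, g h, a, q) \<notin> processed \<tau>" if src: "src D e = f h" for e a q
  proof
    assume "(e, g h, a, q) \<in> processed \<tau>"
    then obtain k where "k < h" "f k = f h" "g k = g h"
      using src by (auto simp: processed_def f_def g_def h_def)
    then show False using inj_onD[OF inj, of k h] h h_def by auto
  qed
  show "wp x (Seq (SetReg r_v (Mem m_qv (Reg r_head) (Const 0)))
     (Seq (SetReg r_q (Mem m_qq (Reg r_head) (Const 0)))
     (Seq scan_edges (SetReg r_head (Inc (Reg r_head))))))
     (\<lambda>\<rho>. (bfs_inv (processed \<rho>) \<rho> \<and> reg \<rho> r_head \<le> reg \<rho> r_tail \<and>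
        clock \<rho> \<le> clock \<sigma> + (\<Sum>k<reg \<rho> r_head. 170 * node_cost (mem \<rho> m_qv k 0) (mem \<rho> m_qq k 0))) \<and>
        card (verts D \<times> states A) - reg \<rho> r_head < card (verts D \<times> states A) - reg \<tau> r_head)
     (tick (Suc (bcost (Less (Reg r_head) (Reg r_tail)))) \<tau>)"
    unfolding wp_simps
  proof (rule wp_mono[OF wp_scan_edges[where f = f and g = g and h = h and P = "processed \<tau>"]], goal_cases)
    case 1
    then show ?case using \<tau> h
      by (simp add: node_inv_def bfs_inv_def f_def g_def h_def)
  next
    case 2
    then show ?case by (rule fresh)
  next
    case (3 \<rho>)
    let ?\<rho> = "tick (Suc (cost (Inc (Reg r_head)))) (set_reg r_head (val x \<rho> (Inc (Reg r_head))) \<rho>)"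
    have \<rho>: "bfs_inv (processed \<tau> \<union> {(e, g h, a, q) |e a q. src D e = f h \<and> (e, g h, a, q) \<in> moves}) \<rho>"
      "reg \<rho> r_head = h" "h < reg \<rho> r_tail" "\<forall>k\<le>h. mem \<rho> m_qv k 0 = f k \<and> mem \<rho> m_qq k 0 = g k"
      using 3 by (auto simp: node_inv_def)
    have proc: "processed ?\<rho> = processed \<tau> \<union> {(e, g h, a, q) |e a q. src D e = f h \<and> (e, g h, a, q) \<in> moves}"
    proof -
      have "(\<exists>k<Suc h. mem \<rho> m_qv k 0 = src D e \<and> mem \<rho> m_qq k 0 = p) \<longleftrightarrow>
          (\<exists>k<h. f k = src D e \<and> g k = p) \<or> (f h = src D e \<and> g h = p)" for e p
        using \<rho>(4) by (auto simp: less_Suc_eq)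
      then show ?thesis using \<rho>(2) by (auto simp: processed_def f_def g_def h_def)
    qed
    have "(\<Sum>k<h. 170 * node_cost (mem \<rho> m_qv k 0) (mem \<rho> m_qq k 0)) = (\<Sum>k<h. 170 * node_cost (f k) (g k))"
      using \<rho>(4) by (intro sum.cong) auto
    moreover have "clock \<tau> \<le> clock \<sigma> + (\<Sum>k<h. 170 * node_cost (f k) (g k))"
      using \<tau> by (simp add: f_def g_def h_def)
    moreover have "1 \<le> node_cost (f h) (g h)" by (simp add: node_cost_def)
    ultimately have "clock ?\<rho> \<le> clock \<sigma> + (\<Sum>k<reg ?\<rho> r_head. 170 * node_cost (mem ?\<rho> m_qv k 0) (mem ?\<rho> m_qq k 0))"
      using 3 \<rho>(2,4) by simp
    moreover have "bfs_inv (processed ?\<rho>) ?\<rho>"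
      using \<rho>(1) queue_inv_next \<rho>(2,3) unfolding proc bfs_inv_def by simp
    ultimately show ?case using \<rho> h le by (simp add: h_def)
  qed
next
  fix \<tau> assume \<tau>: "bfs_inv (processed \<tau>) \<tau> \<and> reg \<tau> r_head \<le> reg \<tau> r_tail \<and>
        clock \<tau> \<le> clock \<sigma> + (\<Sum>k<reg \<tau> r_head. 170 * node_cost (mem \<tau> m_qv k 0) (mem \<tau> m_qq k 0))"
    and "\<not> bval x \<tau> (Less (Reg r_head) (Reg r_tail))"
  then have h: "reg \<tau> r_head = reg \<tau> r_tail" by simp
  have "(\<Sum>k<reg \<tau> r_tail. node_cost (mem \<tau> m_qv k 0) (mem \<tau> m_qq k 0)) \<le> database_size D * nfa_size A"
    by (rule order_trans[OF queue_inv_card(3) sum_node_cost]) (use \<tau> in \<open>auto simp: bfs_inv_def\<close>)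
  then have "(\<Sum>k<reg \<tau> r_head. 170 * node_cost (mem \<tau> m_qv k 0) (mem \<tau> m_qq k 0)) \<le> 170 * (database_size D * nfa_size A)"
    unfolding h sum_distrib_left[symmetric] by simp
  then show "bfs_inv (processed (tick (Suc (bcost (Less (Reg r_head) (Reg r_tail)))) \<tau>))
      (tick (Suc (bcost (Less (Reg r_head) (Reg r_tail)))) \<tau>) \<and>
     reg (tick (Suc (bcost (Less (Reg r_head) (Reg r_tail)))) \<tau>) r_head =
     reg (tick (Suc (bcost (Less (Reg r_head) (Reg r_tail)))) \<tau>) r_tail \<and>
     clock (tick (Suc (bcost (Less (Reg r_head) (Reg r_tail)))) \<tau>) \<le>
       clock \<sigma> + 170 * (database_size D * nfa_size A) + 10"
    using \<tau> h by (simp add: bfs_inv_def processed_def)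
qed

text \<open>The loop invariant describes the memory directly: \<open>queue_inv\<close> wants all
  initial states at distance 1 and is established only after the last round.\<close>

lemma wp_init_queue:
  "wp x init_queue (\<lambda>\<tau>. bfs_inv {} \<tau> \<and> reg \<tau> r_head = 0 \<and> clock \<tau> \<le> 40 * card (initials A) + 10) start"
  unfolding init_queue_def
proof (rule wp_For_list[where xs = "init_arr x" and F = "\<lambda>_. 30"
      and J = "\<lambda>Y \<tau>. frame {r_tail, r_i, r_p} {m_dist, m_qv, m_qq} start \<tau> \<and>
         (\<forall>v q. mem \<tau> m_dist v q = (if v = s \<and> q \<in> Y then 1 else 0)) \<and>
         (\<forall>k<reg \<tau> r_tail. mem \<tau> m_qv k 0 = s) \<and>
         bij_betw (\<lambda>k. mem \<tau> m_qq k 0) {..<reg \<tau> r_tail} Y"])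
  show "distinct (init_arr x)" using init_arr by simp
  fix Y q and \<tau> :: config
  assume q: "q \<in> set (init_arr x)" "q \<notin> Y" "entry (init_arr x) (reg \<tau> r_i) = q"
    and J: "frame {r_tail, r_i, r_p} {m_dist, m_qv, m_qq} start \<tau> \<and>
         (\<forall>v q. mem \<tau> m_dist v q = (if v = s \<and> q \<in> Y then 1 else 0)) \<and>
         (\<forall>k<reg \<tau> r_tail. mem \<tau> m_qv k 0 = s) \<and>
         bij_betw (\<lambda>k. mem \<tau> m_qq k 0) {..<reg \<tau> r_tail} Y"
  let ?n = "reg \<tau> r_tail"
  let ?qq = "(mem \<tau> m_qq)(?n := (mem \<tau> m_qq ?n)(0 := q))"
  have "bij_betw ((\<lambda>k. mem \<tau> m_qq k 0)(?n := q)) {..<Suc ?n} (insert q Y)"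
    by (rule bij_betw_snoc) (use J q in auto)
  moreover have "(\<lambda>k. mem \<tau> m_qq k 0)(?n := q) = (\<lambda>k. ?qq k 0)" by auto
  ultimately have bij: "bij_betw (\<lambda>k. ?qq k 0) {..<Suc ?n} (insert q Y)" by simp
  then show "wp x (Seq (SetReg r_p (InitAt (Reg r_i))) (enqueue Source (Reg r_p) (Const 1)))
       (\<lambda>\<rho>. (frame {r_tail, r_i, r_p} {m_dist, m_qv, m_qq} start \<rho> \<and>
         (\<forall>v q'. mem \<rho> m_dist v q' = (if v = s \<and> q' \<in> insert q Y then 1 else 0)) \<and>
         (\<forall>k<reg \<rho> r_tail. mem \<rho> m_qv k 0 = s) \<and>
         bij_betw (\<lambda>k. mem \<rho> m_qq k 0) {..<reg \<rho> r_tail} (insert q Y)) \<and>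
         reg \<rho> r_i = reg \<tau> r_i \<and> clock \<rho> \<le> clock \<tau> + 30) \<tau>"
    using J q bij by (simp add: enqueue_def source less_Suc_eq)
next
  fix \<tau> :: config
  let ?qq = "mem \<tau> m_qq" and ?qv = "mem \<tau> m_qv" and ?d = "mem \<tau> m_dist" and ?n = "reg \<tau> r_tail"
  assume J: "frame {r_tail, r_i, r_p} {m_dist, m_qv, m_qq} start \<tau> \<and>
         (\<forall>v q. mem \<tau> m_dist v q = (if v = s \<and> q \<in> set (init_arr x) then 1 else 0)) \<and>
         (\<forall>k<reg \<tau> r_tail. mem \<tau> m_qv k 0 = s) \<and>
         bij_betw (\<lambda>k. mem \<tau> m_qq k 0) {..<reg \<tau> r_tail} (set (init_arr x))"
    and clock: "clock \<tau> \<le> clock start + (\<Sum>y\<in>set (init_arr x). 30 + cost InitLen + 6) + cost InitLen + 5"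
  have d: "?d v q = (if v = s \<and> q \<in> initials A then 1 else 0)" for v q using J init_arr by simp
  have qv: "?qv k 0 = s" if "k < ?n" for k using J that by blast
  have inj: "inj_on (\<lambda>k. ?qq k 0) {..<?n}" and image: "(\<lambda>k. ?qq k 0) ` {..<?n} = initials A"
    using J init_arr by (auto simp: bij_betw_def)
  have in_init: "?qq k 0 \<in> initials A" if "k < ?n" for k using image that by blast
  have in_queue: "\<exists>k<?n. ?qq k 0 = q" if "q \<in> initials A" for q
    using image that by (metis (no_types, lifting) imageE lessThan_iff)
  have d_queue: "?d (?qv k 0) (?qq k 0) = 1" if "k < ?n" for k
    using d qv in_init that by simp
  have head: "reg \<tau> r_head = 0" "reg \<tau> r_ids = 0" "mem \<tau> m_id = (\<lambda>_ _. 0)" "mem \<tau> m_count = (\<lambda>_ _. 0)"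
    using J by (auto simp: frame_def)
  have "queue_inv ?d ?qv ?qq ?n 0 {}"
    unfolding queue_inv_def
  proof (intro conjI allI impI ballI)
    fix v q
    show "?d v q > 0 \<longleftrightarrow> (\<exists>k<?n. ?qv k 0 = v \<and> ?qq k 0 = q)"
      using d[of v q] qv in_queue[of q] in_init by auto
    show "?d v q > 0 \<Longrightarrow> reach (?d v q - 1) v q"
      using d[of v q] by (auto split: if_splits)
  next
    show "inj_on (\<lambda>k. (?qv k 0, ?qq k 0)) {..<?n}"
      using inj by (auto simp: inj_on_def)
  qed (use d_queue d in auto)
  moreover have "store_inv ?d (mem \<tau> m_id) (reg \<tau> r_ids) (mem \<tau> m_count) (mem \<tau> m_pred) {}"
    using head by (simp add: store_inv_def good_def)
  moreover have "frame bfs_regs bfs_arrays start \<tau>"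
    using J by (auto simp: frame_def)
  ultimately show "bfs_inv {} \<tau> \<and> reg \<tau> r_head = 0 \<and> clock \<tau> \<le> 40 * card (initials A) + 10"
    using head clock init_arr by (simp add: bfs_inv_def)
qed (auto simp: bij_betw_def)

end

text \<open>A pass from right to left: the entry for a position is that position if its edge is
  usable, and otherwise the value for its right neighbour, kept in \<open>r_j\<close>. The array
  length stands for none.\<close>

definition link_node :: com where
  "link_node = Seq (SetReg r_v (Mem m_qv (Reg r_head) (Const 0)))
     (Seq (SetReg r_q (Mem m_qq (Reg r_head) (Const 0)))
     (Seq (SetReg r_j (InLen (Reg r_v)))
     (Seq (SetReg r_i (InLen (Reg r_v)))
       (For r_k (InLen (Reg r_v))
         (Seq (SetReg r_i (Dec (Reg r_i)))
         (Seq (SetReg r_e (InAt (Reg r_v) (Reg r_i)))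
         (Seq (Cond (Equal (Mem m_id (Reg r_e) (Reg r_q)) (Const 0)) Skip (SetReg r_j (Reg r_i)))
           (SetMem m_next (Reg r_e) (Reg r_q) (Reg r_j)))))))))"

text \<open>The queue of the finished search lists the reached pairs. Linking only these is enough,
  since a stack row holds only states reached at its vertex.\<close>

definition link :: com where
  "link = For r_head (Reg r_tail) link_node"

definition add_state :: "exp \<Rightarrow> exp \<Rightarrow> com" where
  "add_state l p = Seq (SetMem m_set l (Mem m_size l (Const 0)) p)
     (SetMem m_size l (Const 0) (Inc (Mem m_size l (Const 0))))"

text \<open>\<open>r_best\<close> is a distance plus one, like the entries of \<open>m_dist\<close>,
  so 0 means that no final state has been reached at the target.\<close>

definition find_best :: com where
  "find_best = For r_i FinalLen
     (Seq (SetReg r_p (FinalAt (Reg r_i)))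
       (Cond (Equal (Mem m_dist Target (Reg r_p)) (Const 0)) Skip
         (Cond (Conj (Neg (Equal (Reg r_best) (Const 0))) (Neg (Less (Mem m_dist Target (Reg r_p)) (Reg r_best))))
           Skip (SetReg r_best (Mem m_dist Target (Reg r_p))))))"

definition init_stack :: com where
  "init_stack = Seq (SetReg r_level (Dec (Reg r_best)))
     (Seq (SetMem m_vert (Reg r_level) (Const 0) Target)
       (For r_i FinalLen
         (Seq (SetReg r_p (FinalAt (Reg r_i)))
           (Cond (Equal (Mem m_dist Target (Reg r_p)) (Reg r_best))
             (add_state (Reg r_level) (Reg r_p)) Skip))))"

section \<open>Links to the next usable edge and the start of the stack\<close>

context problem
begin

definition tables :: "config \<Rightarrow> bool" where
  "tables \<sigma> \<longleftrightarrow> (\<forall>e q. mem \<sigma> m_id e q = 0 \<longleftrightarrow> tight e q = {}) \<and>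
     (\<forall>e q. mem \<sigma> m_count (mem \<sigma> m_id e q) 0 = card (tight e q)) \<and>
     (\<forall>e q. mem \<sigma> m_pred (mem \<sigma> m_id e q) ` {..<mem \<sigma> m_count (mem \<sigma> m_id e q) 0} = fst ` tight e q)"

lemma tables_frame: "tables \<sigma> \<Longrightarrow> frame R M \<sigma> \<tau> \<Longrightarrow> {m_id, m_count, m_pred} \<inter> M = {} \<Longrightarrow> tables \<tau>"
proof -
  assume "tables \<sigma>" "frame R M \<sigma> \<tau>" "{m_id, m_count, m_pred} \<inter> M = {}"
  then have eq: "mem \<tau> m_id = mem \<sigma> m_id" "mem \<tau> m_count = mem \<sigma> m_count" "mem \<tau> m_pred = mem \<sigma> m_pred"
    by (auto intro: frame_mem)
  show "tables \<tau>" using \<open>tables \<sigma>\<close> unfolding tables_def eq .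
qed

text \<open>With an exhausted queue every discovered pair has been expanded, so all moves out of
  discovered pairs are processed and both invariants become exact.\<close>

lemma bfs_final:
  assumes inv: "bfs_inv (processed \<sigma>) \<sigma>" and head: "reg \<sigma> r_head = reg \<sigma> r_tail"
  shows "tables \<sigma>" and "mem \<sigma> m_dist v q = Suc k \<longleftrightarrow> lev k v q"
    and "lev k v q \<Longrightarrow> \<exists>i<reg \<sigma> r_tail. mem \<sigma> m_qv i 0 = v \<and> mem \<sigma> m_qq i 0 = q"
proof -
  let ?d = "mem \<sigma> m_dist"
  have queue: "queue_inv ?d (mem \<sigma> m_qv) (mem \<sigma> m_qq) (reg \<sigma> r_tail) (reg \<sigma> r_head) (processed \<sigma>)"
    and store: "store_inv ?d (mem \<sigma> m_id) (reg \<sigma> r_ids) (mem \<sigma> m_count) (mem \<sigma> m_pred) (processed \<sigma>)"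
    using inv by (auto simp: bfs_inv_def)
  have pos: "?d v q > 0 \<longleftrightarrow> (\<exists>i<reg \<sigma> r_tail. mem \<sigma> m_qv i 0 = v \<and> mem \<sigma> m_qq i 0 = q)" for v q
    using queue unfolding queue_inv_def by blast
  then have all: "(e, p, a, q) \<in> processed \<sigma>" if "(e, p, a, q) \<in> moves" "?d (src D e) p > 0" for e p a q
    using that by (auto simp: processed_def head)
  show lev: "?d v q = Suc k \<longleftrightarrow> lev k v q" for v q k
    by (rule queue_inv_final[OF queue all])
  have good: "good ?d (processed \<sigma>) = tight"
    by (intro ext good_final[OF queue all])
  show "tables \<sigma>"
    using store unfolding store_inv_def good tables_def by (elim conjE, intro conjI)
  assume "lev k v q"
  then have "?d v q = Suc k" using lev by blast
  then have "?d v q > 0" by simp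
  then show "\<exists>i<reg \<sigma> r_tail. mem \<sigma> m_qv i 0 = v \<and> mem \<sigma> m_qq i 0 = q" by (simp only: pos)
qed

text \<open>The alternative \<open>length (in_arr x v) \<le> j\<close> makes the least value exist
  for every \<open>i\<close>; a result from the length on means that no usable edge is left. For
  \<open>i\<close> beyond the array the result is \<open>i\<close> itself.\<close>

definition nxt :: "nat \<Rightarrow> nat set \<Rightarrow> nat \<Rightarrow> nat" where
  "nxt v S i = (LEAST j. i \<le> j \<and> (length (in_arr x v) \<le> j \<or> stp S (in_arr x v ! j) \<noteq> {}))"

lemma nxt_end: "length (in_arr x v) \<le> i \<Longrightarrow> nxt v S i = i"
  unfolding nxt_def by (rule Least_equality) auto

lemma nxt_step: "i < length (in_arr x v) \<Longrightarrow>
    nxt v S i = (if stp S (in_arr x v ! i) = {} then nxt v S (Suc i) else i)"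
proof -
  assume i: "i < length (in_arr x v)"
  have "nxt v S i = nxt v S (Suc i)" if "stp S (in_arr x v ! i) = {}"
    unfolding nxt_def
    by (rule arg_cong[where f = Least]) (use i that in \<open>auto simp: Suc_le_eq order_le_less fun_eq_iff\<close>)
  moreover have "nxt v S i = i" if "stp S (in_arr x v ! i) \<noteq> {}"
    unfolding nxt_def by (rule Least_equality) (use that in auto)
  ultimately show ?thesis by simp
qed

lemma nxt_empty: "i \<le> length (in_arr x v) \<Longrightarrow> nxt v {} i = length (in_arr x v)"
  unfolding nxt_def by (rule Least_equality) (auto simp: stp_def)

text \<open>\<open>stp\<close> distributes over unions of state sets. Thus entries for single states
  serve all sets of states, of which there are too many to tabulate.\<close>

lemma nxt_insert:
  assumes "i \<le> length (in_arr x v)"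
  shows "nxt v (insert q S) i = min (nxt v {q} i) (nxt v S i)"
  using assms
proof (induction i rule: inc_induct)
  case base
  then show ?case by (simp add: nxt_end)
next
  case (step i)
  have split: "stp (insert q S) e = stp {q} e \<union> stp S e" for e
    by (auto simp: stp_def)
  \<comment> \<open>Values for \<open>Suc i\<close> exceed \<open>i\<close>, so the minimum is
    \<open>i\<close> as soon as one of the two sides stops there.\<close>
  have le: "Suc i \<le> nxt v S' (Suc i)" for S'
    unfolding nxt_def using LeastI[of "\<lambda>j. Suc i \<le> j \<and> (length (in_arr x v) \<le> j \<or> stp S' (in_arr x v ! j) \<noteq> {})"
      "max (Suc i) (length (in_arr x v))"] by simp
  note le[of "{q}"] le[of S]
  then show ?case
    unfolding nxt_step[OF \<open>i < length (in_arr x v)\<close>] split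
    using step.IH by (simp add: min_def)
qed

lemma wp_link_node:
  assumes v: "mem \<sigma> m_qv (reg \<sigma> r_head) 0 = v" "v \<in> verts D" and q: "mem \<sigma> m_qq (reg \<sigma> r_head) 0 = q"
    and tables: "tables \<sigma>"
  shows "wp x link_node (\<lambda>\<tau>. frame {r_v, r_q, r_j, r_i, r_k, r_e} {m_next} \<sigma> \<tau> \<and>
     (\<forall>i<length (in_arr x v). mem \<tau> m_next (in_arr x v ! i) q = nxt v {q} i) \<and>
     (\<forall>e q'. e \<notin> set (in_arr x v) \<or> q' \<noteq> q \<longrightarrow> mem \<tau> m_next e q' = mem \<sigma> m_next e q') \<and>
     clock \<tau> \<le> clock \<sigma> + 40 * (1 + length (in_arr x v))) \<sigma>"
  unfolding link_node_def wp_simps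
proof (rule wp_For[where n = "length (in_arr x v)" and f = "\<lambda>_. 25" and
      J = "\<lambda>c \<tau>. frame {r_v, r_q, r_j, r_i, r_k, r_e} {m_next} \<sigma> \<tau> \<and> reg \<tau> r_v = v \<and> reg \<tau> r_q = q \<and>
     reg \<tau> r_i = length (in_arr x v) - c \<and> reg \<tau> r_j = nxt v {q} (reg \<tau> r_i) \<and>
     (\<forall>i<length (in_arr x v). reg \<tau> r_i \<le> i \<longrightarrow> mem \<tau> m_next (in_arr x v ! i) q = nxt v {q} i) \<and>
     (\<forall>e q'. e \<notin> set (in_arr x v) \<or> q' \<noteq> q \<longrightarrow> mem \<tau> m_next e q' = mem \<sigma> m_next e q')"], goal_cases)
  case 1
  then show ?case using v q by (simp add: nxt_end)
next
  case (5 c \<tau>)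
  let ?in = "in_arr x v"
  define i where "i = reg \<tau> r_i - 1"
  have i: "i < length ?in" "reg \<tau> r_i = Suc i" "i = length ?in - Suc c" using 5 by (auto simp: i_def)
  have e: "entry ?in i = ?in ! i" using i by (simp add: entry_def)
  have id: "mem \<tau> m_id (?in ! i) q = 0 \<longleftrightarrow> stp {q} (?in ! i) = {}"
    using 5 tables by (simp add: frame_def tables_def stp_def)
  \<comment> \<open>The array is distinct, so the write for position \<open>i\<close> leaves the
    entries of all other positions intact.\<close>
  have dist: "?in ! i \<noteq> ?in ! k" if "k < length ?in" "k \<noteq> i" for k
    using in_arr[OF v(2)] i that by (simp add: nth_eq_iff_index_eq)
  have upd: "\<forall>k<length ?in. i \<le> k \<longrightarrow> ((mem \<tau> m_next)(?in ! i := (mem \<tau> m_next (?in ! i))(q := nxt v {q} i))) (?in ! k) q = nxt v {q} k"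
  proof (intro allI impI)
    fix k assume k: "k < length ?in" "i \<le> k"
    show "((mem \<tau> m_next)(?in ! i := (mem \<tau> m_next (?in ! i))(q := nxt v {q} i))) (?in ! k) q = nxt v {q} k"
    proof (cases "k = i")
      case False
      then have "reg \<tau> r_i \<le> k" using k i by simp
      then have "mem \<tau> m_next (?in ! k) q = nxt v {q} k" using 5 k by blast
      with dist[OF k(1) False] show ?thesis by simp
    qed simp
  qed
  have other: "\<forall>e q'. e \<notin> set ?in \<or> q' \<noteq> q \<longrightarrow>
     ((mem \<tau> m_next)(?in ! i := (mem \<tau> m_next (?in ! i))(q := nxt v {q} i))) e q' = mem \<sigma> m_next e q'"
    using 5 i by auto
  have step: "nxt v {q} i = (if mem \<tau> m_id (?in ! i) q = 0 then nxt v {q} (Suc i) else i)"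
    using nxt_step[OF i(1), of "{q}"] id by simp
  have regs: "reg \<tau> r_v = v" "reg \<tau> r_q = q" "reg \<tau> r_j = nxt v {q} (Suc i)"
    and frame: "frame {r_v, r_q, r_j, r_i, r_k, r_e} {m_next} \<sigma> \<tau>"
    using 5 i by auto
  show ?case
  proof (cases "mem \<tau> m_id (?in ! i) q = 0")
    case True
    show ?thesis
      using regs frame upd other i(2) i(3)[symmetric] True step \<open>reg \<tau> r_k = c\<close>
      by (simp add: e del: fun_upd_apply) (simp add: fun_upd_def e)
  next
    case False
    show ?thesis
      using regs frame upd other i(2) i(3)[symmetric] False step \<open>reg \<tau> r_k = c\<close>
      by (simp add: e del: fun_upd_apply) (simp add: fun_upd_def e)
  qed
next
  case (6 \<tau>)
  then show ?case by simp
qed auto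

lemma sum_indegree: "(\<Sum>v\<in>verts D. length (in_arr x v)) = card (edges D)"
proof -
  have "(\<Sum>v\<in>verts D. length (in_arr x v)) = (\<Sum>v\<in>verts D. \<Sum>e | e \<in> edges D \<and> tgt D e = v. 1)"
    by (rule sum.cong) (use in_arr in \<open>auto simp flip: distinct_card\<close>)
  also have "\<dots> = (\<Sum>e\<in>edges D. 1)"
    by (rule sum.group) (use finite_input edge in auto)
  finally show ?thesis by simp
qed

lemma wp_link:
  assumes inv: "bfs_inv (processed \<sigma>) \<sigma>" and head: "reg \<sigma> r_head = reg \<sigma> r_tail"
  shows "wp x link (\<lambda>\<tau>. frame {r_head, r_v, r_q, r_j, r_i, r_k, r_e} {m_next} \<sigma> \<tau> \<and>
     (\<forall>v q k i. lev k v q \<longrightarrow> i < length (in_arr x v) \<longrightarrow> mem \<tau> m_next (in_arr x v ! i) q = nxt v {q} i) \<and>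
     clock \<tau> \<le> clock \<sigma> + 50 * (database_size D * nfa_size A) + 6) \<sigma>"
proof -
  define v q where "v k = mem \<sigma> m_qv k 0" and "q k = mem \<sigma> m_qq k 0" for k
  have queue: "queue_inv (mem \<sigma> m_dist) (mem \<sigma> m_qv) (mem \<sigma> m_qq) (reg \<sigma> r_tail) (reg \<sigma> r_head) (processed \<sigma>)"
    using inv by (auto simp: bfs_inv_def)
  have vert: "v k \<in> verts D" if "k < reg \<sigma> r_tail" for k
    using queue_inv_card(1)[OF queue] that by (auto simp: v_def)
  show ?thesis
    unfolding link_def
  proof (rule wp_For[where n = "reg \<sigma> r_tail" and f = "\<lambda>k. 40 * (1 + length (in_arr x (v k)))" and
      J = "\<lambda>n \<tau>. frame {r_head, r_v, r_q, r_j, r_i, r_k, r_e} {m_next} \<sigma> \<tau> \<and>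
        (\<forall>k<n. \<forall>i<length (in_arr x (v k)). mem \<tau> m_next (in_arr x (v k) ! i) (q k) = nxt (v k) {q k} i)"],
      goal_cases)
    case (4 n \<tau>)
    then show ?case by (simp add: frame_def)
  next
    case (5 n \<tau>)
    show ?case
    proof (rule wp_mono[OF wp_link_node[where v = "v n" and q = "q n"]], goal_cases)
      case 1
      then show ?case using 5 by (simp add: frame_def v_def)
    next
      case 2
      then show ?case using 5 vert by simp
    next
      case 3
      then show ?case using 5 by (simp add: frame_def q_def)
    next
      case 4
      then show ?case using 5 tables_frame[OF bfs_final(1)[OF inv head]] by auto
    next
      case (5 \<rho>)
      have frame: "frame {r_head, r_v, r_q, r_j, r_i, r_k, r_e} {m_next} \<sigma> \<rho>"
        by (rule frame_trans[of "{r_head, r_v, r_q, r_j, r_i, r_k, r_e}" "{m_next}" \<sigma> \<tau> "{r_v, r_q, r_j, r_i, r_k, r_e}" "{m_next}"])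
          (use 5 \<open>frame _ _ \<sigma> \<tau> \<and> _\<close> in auto)
      have "mem \<rho> m_next (in_arr x (v k) ! i) (q k) = nxt (v k) {q k} i"
        if k: "k < Suc n" "i < length (in_arr x (v k))" for k i
      \<comment> \<open>The writes for queue entry \<open>n\<close> can hit the cell of an earlier
        entry \<open>k\<close> only if edge and state agree. An edge has one target, so then
        \<open>v k = v n\<close> and the cell receives the same value.\<close>
      proof (cases "in_arr x (v k) ! i \<in> set (in_arr x (v n)) \<and> q k = q n")
        case True
        have "tgt D (in_arr x (v k) ! i) = v k"
          using in_arr[OF vert, of k] k \<open>n < reg \<sigma> r_tail\<close> nth_mem[OF k(2)] by auto
        moreover have "tgt D (in_arr x (v k) ! i) = v n"
          using in_arr[OF vert, of n] True \<open>n < reg \<sigma> r_tail\<close> by auto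
        ultimately have "v k = v n" by simp
        then show ?thesis using 5 True k by simp
      next
        case False
        then have "k \<noteq> n" using k nth_mem by auto
        with k have "k < n" by simp
        then show ?thesis using 5 False k \<open>frame _ _ \<sigma> \<tau> \<and> _\<close> by auto
      qed
      then show ?case using 5 frame \<open>reg \<tau> r_head = n\<close> by (auto simp: frame_def)
    qed
  next
    case (6 \<tau>)
    have next_entry: "mem \<tau> m_next (in_arr x v' ! i) q' = nxt v' {q'} i"
      if "lev k v' q'" "i < length (in_arr x v')" for v' q' k i
      using bfs_final(3)[OF inv head that(1)] 6 that(2) by (auto simp: v_def q_def)
    have "(\<Sum>k<reg \<sigma> r_tail. 1 + length (in_arr x (v k))) \<le>
        (\<Sum>v\<in>verts D. \<Sum>q\<in>states A. 1 + length (in_arr x v))"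
      unfolding v_def by (rule queue_inv_card(3)[OF queue])
    moreover have "(\<Sum>v\<in>verts D. \<Sum>q\<in>states A. 1 + length (in_arr x v)) =
        card (verts D) * card (states A) + card (edges D) * card (states A)"
      unfolding sum_indegree[symmetric] by (simp add: sum.distrib sum_Suc sum_distrib_left algebra_simps)
    moreover have "(\<Sum>k<reg \<sigma> r_tail. 40 * (1 + length (in_arr x (v k))) + cost (Reg r_tail) + 6) \<le>
        50 * (\<Sum>k<reg \<sigma> r_tail. 1 + length (in_arr x (v k)))"
      unfolding sum_distrib_left by (rule sum_mono) simp
    moreover have "cost (Reg r_tail) = 1" by simp
    moreover have "clock \<tau> \<le> clock \<sigma> + (\<Sum>k<reg \<sigma> r_tail. 40 * (1 + length (in_arr x (v k))) + cost (Reg r_tail) + 6) +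
        cost (Reg r_tail) + 5" using 6 by simp
    ultimately have "clock \<tau> \<le> clock \<sigma> + 50 * (database_size D * nfa_size A) + 6"
      using size_bounds by linarith
    with next_entry 6 show ?case by blast
  qed auto
qed

lemma wp_find_best:
  assumes dist: "\<And>q k. mem \<sigma> m_dist t q = Suc k \<longleftrightarrow> lev k t q" and best: "reg \<sigma> r_best = 0"
  shows "wp x find_best (\<lambda>\<tau>. frame {r_i, r_p, r_best} {} \<sigma> \<tau> \<and>
     (if reg \<tau> r_best = 0 then \<forall>q\<in>finals A. \<forall>k. \<not> lev k t q
      else (\<exists>q\<in>finals A. lev (reg \<tau> r_best - 1) t q) \<and> (\<forall>q\<in>finals A. \<forall>k. lev k t q \<longrightarrow> reg \<tau> r_best - 1 \<le> k)) \<and>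
     clock \<tau> \<le> clock \<sigma> + 50 * card (states A) + 6) \<sigma>"
  unfolding find_best_def
proof (rule wp_For_list[where xs = "final_arr x" and F = "\<lambda>_. 40" and
      J = "\<lambda>Y \<tau>. frame {r_i, r_p, r_best} {} \<sigma> \<tau> \<and>
     (if reg \<tau> r_best = 0 then \<forall>q\<in>Y. mem \<sigma> m_dist t q = 0
      else (\<exists>q\<in>Y. mem \<sigma> m_dist t q = reg \<tau> r_best) \<and> (\<forall>q\<in>Y. mem \<sigma> m_dist t q > 0 \<longrightarrow> reg \<tau> r_best \<le> mem \<sigma> m_dist t q))"],
    goal_cases)
  case 1
  then show ?case using final_arr by simp
next
  case (6 q Y \<tau>)
  have "mem \<tau> m_dist = mem \<sigma> m_dist" using 6 by (simp add: frame_def)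
  then show ?case using 6 by (auto simp: target split: if_splits)
next
  case (7 \<tau>)
  have d: "mem \<sigma> m_dist t q = 0 \<longleftrightarrow> (\<forall>k. \<not> lev k t q)" for q
    using dist[of q] by (metis not0_implies_Suc nat.distinct(1))
  have le: "card (finals A) \<le> card (states A)"
    using nfa finite_input(3) by (intro card_mono) (auto simp: nfa_def)
  have "if reg \<tau> r_best = 0 then \<forall>q\<in>finals A. \<forall>k. \<not> lev k t q
      else (\<exists>q\<in>finals A. lev (reg \<tau> r_best - 1) t q) \<and> (\<forall>q\<in>finals A. \<forall>k. lev k t q \<longrightarrow> reg \<tau> r_best - 1 \<le> k)"
  proof (cases "reg \<tau> r_best")
    case 0
    then show ?thesis using 7 d final_arr by simp
  next
    case (Suc n)
    have "mem \<sigma> m_dist t q \<ge> Suc n" if "q \<in> finals A" "lev k t q" for q k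
      using 7 Suc d that final_arr by auto
    then have "n \<le> k" if "q \<in> finals A" "lev k t q" for q k
      using that dist by (metis Suc_le_mono)
    moreover have "\<exists>q\<in>finals A. lev n t q" using 7 Suc final_arr dist by auto
    ultimately show ?thesis using Suc by auto
  qed
  then show ?case using 7 final_arr le by simp
qed (use best in auto)

lemma wp_init_stack:
  assumes best: "reg \<sigma> r_best = Suc l" and dist: "\<And>q k. mem \<sigma> m_dist t q = Suc k \<longleftrightarrow> lev k t q"
    and size: "mem \<sigma> m_size = (\<lambda>_ _. 0)"
  shows "wp x init_stack (\<lambda>\<tau>. frame {r_i, r_p, r_level} {m_vert, m_set, m_size} \<sigma> \<tau> \<and> reg \<tau> r_level = l \<and>
     mem \<tau> m_vert l 0 = t \<and> bij_betw (mem \<tau> m_set l) {..<mem \<tau> m_size l 0} {q \<in> finals A. lev l t q} \<and>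
     clock \<tau> \<le> clock \<sigma> + 50 * card (states A) + 20) \<sigma>"
  unfolding init_stack_def wp_simps
proof (rule wp_For_list[where xs = "final_arr x" and F = "\<lambda>_. 40" and
      J = "\<lambda>Y \<tau>. frame {r_i, r_p, r_level} {m_vert, m_set, m_size} \<sigma> \<tau> \<and> reg \<tau> r_level = l \<and>
     mem \<tau> m_vert l 0 = t \<and> bij_betw (mem \<tau> m_set l) {..<mem \<tau> m_size l 0} {q \<in> Y. lev l t q}"],
    goal_cases)
  case 1
  then show ?case using final_arr by simp
next
  case 2
  then show ?case using best size target by (simp add: bij_betw_def)
next
  case (6 q Y \<tau>)
  have [simp]: "mem \<tau> m_dist = mem \<sigma> m_dist" "reg \<tau> r_best = Suc l" using 6 best by (simp_all add: frame_def)
  show ?case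
  proof (cases "lev l t q")
    case True
    then have "{r \<in> insert q Y. lev l t r} = insert q {r \<in> Y. lev l t r}" by auto
    moreover have "bij_betw ((mem \<tau> m_set l)(mem \<tau> m_size l 0 := q)) {..<Suc (mem \<tau> m_size l 0)} (insert q {r \<in> Y. lev l t r})"
      by (rule bij_betw_snoc) (use 6 in auto)
    ultimately show ?thesis using 6 True dist by (simp add: target add_state_def del: fun_upd_apply) (simp add: fun_upd_same)
  next
    case False
    then have "{r \<in> insert q Y. lev l t r} = {r \<in> Y. lev l t r}" by auto
    then show ?thesis using 6 False dist by (simp add: target)
  qed
next
  case (7 \<tau>)
  have "card (finals A) \<le> card (states A)"
    using nfa finite_input(3) by (intro card_mono) (auto simp: nfa_def)
  then show ?case using 7 final_arr by simp
qed auto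

end

section \<open>The enumeration program\<close>

text \<open>The edge at the current index serves only as a key into \<open>m_next\<close>;
  \<open>r_j\<close> becomes the least entry over the states of the row. An index at the end of the
  array provides no key, hence the outer conditional.\<close>

definition find_next :: com where
  "find_next = Seq (SetReg r_v (Mem m_vert (Reg r_level) (Const 0)))
     (Seq (SetReg r_j (InLen (Reg r_v)))
     (Seq (SetReg r_i (Mem m_index (Reg r_level) (Const 0)))
       (Cond (Less (Reg r_i) (Reg r_j))
         (Seq (SetReg r_e (InAt (Reg r_v) (Reg r_i)))
           (For r_k (Mem m_size (Reg r_level) (Const 0))
             (Seq (SetReg r_a (Mem m_next (Reg r_e) (Mem m_set (Reg r_level) (Reg r_k))))
               (Cond (Less (Reg r_a) (Reg r_j)) (SetReg r_j (Reg r_a)) Skip))))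
         Skip)))"

text \<open>Here \<open>r_q\<close> holds the number of the upper row, not a state, and
  \<open>r_a\<close> the number of a predecessor list. The marks keep the new row free of
  repetitions.\<close>

definition collect :: com where
  "collect = For r_k (Mem m_size (Reg r_q) (Const 0))
     (Seq (SetReg r_a (Mem m_id (Reg r_e) (Mem m_set (Reg r_q) (Reg r_k))))
       (For r_i (Mem m_count (Reg r_a) (Const 0))
         (Seq (SetReg r_p (Mem m_pred (Reg r_a) (Reg r_i)))
           (Cond (Equal (Mem m_mark (Reg r_p) (Const 0)) (Reg r_stamp)) Skip
             (Seq (SetMem m_mark (Reg r_p) (Const 0) (Reg r_stamp)) (add_state (Reg r_level) (Reg r_p)))))))"

text \<open>The upper index is moved past the chosen edge before the descent, so that climbing back
  resumes behind it.\<close>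

definition descend :: com where
  "descend = Seq (SetReg r_e (InAt (Reg r_v) (Reg r_j)))
     (Seq (SetMem m_index (Reg r_level) (Const 0) (Inc (Reg r_j)))
     (Seq (SetMem m_edge (Reg r_level) (Const 0) (Reg r_e))
     (Seq (SetReg r_q (Reg r_level))
     (Seq (SetReg r_level (Dec (Reg r_level)))
     (Seq (SetMem m_vert (Reg r_level) (Const 0) (SrcOf (Reg r_e)))
     (Seq (SetMem m_index (Reg r_level) (Const 0) (Const 0))
     (Seq (SetMem m_size (Reg r_level) (Const 0) (Const 0))
     (Seq (SetReg r_stamp (Inc (Reg r_stamp)))
       collect))))))))"

definition go_down :: com where
  "go_down = While (Less (Const 0) (Reg r_level)) (Seq find_next descend)"

text \<open>Row 0 belongs to the source, so reading the rows upwards gives the walk in forward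
  direction. The edge from row \<open>i\<close> to row \<open>i + 1\<close> is stored in row
  \<open>i + 1\<close>, where it was chosen.\<close>

definition deliver :: com where
  "deliver = Seq (For r_i (Dec (Reg r_best))
       (Seq (Emit (Mem m_vert (Reg r_i) (Const 0))) (Emit (Mem m_edge (Inc (Reg r_i)) (Const 0)))))
     (Seq (Emit (Mem m_vert (Dec (Reg r_best)) (Const 0))) Finish)"

text \<open>Starts at level 1, as level 0 offers no edge. It only locates a level with a usable edge
  and leaves the choice to the next descent; reaching level \<open>r_best\<close>, one above the top
  row, signals the end.\<close>

definition go_up :: com where
  "go_up = Seq (SetReg r_level (Const 1)) (Seq (SetReg r_stop (Const 0))
     (While (Conj (Less (Reg r_level) (Reg r_best)) (Equal (Reg r_stop) (Const 0)))
       (Seq find_next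
         (Cond (Less (Reg r_j) (InLen (Reg r_v))) (SetReg r_stop (Const 1)) (SetReg r_level (Inc (Reg r_level)))))))"

section \<open>The stack as an encoding of the walks still to be delivered\<close>

context problem
begin

text \<open>A stack row with its current index stands for a suffix of the corresponding
  \<open>branches\<close> list.\<close>

definition rest :: "nat \<Rightarrow> nat \<Rightarrow> nat set \<Rightarrow> nat \<Rightarrow> nat list list" where
  "rest l v S i = (case l of 0 \<Rightarrow> [[]] | Suc l' \<Rightarrow> concat (map (\<lambda>e. if stp S e = {} then []
     else map ((#) e) (branches l' (src D e) (stp S e))) (drop i (in_arr x v))))"

lemma rest_zero: "rest l v S 0 = branches l v S"
  by (simp add: rest_def split: nat.split)

text \<open>Edges skipped by \<open>nxt\<close> contribute empty blocks, so the suffix either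
  vanishes or begins with the block of the edge at \<open>nxt\<close>.\<close>

lemma rest_nxt:
  "if nxt v S i < length (in_arr x v)
   then stp S (in_arr x v ! nxt v S i) \<noteq> {} \<and>
     rest (Suc l) v S i = map ((#) (in_arr x v ! nxt v S i))
       (branches l (src D (in_arr x v ! nxt v S i)) (stp S (in_arr x v ! nxt v S i))) @
       rest (Suc l) v S (Suc (nxt v S i))
   else rest (Suc l) v S i = []"
proof (cases "i \<le> length (in_arr x v)")
  case True
  then show ?thesis
  proof (induction i rule: inc_induct)
    case base
    then show ?case by (simp add: nxt_end rest_def)
  next
    case (step i)
    have drop: "drop i (in_arr x v) = in_arr x v ! i # drop (Suc i) (in_arr x v)"
      using step by (simp add: Cons_nth_drop_Suc)
    show ?case
    proof (cases "stp S (in_arr x v ! i) = {}")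
      case True
      then have "rest (Suc l) v S i = rest (Suc l) v S (Suc i)" by (simp add: rest_def drop)
      moreover have "nxt v S i = nxt v S (Suc i)" using True step nxt_step by simp
      ultimately show ?thesis using step.IH by simp
    next
      case False
      then have "nxt v S i = i" using step nxt_step by simp
      then show ?thesis using False step by (simp add: rest_def drop)
    qed
  qed
qed (simp add: nxt_end rest_def)

definition lset :: "config \<Rightarrow> nat \<Rightarrow> nat set" where
  "lset \<sigma> m = mem \<sigma> m_set m ` {..<mem \<sigma> m_size m 0}"

definition todo :: "config \<Rightarrow> nat \<Rightarrow> nat list list" where
  "todo \<sigma> m = rest m (mem \<sigma> m_vert m 0) (lset \<sigma> m) (mem \<sigma> m_index m 0)"

definition level_ok :: "config \<Rightarrow> nat \<Rightarrow> bool" where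
  "level_ok \<sigma> m \<longleftrightarrow> inj_on (mem \<sigma> m_set m) {..<mem \<sigma> m_size m 0} \<and> lset \<sigma> m \<noteq> {} \<and>
     lset \<sigma> m \<subseteq> {q. lev m (mem \<sigma> m_vert m 0) q}"

definition edge_ok :: "config \<Rightarrow> nat \<Rightarrow> bool" where
  "edge_ok \<sigma> m \<longleftrightarrow> mem \<sigma> m_edge m 0 \<in> edges D \<and> tgt D (mem \<sigma> m_edge m 0) = mem \<sigma> m_vert m 0 \<and>
     src D (mem \<sigma> m_edge m 0) = mem \<sigma> m_vert (m - 1) 0"

definition links_ok :: "config \<Rightarrow> bool" where
  "links_ok \<sigma> \<longleftrightarrow> (\<forall>v q k i. lev k v q \<longrightarrow> i < length (in_arr x v) \<longrightarrow>
     mem \<sigma> m_next (in_arr x v ! i) q = nxt v {q} i)"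

text \<open>The edge of row \<open>m\<close> leads down to row \<open>m - 1\<close>, so it is
  meaningful only above the current level. Marks never exceed the stamp, hence a single increment of
  the stamp outdates them all.\<close>

definition stack_inv :: "nat \<Rightarrow> config \<Rightarrow> bool" where
  "stack_inv depth \<sigma> \<longleftrightarrow> tables \<sigma> \<and> links_ok \<sigma> \<and> reg \<sigma> r_best = Suc depth \<and>
     (\<forall>p. mem \<sigma> m_mark p 0 \<le> reg \<sigma> r_stamp) \<and> mem \<sigma> m_vert depth 0 = t \<and>
     (\<forall>m\<le>depth. reg \<sigma> r_level \<le> m \<longrightarrow> level_ok \<sigma> m) \<and>
     (\<forall>m\<le>depth. reg \<sigma> r_level < m \<longrightarrow> edge_ok \<sigma> m)"

text \<open>Upper rows hold later edges of the walk; taking the rows downwards lists the last edge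
  first, as \<open>branches\<close> does.\<close>

definition chosen :: "nat \<Rightarrow> config \<Rightarrow> nat \<Rightarrow> nat list" where
  "chosen depth \<sigma> l = map (\<lambda>k. mem \<sigma> m_edge k 0) (rev [Suc l..<Suc depth])"

text \<open>
  The walks still to be delivered while the current level is \<open>l\<close>: lower rows of the stack are stale.
\<close>

definition remaining :: "nat \<Rightarrow> config \<Rightarrow> nat \<Rightarrow> nat list list" where
  "remaining depth \<sigma> l = concat (map (\<lambda>m. map ((@) (chosen depth \<sigma> m)) (todo \<sigma> m)) [l..<Suc depth])"

lemma chosen_step: "l < depth \<Longrightarrow> chosen depth \<sigma> l = chosen depth \<sigma> (Suc l) @ [mem \<sigma> m_edge (Suc l) 0]"
  unfolding chosen_def by (subst upt_conv_Cons) auto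

lemma remaining_step: "l \<le> depth \<Longrightarrow>
    remaining depth \<sigma> l = map ((@) (chosen depth \<sigma> l)) (todo \<sigma> l) @ remaining depth \<sigma> (Suc l)"
  unfolding remaining_def by (subst upt_conv_Cons) auto

lemma remaining_top: "remaining depth \<sigma> (Suc depth) = []"
  by (simp add: remaining_def)

lemma chosen_cong:
  assumes "\<And>m. l < m \<Longrightarrow> mem \<tau> m_edge m 0 = mem \<sigma> m_edge m 0"
  shows "chosen depth \<tau> l = chosen depth \<sigma> l"
  unfolding chosen_def by (rule map_cong) (use assms in auto)

lemma remaining_cong:
  assumes "\<And>m. l \<le> m \<Longrightarrow> todo \<tau> m = todo \<sigma> m"
    and "\<And>m. l < m \<Longrightarrow> mem \<tau> m_edge m 0 = mem \<sigma> m_edge m 0"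
  shows "remaining depth \<tau> l = remaining depth \<sigma> l"
proof -
  have "chosen depth \<tau> m = chosen depth \<sigma> m" if "l \<le> m" for m
    by (rule chosen_cong) (use assms that in auto)
  then show ?thesis
    unfolding remaining_def by (intro arg_cong[where f = concat] map_cong) (use assms in auto)
qed

lemma mem_eq_simps:
  assumes "mem \<tau> = mem \<sigma>"
  shows "todo \<tau> = todo \<sigma>" "level_ok \<tau> = level_ok \<sigma>" "edge_ok \<tau> = edge_ok \<sigma>" "links_ok \<tau> = links_ok \<sigma>"
    "remaining depth \<tau> = remaining depth \<sigma>" "tables \<tau> = tables \<sigma>" "chosen depth \<tau> = chosen depth \<sigma>"
proof -
  show 1: "todo \<tau> = todo \<sigma>" unfolding todo_def lset_def assms fun_eq_iff by (intro allI refl)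
  show "level_ok \<tau> = level_ok \<sigma>" unfolding level_ok_def lset_def assms fun_eq_iff by (intro allI refl)
  show "edge_ok \<tau> = edge_ok \<sigma>" unfolding edge_ok_def assms fun_eq_iff by (intro allI refl)
  show "links_ok \<tau> = links_ok \<sigma>" unfolding links_ok_def assms by (rule refl)
  show "tables \<tau> = tables \<sigma>" unfolding tables_def assms by (rule refl)
  show 2: "chosen depth \<tau> = chosen depth \<sigma>" unfolding chosen_def assms fun_eq_iff by (intro allI refl)
  show "remaining depth \<tau> = remaining depth \<sigma>" unfolding remaining_def 1 2 fun_eq_iff by (intro allI refl)
qed

lemma frame_mem_eq: "frame R {} \<sigma> \<tau> \<Longrightarrow> mem \<tau> = mem \<sigma>"
  by (simp add: frame_def fun_eq_iff)

lemma level_card: "level_ok \<sigma> m \<Longrightarrow> mem \<sigma> m_size m 0 = card (lset \<sigma> m)"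
  by (simp add: level_ok_def lset_def card_image)

lemma level_vert: "level_ok \<sigma> m \<Longrightarrow> mem \<sigma> m_vert m 0 \<in> verts D"
  unfolding level_ok_def using lev_verts by blast

text \<open>By \<open>nxt_insert\<close> the running minimum over a prefix of the row is
  \<open>nxt\<close> for the states of that prefix. The \<open>min\<close> with the length covers an
  index at or beyond the end of the array.\<close>

lemma wp_find_next:
  assumes links: "links_ok \<sigma>" and ok: "level_ok \<sigma> (reg \<sigma> r_level)"
    and v: "mem \<sigma> m_vert (reg \<sigma> r_level) 0 = v"
  shows "wp x find_next (\<lambda>\<tau>. frame {r_v, r_j, r_i, r_e, r_k, r_a} {} \<sigma> \<tau> \<and> reg \<tau> r_v = v \<and>
     reg \<tau> r_j = min (length (in_arr x v)) (nxt v (lset \<sigma> (reg \<sigma> r_level)) (mem \<sigma> m_index (reg \<sigma> r_level) 0)) \<and>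
     clock \<tau> \<le> clock \<sigma> + 40 * level_cost (reg \<sigma> r_level)) \<sigma>"
proof -
  define l S i n where "l = reg \<sigma> r_level" and "S = lset \<sigma> l" and "i = mem \<sigma> m_index l 0"
    and "n = length (in_arr x v)"
  note defs = l_def S_def i_def n_def
  have cost: "1 + card S \<le> level_cost l"
    by (rule level_cost_next[of S l v]) (use ok v in \<open>simp add: level_ok_def defs\<close>)
  show ?thesis
  proof (cases "i < n")
    case False
    then have "nxt v S i = i" by (simp add: nxt_end n_def)
    then show ?thesis using False v cost by (simp add: find_next_def flip: defs)
  next
    case True
    \<comment> \<open>The configuration in which the loop starts, spelled out so that the loop rule
      can be applied to it.\<close>
    define pre where "pre = tick (Suc (cost (InAt (Reg r_v) (Reg r_i)))) (set_reg r_e (in_arr x v ! i)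
      (tick (Suc (bcost (Less (Reg r_i) (Reg r_j))))
        (tick (Suc (cost (Mem m_index (Reg r_level) (Const 0)))) (set_reg r_i i
          (tick (Suc (cost (InLen (Reg r_v)))) (set_reg r_j n
            (tick (Suc (cost (Mem m_vert (Reg r_level) (Const 0)))) (set_reg r_v v \<sigma>))))))))"
    have "wp x (For r_k (Mem m_size (Reg r_level) (Const 0))
        (Seq (SetReg r_a (Mem m_next (Reg r_e) (Mem m_set (Reg r_level) (Reg r_k))))
          (Cond (Less (Reg r_a) (Reg r_j)) (SetReg r_j (Reg r_a)) Skip)))
      (\<lambda>\<tau>. frame {r_v, r_j, r_i, r_e, r_k, r_a} {} \<sigma> \<tau> \<and> reg \<tau> r_v = v \<and>
        reg \<tau> r_j = min n (nxt v S i) \<and> clock \<tau> \<le> clock \<sigma> + 40 * level_cost l) pre"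
    proof (rule wp_For[where n = "card S" and f = "\<lambda>_. 20" and
        J = "\<lambda>c \<tau>. frame {r_v, r_j, r_i, r_e, r_k, r_a} {} \<sigma> \<tau> \<and> reg \<tau> r_v = v \<and> reg \<tau> r_e = in_arr x v ! i \<and>
          reg \<tau> r_j = min n (nxt v (mem \<sigma> m_set l ` {..<c}) i)"], goal_cases)
      case 1
      then show ?case using True nxt_empty[of i v] by (simp add: pre_def n_def)
    next
      case (4 c \<tau>)
      then show ?case using level_card[OF ok] by (simp add: frame_def flip: defs)
    next
      case (5 c \<tau>)
      let ?q = "mem \<sigma> m_set l c"
      have c: "c < mem \<sigma> m_size l 0" using 5 level_card[OF ok] by (simp flip: defs)
      then have "?q \<in> S" by (auto simp: S_def lset_def)
      then have "lev l v ?q" using ok v by (auto simp: level_ok_def defs)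
      then have "mem \<sigma> m_next (in_arr x v ! i) ?q = nxt v {?q} i"
        using links True unfolding links_ok_def n_def by blast
      moreover have "nxt v (mem \<sigma> m_set l ` {..<Suc c}) i = min (nxt v {?q} i) (nxt v (mem \<sigma> m_set l ` {..<c}) i)"
        unfolding lessThan_Suc image_insert by (rule nxt_insert) (use True in \<open>simp add: n_def\<close>)
      moreover have "reg \<tau> r_level = l" using 5 by (simp add: frame_def l_def)
      moreover have "mem \<tau> = mem \<sigma>" using 5 frame_mem_eq by blast
      ultimately show ?case using 5 by (simp add: min_def)
    next
      case (6 \<tau>)
      have "mem \<sigma> m_set l ` {..<card S} = S" using level_card[OF ok] by (simp add: lset_def flip: defs) (simp add: S_def lset_def)
      then show ?case using 6 cost by (simp add: pre_def)
    qed auto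
    then show ?thesis
      using True v unfolding find_next_def by (simp add: pre_def entry_def flip: defs)
  qed
qed

text \<open>The last clause makes the test on \<open>m_mark\<close> decide membership in
  \<open>X\<close>, the states gathered so far.\<close>

definition collected :: "config \<Rightarrow> nat \<Rightarrow> nat set \<Rightarrow> config \<Rightarrow> bool" where
  "collected \<sigma> l X \<tau> \<longleftrightarrow> frame {r_k, r_a, r_i, r_p} {m_set, m_size, m_mark} \<sigma> \<tau> \<and>
     (\<forall>m. m \<noteq> l \<longrightarrow> mem \<tau> m_set m = mem \<sigma> m_set m \<and> mem \<tau> m_size m = mem \<sigma> m_size m) \<and>
     bij_betw (mem \<tau> m_set l) {..<mem \<tau> m_size l 0} X \<and>
     (\<forall>p. mem \<tau> m_mark p 0 \<le> reg \<sigma> r_stamp) \<and> (\<forall>p. mem \<tau> m_mark p 0 = reg \<sigma> r_stamp \<longleftrightarrow> p \<in> X)"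

lemma collected_update:
  "collected \<sigma> l X \<tau> \<Longrightarrow> collected \<sigma> l X (tick n \<tau>)"
  "collected \<sigma> l X \<tau> \<Longrightarrow> r \<in> {r_k, r_a, r_i, r_p} \<Longrightarrow> collected \<sigma> l X (set_reg r n \<tau>)"
  by (auto simp: collected_def)

lemma collected_add:
  assumes col: "collected \<sigma> l X \<tau>" and l: "reg \<sigma> r_level = l" and p: "reg \<tau> r_p = p"
  shows "wp x (Cond (Equal (Mem m_mark (Reg r_p) (Const 0)) (Reg r_stamp)) Skip
      (Seq (SetMem m_mark (Reg r_p) (Const 0) (Reg r_stamp)) (add_state (Reg r_level) (Reg r_p))))
    (\<lambda>\<rho>. collected \<sigma> l (insert p X) \<rho> \<and> reg \<rho> = reg \<tau> \<and> clock \<rho> \<le> clock \<tau> + 30) \<tau>"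
proof -
  have regs: "reg \<tau> r_level = l" "reg \<tau> r_stamp = reg \<sigma> r_stamp"
    using col l by (auto simp: collected_def frame_def)
  show ?thesis
  proof (cases "p \<in> X")
    case True
    then have "mem \<tau> m_mark p 0 = reg \<sigma> r_stamp" "insert p X = X" using col by (auto simp: collected_def)
    then show ?thesis using col p regs by (simp add: collected_update)
  next
    case False
    then have "mem \<tau> m_mark p 0 \<noteq> reg \<sigma> r_stamp" using col by (auto simp: collected_def)
    moreover have "bij_betw ((mem \<tau> m_set l)(mem \<tau> m_size l 0 := p)) {..<Suc (mem \<tau> m_size l 0)} (insert p X)"
      by (rule bij_betw_snoc) (use col False in \<open>auto simp: collected_def\<close>)
    ultimately show ?thesis
      using col p regs by (simp add: add_state_def collected_def del: fun_upd_apply) (simp add: fun_upd_def)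
  qed
qed

lemma tables_store:
  assumes "tables \<sigma>"
  shows "mem \<sigma> m_count (mem \<sigma> m_id e q) 0 = card (tight e q)"
    and "mem \<sigma> m_pred (mem \<sigma> m_id e q) ` {..<mem \<sigma> m_count (mem \<sigma> m_id e q) 0} = fst ` tight e q"
  by (rule assms[unfolded tables_def, THEN conjunct2, THEN conjunct1, rule_format],
      rule assms[unfolded tables_def, THEN conjunct2, THEN conjunct2, rule_format])

text \<open>Every predecessor entry of every state of the upper row is read once, repeated states
  included, which gives the sum of the list lengths. \<open>marks\<close> is strict because the
  stamp has just been increased: no old mark can pass for a new one.\<close>

lemma wp_collect:
  assumes tables: "tables \<sigma>" and e: "reg \<sigma> r_e = e" and L: "reg \<sigma> r_q = L" and l: "reg \<sigma> r_level = l" "l \<noteq> L"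
    and inj: "inj_on (mem \<sigma> m_set L) {..<mem \<sigma> m_size L 0}" and empty: "mem \<sigma> m_size l 0 = 0"
    and marks: "\<And>p. mem \<sigma> m_mark p 0 < reg \<sigma> r_stamp"
  shows "wp x collect (\<lambda>\<tau>. collected \<sigma> l (stp (lset \<sigma> L) e) \<tau> \<and>
    clock \<tau> \<le> clock \<sigma> + 50 * (1 + card (lset \<sigma> L) + (\<Sum>q\<in>lset \<sigma> L. card (tight e q)))) \<sigma>"
proof -
  define n where "n = mem \<sigma> m_size L 0"
  let ?q = "mem \<sigma> m_set L"
  have image: "?q ` {..<n} = lset \<sigma> L" by (simp add: lset_def n_def)
  show ?thesis
    unfolding collect_def
  proof (rule wp_For[where n = n and f = "\<lambda>k. 25 + 50 * card (tight e (?q k))" and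
      J = "\<lambda>k. collected \<sigma> l (stp (?q ` {..<k}) e)"], goal_cases)
    case 1
    have "mem \<sigma> m_mark p 0 \<noteq> reg \<sigma> r_stamp" for p using marks[of p] by simp
    then show ?case using empty marks by (simp add: collected_def stp_def bij_betw_def less_imp_le)
  next
    case (4 k \<tau>)
    then show ?case using l L by (auto simp: collected_def frame_def n_def)
  next
    case (5 k \<tau>)
    define i X where "i = mem \<sigma> m_id e (?q k)" and "X = stp (?q ` {..<k}) e"
    have col: "collected \<sigma> l X \<tau>" using 5 by (simp add: X_def)
    have count: "mem \<sigma> m_count i 0 = card (tight e (?q k))"
      and pred: "mem \<sigma> m_pred i ` {..<mem \<sigma> m_count i 0} = fst ` tight e (?q k)"
      unfolding i_def by (rule tables_store[OF tables])+
    have same: "mem \<tau> m_id = mem \<sigma> m_id" "mem \<tau> m_set L = ?q" "reg \<tau> r_e = e" "reg \<tau> r_q = L"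
      using col l e L by (auto simp: collected_def frame_def)
    define \<tau>' where "\<tau>' = tick (Suc (cost (Mem m_id (Reg r_e) (Mem m_set (Reg r_q) (Reg r_k))))) (set_reg r_a i \<tau>)"
    have "wp x (For r_i (Mem m_count (Reg r_a) (Const 0))
         (Seq (SetReg r_p (Mem m_pred (Reg r_a) (Reg r_i)))
           (Cond (Equal (Mem m_mark (Reg r_p) (Const 0)) (Reg r_stamp)) Skip
             (Seq (SetMem m_mark (Reg r_p) (Const 0) (Reg r_stamp)) (add_state (Reg r_level) (Reg r_p))))))
      (\<lambda>\<rho>. collected \<sigma> l (stp (?q ` {..<Suc k}) e) \<rho> \<and> reg \<rho> r_k = k \<and>
        clock \<rho> \<le> clock \<tau> + (25 + 50 * card (tight e (?q k)))) \<tau>'"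
    proof (rule wp_For[where n = "card (tight e (?q k))" and f = "\<lambda>_. 34" and
        J = "\<lambda>c \<rho>. collected \<sigma> l (X \<union> mem \<sigma> m_pred i ` {..<c}) \<rho> \<and> reg \<rho> r_k = k \<and> reg \<rho> r_a = i"], goal_cases)
      case 1
      then show ?case using col 5 by (simp add: collected_update \<tau>'_def)
    next
      case (4 c \<rho>)
      then show ?case using count by (simp add: collected_def frame_def)
    next
      case (5 c \<rho>)
      define \<rho>' where "\<rho>' = tick (Suc (cost (Mem m_pred (Reg r_a) (Reg r_i)))) (set_reg r_p (mem \<sigma> m_pred i c) \<rho>)"
      have "mem \<rho> m_pred = mem \<sigma> m_pred" using 5 by (simp add: collected_def frame_def)
      moreover have "insert (mem \<sigma> m_pred i c) (X \<union> mem \<sigma> m_pred i ` {..<c}) = X \<union> mem \<sigma> m_pred i ` {..<Suc c}"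
        by (auto simp: lessThan_Suc)
      moreover have "collected \<sigma> l (X \<union> mem \<sigma> m_pred i ` {..<c}) \<rho>'"
        using 5 by (simp add: collected_update \<rho>'_def)
      then have "wp x (Cond (Equal (Mem m_mark (Reg r_p) (Const 0)) (Reg r_stamp)) Skip
          (Seq (SetMem m_mark (Reg r_p) (Const 0) (Reg r_stamp)) (add_state (Reg r_level) (Reg r_p))))
        (\<lambda>\<upsilon>. collected \<sigma> l (insert (mem \<sigma> m_pred i c) (X \<union> mem \<sigma> m_pred i ` {..<c})) \<upsilon> \<and>
          reg \<upsilon> = reg \<rho>' \<and> clock \<upsilon> \<le> clock \<rho>' + 30) \<rho>'"
        by (rule collected_add) (use l in \<open>auto simp: \<rho>'_def\<close>)
      ultimately show ?case
        using 5 unfolding wp_simps(2,6)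
        by (elim conjE) (simp only: val.simps, rule wp_mono, simp add: \<rho>'_def, auto simp: \<rho>'_def)
    next
      case (6 \<rho>)
      have "X \<union> mem \<sigma> m_pred i ` {..<card (tight e (?q k))} = stp (?q ` {..<Suc k}) e"
        using pred unfolding count by (auto simp: X_def stp_def lessThan_Suc)
      then show ?case using 6 by (simp add: \<tau>'_def)
    qed (auto simp: collected_update)
    then show ?case using same 5 by (simp add: \<tau>'_def flip: i_def)
  next
    case (6 \<tau>)
    have "(\<Sum>k<n. 25 + 50 * card (tight e (?q k)) + cost (Mem m_size (Reg r_q) (Const 0)) + 6) \<le>
        (\<Sum>k<n. 50 * (1 + card (tight e (?q k))))"
      by (rule sum_mono) simp
    also have "\<dots> = 50 * (\<Sum>k<n. 1 + card (tight e (?q k)))"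
      by (rule sum_distrib_left[symmetric])
    \<comment> \<open>The row has no repetitions, so a sum over its positions is a sum over its
      set.\<close>
    also have "(\<Sum>k<n. 1 + card (tight e (?q k))) = (\<Sum>q\<in>lset \<sigma> L. 1 + card (tight e q))"
      unfolding image[symmetric] by (rule sum.reindex_cong[symmetric, OF inj[folded n_def]]) auto
    also have "\<dots> = card (lset \<sigma> L) + (\<Sum>q\<in>lset \<sigma> L. card (tight e q))"
      by (simp add: sum_Suc)
    finally show ?case using 6 image by simp
  qed (auto simp: collected_update)
qed

lemma level_ok_cong:
  assumes "mem \<tau> m_set m = mem \<sigma> m_set m" "mem \<tau> m_size m = mem \<sigma> m_size m"
    "mem \<tau> m_vert m 0 = mem \<sigma> m_vert m 0"
  shows "lset \<tau> m = lset \<sigma> m" "level_ok \<tau> m = level_ok \<sigma> m"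
proof -
  show "lset \<tau> m = lset \<sigma> m" unfolding lset_def assms by (rule refl)
  show "level_ok \<tau> m = level_ok \<sigma> m" unfolding level_ok_def lset_def assms by (rule refl)
qed

lemma links_frame:
  assumes "links_ok \<sigma>" "frame R M \<sigma> \<tau>" "m_next \<notin> M"
  shows "links_ok \<tau>"
  using assms(1) unfolding links_ok_def frame_mem[OF assms(2,3)] .

text \<open>Descending only redistributes the walks to come: the block of the chosen edge
  \<open>e\<close> leaves row \<open>Suc l\<close>, whose index moves past \<open>e\<close>, and
  becomes the whole list of row \<open>l\<close>, with \<open>e\<close> added to
  \<open>chosen\<close>. That list is nonempty by \<open>branches_nonempty\<close>.\<close>

lemma wp_descend:
  assumes inv: "stack_inv depth \<sigma>" and level: "reg \<sigma> r_level = Suc l" "Suc l \<le> depth"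
    and v: "reg \<sigma> r_v = v" "mem \<sigma> m_vert (Suc l) 0 = v"
    and j: "reg \<sigma> r_j = j" "j = nxt v (lset \<sigma> (Suc l)) (mem \<sigma> m_index (Suc l) 0)" "j < length (in_arr x v)"
  shows "wp x descend (\<lambda>\<tau>. stack_inv depth \<tau> \<and> reg \<tau> r_level = l \<and> todo \<tau> l \<noteq> [] \<and>
    remaining depth \<tau> l = remaining depth \<sigma> (Suc l) \<and> pending \<tau> = pending \<sigma> \<and> outputs \<tau> = outputs \<sigma> \<and>
    clock \<tau> \<le> clock \<sigma> + 100 * level_cost (Suc l)) \<sigma>"
proof -
  define e S where "e = in_arr x v ! j" and "S = lset \<sigma> (Suc l)"
  have ok: "level_ok \<sigma> (Suc l)" using inv level by (simp add: stack_inv_def)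
  have e: "e \<in> edges D" "tgt D e = v"
    using nth_mem[OF j(3)] in_arr[of v] level_vert[OF ok] v by (auto simp: e_def)
  have S: "S \<subseteq> {q. lev (Suc l) (tgt D e) q}" using ok v e by (simp add: level_ok_def S_def)
  note rest = rest_nxt[of v S "mem \<sigma> m_index (Suc l) 0" l, folded S_def j(2)[folded S_def], folded e_def]
  have stp: "stp S e \<noteq> {}" using rest j(3) by simp
  have stp_lev: "stp S e \<subseteq> {p. lev l (src D e) p}" by (rule stp_lev[OF S])
  have cost: "1 + card S + (\<Sum>q\<in>S. card (tight e q)) \<le> level_cost (Suc l)"
    by (rule level_cost_step[OF S e(1)])
  \<comment> \<open>The configuration before \<open>collect\<close>; 34 is the total cost of the
    nine assignments leading there.\<close>
  define \<sigma>' where "\<sigma>' = tick 34 (set_reg r_stamp (reg \<sigma> r_stamp + 1) (set_mem m_size l 0 0 (set_mem m_index l 0 0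
     (set_mem m_vert l 0 (src D e) (set_reg r_level l (set_reg r_q (Suc l) (set_mem m_edge (Suc l) 0 e
     (set_mem m_index (Suc l) 0 (j + 1) (set_reg r_e e \<sigma>)))))))))"
  have "tables \<sigma>'"
    by (rule tables_frame[of \<sigma> "{r_stamp, r_level, r_q, r_e}" "{m_size, m_index, m_vert, m_edge}"])
      (use inv in \<open>auto simp: stack_inv_def \<sigma>'_def\<close>)
  then have collect: "wp x collect (\<lambda>\<tau>. collected \<sigma>' l (stp (lset \<sigma>' (Suc l)) e) \<tau> \<and>
      clock \<tau> \<le> clock \<sigma>' + 50 * (1 + card (lset \<sigma>' (Suc l)) + (\<Sum>q\<in>lset \<sigma>' (Suc l). card (tight e q)))) \<sigma>'"
    by (rule wp_collect) (use inv ok in \<open>auto simp: \<sigma>'_def stack_inv_def level_ok_def less_Suc_eq_le\<close>)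
  have lset: "lset \<sigma>' (Suc l) = S" by (simp add: \<sigma>'_def S_def lset_def)
  have post: "stack_inv depth \<tau> \<and> reg \<tau> r_level = l \<and> todo \<tau> l \<noteq> [] \<and>
      remaining depth \<tau> l = remaining depth \<sigma> (Suc l) \<and> pending \<tau> = pending \<sigma> \<and> outputs \<tau> = outputs \<sigma>"
    if col: "collected \<sigma>' l (stp S e) \<tau>" for \<tau>
  proof -
    have frame: "frame {r_k, r_a, r_i, r_p} {m_set, m_size, m_mark} \<sigma>' \<tau>"
      and rows: "\<And>m. m \<noteq> l \<Longrightarrow> mem \<tau> m_set m = mem \<sigma> m_set m \<and> mem \<tau> m_size m = mem \<sigma> m_size m"
      and bij: "bij_betw (mem \<tau> m_set l) {..<mem \<tau> m_size l 0} (stp S e)"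
      and marks: "\<And>p. mem \<tau> m_mark p 0 \<le> reg \<sigma>' r_stamp"
      using col by (auto simp: collected_def \<sigma>'_def)
    have frame': "frame {r_k, r_a, r_i, r_p, r_stamp, r_level, r_q, r_e}
        {m_set, m_size, m_mark, m_index, m_vert, m_edge} \<sigma> \<tau>"
      by (rule frame_trans[OF _ frame, of "{r_stamp, r_level, r_q, r_e}" "{m_size, m_index, m_vert, m_edge}"])
        (auto simp: \<sigma>'_def)
    have mem: "mem \<tau> m_vert = mem \<sigma>' m_vert" "mem \<tau> m_index = mem \<sigma>' m_index" "mem \<tau> m_edge = mem \<sigma>' m_edge"
      using frame by (simp_all add: frame_def)
    have vert: "mem \<tau> m_vert m 0 = (if m = l then src D e else mem \<sigma> m_vert m 0)"
      and index: "mem \<tau> m_index m 0 = (if m = l then 0 else if m = Suc l then Suc j else mem \<sigma> m_index m 0)"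
      and edge: "mem \<tau> m_edge m 0 = (if m = Suc l then e else mem \<sigma> m_edge m 0)" for m
      unfolding mem by (simp_all add: \<sigma>'_def)
    have regs: "reg \<tau> r_level = l" "reg \<tau> r_best = reg \<sigma> r_best" "reg \<tau> r_stamp = reg \<sigma>' r_stamp"
      using frame by (simp_all add: frame_def \<sigma>'_def)
    have lset_l: "lset \<tau> l = stp S e" using bij by (simp add: lset_def bij_betw_def)
    have ok_l: "level_ok \<tau> l"
      using bij stp stp_lev lset_l by (simp add: level_ok_def vert bij_betw_def)
    have above: "lset \<tau> m = lset \<sigma> m" "level_ok \<tau> m = level_ok \<sigma> m" if "l < m" for m
      by (rule level_ok_cong; use that rows vert in simp)+
    have todo_l: "todo \<tau> l = branches l (src D e) (stp S e)"
      by (simp add: todo_def vert index lset_l rest_zero)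
    have todo_Suc: "todo \<tau> (Suc l) = rest (Suc l) v S (Suc j)"
      by (simp add: todo_def vert index above v S_def)
    have todo: "todo \<tau> m = todo \<sigma> m" if "Suc l < m" for m
      using that by (simp add: todo_def vert index above)
    have chosen_Suc: "chosen depth \<tau> (Suc l) = chosen depth \<sigma> (Suc l)"
      by (rule chosen_cong) (simp add: edge)
    have chosen_l: "chosen depth \<tau> l = chosen depth \<sigma> (Suc l) @ [e]"
      using level chosen_step[of l depth \<tau>] chosen_Suc by (simp add: edge)
    have "remaining depth \<tau> l = map ((@) (chosen depth \<tau> l)) (todo \<tau> l) @
        map ((@) (chosen depth \<tau> (Suc l))) (todo \<tau> (Suc l)) @ remaining depth \<tau> (Suc (Suc l))"
      using level by (simp add: remaining_step)
    also have "remaining depth \<tau> (Suc (Suc l)) = remaining depth \<sigma> (Suc (Suc l))"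
      by (rule remaining_cong) (use todo edge in auto)
    also have "map ((@) (chosen depth \<tau> l)) (todo \<tau> l) @
        map ((@) (chosen depth \<tau> (Suc l))) (todo \<tau> (Suc l)) @ remaining depth \<sigma> (Suc (Suc l)) =
        map ((@) (chosen depth \<sigma> (Suc l))) (todo \<sigma> (Suc l)) @ remaining depth \<sigma> (Suc (Suc l))"
      unfolding chosen_l chosen_Suc todo_l todo_Suc
      using rest j(3) by (simp add: todo_def v S_def comp_def)
    also have "\<dots> = remaining depth \<sigma> (Suc l)"
      using level by (simp add: remaining_step)
    finally have remaining: "remaining depth \<tau> l = remaining depth \<sigma> (Suc l)" .
    have "edge_ok \<tau> (Suc l)" using e v by (simp add: edge_ok_def vert edge)
    moreover have "edge_ok \<tau> m = edge_ok \<sigma> m" if "Suc l < m" for m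
      using that by (auto simp: edge_ok_def vert edge)
    ultimately have edges: "edge_ok \<tau> m" if "m \<le> depth" "l < m" for m
      using inv level that by (cases "m = Suc l") (auto simp: stack_inv_def)
    have levels: "level_ok \<tau> m" if "m \<le> depth" "l \<le> m" for m
      using inv level that ok_l above(2)[of m] by (cases "m = l") (auto simp: stack_inv_def)
    have "tables \<tau>" "links_ok \<tau>"
      using tables_frame[OF _ frame'] links_frame[OF _ frame'] inv by (auto simp: stack_inv_def)
    then have "stack_inv depth \<tau>"
      using inv level regs marks edges levels by (simp add: stack_inv_def vert)
    moreover have "todo \<tau> l \<noteq> []" unfolding todo_l by (rule branches_nonempty[OF stp stp_lev])
    ultimately show ?thesis using regs remaining frame_output[OF frame'] by simp
  qed
  have "wp x collect (\<lambda>\<tau>. stack_inv depth \<tau> \<and> reg \<tau> r_level = l \<and> todo \<tau> l \<noteq> [] \<and>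
    remaining depth \<tau> l = remaining depth \<sigma> (Suc l) \<and> pending \<tau> = pending \<sigma> \<and> outputs \<tau> = outputs \<sigma> \<and>
    clock \<tau> \<le> clock \<sigma> + 100 * level_cost (Suc l)) \<sigma>'"
  proof (rule wp_mono[OF collect[unfolded lset]])
    have "clock \<sigma>' = clock \<sigma> + 34" by (simp add: \<sigma>'_def)
    moreover fix \<tau> assume "collected \<sigma>' l (stp S e) \<tau> \<and>
       clock \<tau> \<le> clock \<sigma>' + 50 * (1 + card S + (\<Sum>q\<in>S. card (tight e q)))"
    ultimately show "stack_inv depth \<tau> \<and> reg \<tau> r_level = l \<and> todo \<tau> l \<noteq> [] \<and>
        remaining depth \<tau> l = remaining depth \<sigma> (Suc l) \<and> pending \<tau> = pending \<sigma> \<and> outputs \<tau> = outputs \<sigma> \<and>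
        clock \<tau> \<le> clock \<sigma> + 100 * level_cost (Suc l)"
      using post[of \<tau>] cost by simp
  qed
  moreover have "src_of x e = src D e" using src_of e by simp
  moreover have "entry (in_arr x v) j = e" using j(3) by (simp add: entry_def e_def)
  ultimately show ?thesis
    using v(1) level(1) j(1) unfolding descend_def wp_simps
    by (simp add: \<sigma>'_def tick_commute del: One_nat_def)
qed

lemma stack_inv_frame:
  assumes "stack_inv depth \<sigma>" "frame R {} \<sigma> \<tau>" "r_level \<notin> R" "r_best \<notin> R" "r_stamp \<notin> R"
  shows "stack_inv depth \<tau>"
  using assms mem_eq_simps[OF frame_mem_eq[OF assms(2)]] frame_mem_eq[OF assms(2)]
  by (simp add: stack_inv_def frame_reg)

lemma tick_simps [simp]:
  "todo (tick n \<sigma>) = todo \<sigma>" "remaining depth (tick n \<sigma>) = remaining depth \<sigma>"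
  "lset (tick n \<sigma>) = lset \<sigma>" "links_ok (tick n \<sigma>) = links_ok \<sigma>" "level_ok (tick n \<sigma>) = level_ok \<sigma>"
  "stack_inv depth (tick n \<sigma>) = stack_inv depth \<sigma>"
proof -
  note eq = mem_eq_simps[of "tick n \<sigma>" \<sigma>]
  show "todo (tick n \<sigma>) = todo \<sigma>" "remaining depth (tick n \<sigma>) = remaining depth \<sigma>"
    "links_ok (tick n \<sigma>) = links_ok \<sigma>" "level_ok (tick n \<sigma>) = level_ok \<sigma>"
    by (simp_all add: eq)
  show "lset (tick n \<sigma>) = lset \<sigma>" by (simp add: lset_def fun_eq_iff)
  show "stack_inv depth (tick n \<sigma>) = stack_inv depth \<sigma>" by (simp add: stack_inv_def eq)
qed

text \<open>A nonempty list at the current level puts \<open>nxt\<close> inside the array, and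
  \<open>wp_descend\<close> hands a nonempty list to the next level, so the descent never turns
  back. In units of \<open>level_cost\<close>, a level pays at most 4 for the guard, 40 for the
  search and 100 for the descent.\<close>

lemma wp_go_down:
  assumes inv: "stack_inv depth \<sigma>" and level: "reg \<sigma> r_level \<le> depth" and todo: "todo \<sigma> (reg \<sigma> r_level) \<noteq> []"
  shows "wp x go_down (\<lambda>\<tau>. stack_inv depth \<tau> \<and> reg \<tau> r_level = 0 \<and>
    remaining depth \<tau> 0 = remaining depth \<sigma> (reg \<sigma> r_level) \<and> pending \<tau> = pending \<sigma> \<and> outputs \<tau> = outputs \<sigma> \<and>
    clock \<tau> \<le> clock \<sigma> + 150 * (\<Sum>m\<in>{1..depth}. level_cost m) + 4) \<sigma>"
  unfolding go_down_def
proof (rule wp_While[where f = "\<lambda>\<tau>. reg \<tau> r_level" and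
    I = "\<lambda>\<tau>. stack_inv depth \<tau> \<and> reg \<tau> r_level \<le> depth \<and> todo \<tau> (reg \<tau> r_level) \<noteq> [] \<and>
      remaining depth \<tau> (reg \<tau> r_level) = remaining depth \<sigma> (reg \<sigma> r_level) \<and>
      pending \<tau> = pending \<sigma> \<and> outputs \<tau> = outputs \<sigma> \<and>
      clock \<tau> \<le> clock \<sigma> + 150 * (\<Sum>m\<in>{reg \<tau> r_level<..depth}. level_cost m)"], goal_cases)
  case 1
  then show ?case using assms by simp
next
  case (2 \<tau>)
  then obtain l where l: "reg \<tau> r_level = Suc l" by (auto simp: gr0_conv_Suc)
  define v j where "v = mem \<tau> m_vert (Suc l) 0" and "j = nxt v (lset \<tau> (Suc l)) (mem \<tau> m_index (Suc l) 0)"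
  have ok: "links_ok \<tau>" "level_ok \<tau> (Suc l)" using 2 l by (auto simp: stack_inv_def)
  have jlen: "j < length (in_arr x v)"
    using rest_nxt[of v "lset \<tau> (Suc l)" "mem \<tau> m_index (Suc l) 0" l] 2 l by (auto simp: todo_def v_def j_def split: if_splits)
  let ?\<tau> = "tick (Suc (bcost (Less (Const 0) (Reg r_level)))) \<tau>"
  have "1 \<le> level_cost (Suc l)" by (simp add: level_cost_def)
  show ?case
    unfolding wp_simps
  proof (rule wp_mono[OF wp_find_next[where v = v]], goal_cases)
    case 1
    show ?case using ok by simp
  next
    case 2
    show ?case using ok l by simp
  next
    case 3
    show ?case using l by (simp add: v_def)
  next
    case (4 \<rho>)
    have frame: "frame {r_v, r_j, r_i, r_e, r_k, r_a} {} \<tau> \<rho>"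
      by (rule frame_trans[of "{}" "{}" \<tau> ?\<tau>]) (use 4 in auto)
    note eq = mem_eq_simps[OF frame_mem_eq[OF frame]] frame_mem_eq[OF frame]
    have lset: "lset \<rho> = lset \<tau>" by (simp add: lset_def eq fun_eq_iff)
    have "stack_inv depth \<rho>" by (rule stack_inv_frame[OF _ frame]) (use 2 in auto)
    moreover have "reg \<rho> r_level = Suc l" using frame l by (simp add: frame_def)
    moreover have "reg \<rho> r_j = j" using 4 jlen l by (simp add: j_def)
    moreover have "clock \<rho> \<le> clock \<tau> + 4 + 40 * level_cost (Suc l)" using 4 l by simp
    ultimately show ?case
    proof (intro wp_mono[OF wp_descend[where depth = depth and l = l and v = v and j = j and \<sigma> = \<rho>]], goal_cases)
      case (9 \<upsilon>)
      have "{l<..depth} = insert (Suc l) {Suc l<..depth}" using 2 l by auto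
      then have "(\<Sum>m\<in>{l<..depth}. level_cost m) = level_cost (Suc l) + (\<Sum>m\<in>{Suc l<..depth}. level_cost m)"
        by simp
      then show ?case
        using 9 2 l \<open>1 \<le> level_cost (Suc l)\<close> frame_output[OF frame] by (simp add: eq)
    qed (use 2 4 l jlen in \<open>auto simp: v_def j_def eq lset\<close>)
  qed
next
  case (3 \<tau>)
  then have "reg \<tau> r_level = 0" by simp
  moreover have "{0<..depth} = {1..depth}" by auto
  ultimately show ?case using 3 by simp
qed

definition word :: "nat list \<Rightarrow> nat list" where
  "word es = walk_word (path es) (rev es)"

lemma walk_word_map:
  "a \<le> b \<Longrightarrow> walk_word (map f [a..<Suc b]) (map g [Suc a..<Suc b]) = concat (map (\<lambda>k. [f k, g (Suc k)]) [a..<b]) @ [f b]"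
proof (induction a rule: inc_induct)
  case (step a)
  have "[a..<Suc b] = a # [Suc a..<Suc b]" "[Suc a..<Suc b] = Suc a # [Suc (Suc a)..<Suc b]" "[a..<b] = a # [Suc a..<b]"
    using step by (auto simp: upt_conv_Cons simp del: upt_Suc)
  then show ?case using step.IH by (simp del: upt_Suc)
qed simp

text \<open>By \<open>edge_ok\<close> the vertex in row \<open>k\<close> is the source of the edge
  in row \<open>k + 1\<close>, so the word built from the edges and the one read off the rows
  coincide.\<close>

lemma word_chosen:
  assumes "stack_inv depth \<sigma>" "reg \<sigma> r_level = 0"
  shows "word (chosen depth \<sigma> 0) =
    concat (map (\<lambda>k. [mem \<sigma> m_vert k 0, mem \<sigma> m_edge (Suc k) 0]) [0..<depth]) @ [mem \<sigma> m_vert depth 0]"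
proof -
  have "path (chosen depth \<sigma> 0) = map (\<lambda>k. src D (mem \<sigma> m_edge k 0)) [Suc 0..<Suc depth] @ [t]"
    by (simp add: path_def chosen_def rev_map[symmetric] del: upt_Suc)
  also have "map (\<lambda>k. src D (mem \<sigma> m_edge k 0)) [Suc 0..<Suc depth] = map (\<lambda>k. mem \<sigma> m_vert k 0) [0..<depth]"
    unfolding map_Suc_upt[symmetric] map_map
    by (rule map_cong) (use assms in \<open>auto simp: stack_inv_def edge_ok_def\<close>)
  also have "\<dots> @ [t] = map (\<lambda>k. mem \<sigma> m_vert k 0) [0..<Suc depth]"
    using assms by (simp add: stack_inv_def)
  finally have path: "path (chosen depth \<sigma> 0) = map (\<lambda>k. mem \<sigma> m_vert k 0) [0..<Suc depth]" .
  have "rev (chosen depth \<sigma> 0) = map (\<lambda>k. mem \<sigma> m_edge k 0) [Suc 0..<Suc depth]"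
    by (simp add: chosen_def rev_map del: upt_Suc)
  then show ?thesis unfolding word_def path using walk_word_map[of 0 depth] by (simp del: upt_Suc)
qed

lemma wp_deliver:
  assumes inv: "stack_inv depth \<sigma>" and level: "reg \<sigma> r_level = 0" and "pending \<sigma> = []"
  shows "wp x deliver (\<lambda>\<tau>. mem \<tau> = mem \<sigma> \<and> (\<forall>r. r \<noteq> r_i \<longrightarrow> reg \<tau> r = reg \<sigma> r) \<and> pending \<tau> = [] \<and>
    outputs \<tau> = outputs \<sigma> @ [(clock \<tau>, word (chosen depth \<sigma> 0))] \<and>
    clock \<tau> \<le> clock \<sigma> + 30 * (1 + depth)) \<sigma>"
  unfolding deliver_def wp_simps
proof (rule wp_For[where n = depth and f = "\<lambda>_. 10" and
    J = "\<lambda>n \<tau>. mem \<tau> = mem \<sigma> \<and> (\<forall>r. r \<noteq> r_i \<longrightarrow> reg \<tau> r = reg \<sigma> r) \<and> outputs \<tau> = outputs \<sigma> \<and>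
      pending \<tau> = concat (map (\<lambda>k. [mem \<sigma> m_vert k 0, mem \<sigma> m_edge (Suc k) 0]) [0..<n])"], goal_cases)
  case (6 \<tau>)
  then show ?case using word_chosen[OF inv level] inv by (simp add: stack_inv_def)
qed (use assms in \<open>auto simp: stack_inv_def\<close>)

text \<open>A level that is passed has an empty list and contributes nothing to
  \<open>remaining\<close>. Level 0 is dropped at the start, as its only walk is the one just
  delivered.\<close>

lemma wp_go_up:
  assumes inv: "stack_inv depth \<sigma>" and level: "reg \<sigma> r_level = 0"
  shows "wp x go_up (\<lambda>\<tau>. stack_inv depth \<tau> \<and> (reg \<tau> r_level \<le> depth \<longrightarrow> todo \<tau> (reg \<tau> r_level) \<noteq> []) \<and>
    reg \<tau> r_level \<le> Suc depth \<and> remaining depth \<tau> (reg \<tau> r_level) = remaining depth \<sigma> 1 \<and>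
    pending \<tau> = pending \<sigma> \<and> outputs \<tau> = outputs \<sigma> \<and>
    clock \<tau> \<le> clock \<sigma> + 80 * (\<Sum>m\<in>{1..depth}. level_cost m) + 20) \<sigma>"
  unfolding go_up_def wp_simps
\<comment> \<open>Setting the stop flag counts as progress too, hence the extra unit in the measure.
  Once it is set, the current level has been searched as well, hence one more summand in the time
  bound.\<close>
proof (rule wp_While[where f = "\<lambda>\<tau>. Suc depth - reg \<tau> r_level + (if reg \<tau> r_stop = 0 then 1 else 0)" and
    I = "\<lambda>\<tau>. frame {r_v, r_j, r_i, r_e, r_k, r_a, r_level, r_stop} {} \<sigma> \<tau> \<and>
      1 \<le> reg \<tau> r_level \<and> reg \<tau> r_level \<le> Suc depth \<and>
      (reg \<tau> r_stop \<noteq> 0 \<longrightarrow> reg \<tau> r_level \<le> depth \<and> todo \<sigma> (reg \<tau> r_level) \<noteq> []) \<and>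
      remaining depth \<sigma> (reg \<tau> r_level) = remaining depth \<sigma> 1 \<and>
      clock \<tau> \<le> clock \<sigma> + 80 * (\<Sum>m\<in>{1..<reg \<tau> r_level + (if reg \<tau> r_stop = 0 then 0 else 1)}. level_cost m) + 10"], goal_cases)
  case 1
  then show ?case by simp
next
  case (2 \<tau>)
  have frame: "frame {r_v, r_j, r_i, r_e, r_k, r_a, r_level, r_stop} {} \<sigma> \<tau>" using 2 by blast
  have best: "reg \<tau> r_best = Suc depth" using frame inv by (simp add: frame_def stack_inv_def)
  define l where "l = reg \<tau> r_level"
  have l: "1 \<le> l" "l \<le> depth" "reg \<tau> r_stop = 0" using 2 best by (auto simp: l_def)
  define v i where "v = mem \<sigma> m_vert l 0" and "i = mem \<sigma> m_index l 0"
  define j where "j = nxt v (lset \<sigma> l) i"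
  let ?\<tau> = "tick (Suc (bcost (Conj (Less (Reg r_level) (Reg r_best)) (Equal (Reg r_stop) (Const 0))))) \<tau>"
  have mem: "mem ?\<tau> = mem \<sigma>" using frame_mem_eq[OF frame] by simp
  note eq = mem_eq_simps[OF mem]
  have lset: "lset ?\<tau> = lset \<sigma>" unfolding lset_def mem fun_eq_iff by (intro allI refl)
  have ok: "links_ok \<sigma>" "level_ok \<sigma> l" using inv level l by (auto simp: stack_inv_def)
  obtain l' where l': "l = Suc l'" using l by (cases l) auto
  have todo_eq: "todo \<sigma> l = rest (Suc l') v (lset \<sigma> l) i" by (simp add: todo_def v_def i_def l')
  \<comment> \<open>A usable edge has a nonempty block by \<open>branches_nonempty\<close>, so the
    test made by the machine agrees with nonemptiness of the list.\<close>
  have todo: "todo \<sigma> l \<noteq> [] \<longleftrightarrow> j < length (in_arr x v)"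
  proof (cases "j < length (in_arr x v)")
    case True
    let ?e = "in_arr x v ! j"
    have "v \<in> verts D" using level_vert[OF ok(2)] by (simp add: v_def)
    then have "tgt D ?e = v" using in_arr nth_mem[OF True] by blast
    then have "stp (lset \<sigma> l) ?e \<subseteq> {p. lev l' (src D ?e) p}"
      using ok(2) by (intro stp_lev) (simp add: level_ok_def v_def l')
    moreover have rest: "stp (lset \<sigma> l) ?e \<noteq> {}"
      "todo \<sigma> l = map ((#) ?e) (branches l' (src D ?e) (stp (lset \<sigma> l) ?e)) @ rest l v (lset \<sigma> l) (Suc j)"
      using rest_nxt[of v "lset \<sigma> l" i l'] True unfolding j_def[symmetric]
      by (simp_all add: todo_eq[unfolded l'] l')
    ultimately show ?thesis using branches_nonempty True by simp
  next
    case False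
    then show ?thesis
      using rest_nxt[of v "lset \<sigma> l" i l'] unfolding j_def[symmetric]
      by (simp add: todo_eq)
  qed
  have "1 \<le> level_cost l" by (simp add: level_cost_def)
  show ?case
    unfolding wp_simps
  proof (rule wp_mono[OF wp_find_next[where v = v]], goal_cases)
    case 1
    show ?case using ok by (simp only: eq)
  next
    case 2
    show ?case using ok by (simp only: eq) (simp add: l_def)
  next
    case 3
    show ?case by (simp only: mem) (simp add: v_def l_def)
  next
    case (4 \<rho>)
    have frame\<rho>: "frame {r_v, r_j, r_i, r_e, r_k, r_a} {} \<tau> \<rho>"
      by (rule frame_trans[of "{}" "{}" \<tau> ?\<tau>]) (use 4 in auto)
    have frame': "frame {r_v, r_j, r_i, r_e, r_k, r_a, r_level, r_stop} {} \<sigma> \<rho>"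
      by (rule frame_trans[OF frame frame\<rho>]) auto
    have regs: "reg \<rho> r_level = l" "reg \<rho> r_stop = 0" "reg \<rho> r_v = v" "clock \<rho> \<le> clock \<tau> + 8 + 40 * level_cost l"
      using frame\<rho> l 4 by (simp_all add: frame_def l_def)
    have rj: "reg \<rho> r_j = min (length (in_arr x v)) j"
      using 4 unfolding lset mem by (simp add: j_def i_def l_def)
    have clock: "clock \<tau> \<le> clock \<sigma> + 80 * (\<Sum>m\<in>{1..<l}. level_cost m) + 10" using 2 l by (simp add: l_def)
    have sum: "(\<Sum>m\<in>{1..<Suc l}. level_cost m) = (\<Sum>m\<in>{1..<l}. level_cost m) + level_cost l"
      using l by simp
    have rem: "remaining depth \<sigma> l = remaining depth \<sigma> 1" using 2 by (simp add: l_def)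
    show ?case
    proof (cases "j < length (in_arr x v)")
      case True
      then have "todo \<sigma> l \<noteq> []" using todo by simp
      then show ?thesis
        using True rj regs frame' clock sum rem l \<open>1 \<le> level_cost l\<close> by (simp flip: l_def)
    next
      case False
      then have "todo \<sigma> l = []" using todo by simp
      then have "remaining depth \<sigma> (Suc l) = remaining depth \<sigma> l" using l by (simp add: remaining_step)
      then show ?thesis
        using False rj regs frame' clock sum rem l \<open>1 \<le> level_cost l\<close> by (simp flip: l_def)
    qed
  qed
next
  case (3 \<tau>)
  have frame: "frame {r_v, r_j, r_i, r_e, r_k, r_a, r_level, r_stop} {} \<sigma> \<tau>" using 3 by blast
  have best: "reg \<tau> r_best = Suc depth" using frame inv by (simp add: frame_def stack_inv_def)
  have mem: "mem \<tau> = mem \<sigma>" using frame_mem_eq[OF frame] .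
  note eq = mem_eq_simps[OF mem]
  have "stack_inv depth \<tau>"
    using inv level 3 best frame unfolding stack_inv_def eq mem by (simp add: frame_def)
  moreover have "(\<Sum>m\<in>{1..<reg \<tau> r_level + (if reg \<tau> r_stop = 0 then 0 else 1)}. level_cost m) \<le>
      (\<Sum>m\<in>{1..depth}. level_cost m)"
    by (rule sum_mono2) (use 3 in auto)
  ultimately show ?case
    using 3 best frame_output[OF frame] by (auto simp: eq)
qed

end

section \<open>Delays of a loop with one output per round\<close>

lemma tick_0: "tick 0 \<sigma> = \<sigma>"
  by (simp add: tick_def)

text \<open>Describes a loop entered by time \<open>b\<close> whose rounds last at most
  \<open>T\<close> and deliver one output each, at any moment of the round. An output lies at most
  \<open>T\<close> before the end of its round and the next one at most \<open>T\<close> after that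
  end, hence \<open>2 * T\<close>.\<close>

definition timely :: "nat \<Rightarrow> nat \<Rightarrow> config \<Rightarrow> bool" where
  "timely b T \<sigma> \<longleftrightarrow> (let ts = map fst (outputs \<sigma>) in
     if ts = [] then clock \<sigma> \<le> b
     else hd ts \<le> b + T \<and> clock \<sigma> \<le> last ts + T \<and>
       (\<forall>i. Suc i < length ts \<longrightarrow> ts ! Suc i - ts ! i \<le> 2 * T))"

lemma nth_last_append:
  assumes "Suc i = length ts"
  shows "(ts @ [c]) ! i = last ts" "(ts @ [c]) ! Suc i = c"
proof -
  have "ts \<noteq> []" "i < length ts" "length ts - 1 = i" using assms by auto
  then show "(ts @ [c]) ! i = last ts" "(ts @ [c]) ! Suc i = c"
    using assms by (simp_all add: nth_append last_conv_nth)
qed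

lemma timely_output:
  assumes "timely b T \<sigma>" "outputs \<tau> = outputs \<sigma> @ [(n, w)]"
    and "clock \<sigma> \<le> n" "n \<le> clock \<tau>" "clock \<tau> \<le> clock \<sigma> + T"
  shows "timely b T \<tau>"
proof -
  define ts where "ts = map fst (outputs \<sigma>)"
  have ts': "map fst (outputs \<tau>) = ts @ [n]" using assms(2) by (simp add: ts_def)
  show ?thesis
  proof (cases "ts = []")
    case True
    then show ?thesis using assms by (simp add: timely_def ts' flip: ts_def)
  next
    case False
    then have *: "hd ts \<le> b + T" "clock \<sigma> \<le> last ts + T"
      "\<And>i. Suc i < length ts \<Longrightarrow> ts ! Suc i - ts ! i \<le> 2 * T"
      using assms(1) by (auto simp: timely_def simp flip: ts_def)
    have "(ts @ [n]) ! Suc i - (ts @ [n]) ! i \<le> 2 * T" if "Suc i < length (ts @ [n])" for i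
    proof (cases "Suc i < length ts")
      case True
      then show ?thesis using *(3) by (simp add: nth_append)
    next
      case last: False
      then have "Suc i = length ts" using that by simp
      have "(ts @ [n]) ! i = last ts" "(ts @ [n]) ! Suc i = n"
        using nth_last_append[OF \<open>Suc i = length ts\<close>] by blast+
      then show ?thesis using * assms by simp
    qed
    then show ?thesis
      using False * assms(3-5) unfolding timely_def Let_def ts' by (simp del: length_append)
  qed
qed

text \<open>The final clock value acts as one more time stamp, within \<open>T\<close> of the last
  output; without any output it is itself the preprocessing time, at most \<open>b\<close>.\<close>

lemma timely_bounds:
  assumes "timely b T \<sigma>"
  shows "preprocessing_time \<sigma> \<le> b + T" "\<forall>d\<in>delays \<sigma>. d \<le> 2 * T"
proof -
  define ts where "ts = map fst (outputs \<sigma>)"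
  show "preprocessing_time \<sigma> \<le> b + T"
    using assms by (cases "ts = []") (auto simp: preprocessing_time_def timely_def simp flip: ts_def)
  have "(ts @ [clock \<sigma>]) ! Suc i - (ts @ [clock \<sigma>]) ! i \<le> 2 * T" if "Suc i < length (ts @ [clock \<sigma>])" for i
  proof -
    have "ts \<noteq> []" using that by auto
    then have *: "clock \<sigma> \<le> last ts + T" "\<And>i. Suc i < length ts \<Longrightarrow> ts ! Suc i - ts ! i \<le> 2 * T"
      using assms by (auto simp: timely_def simp flip: ts_def)
    show ?thesis
    proof (cases "Suc i < length ts")
      case True
      then show ?thesis using *(2) by (simp add: nth_append)
    next
      case False
      then have "Suc i = length ts" using that by simp
      have "(ts @ [clock \<sigma>]) ! i = last ts" "(ts @ [clock \<sigma>]) ! Suc i = clock \<sigma>"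
        using nth_last_append[OF \<open>Suc i = length ts\<close>] by blast+
      then show ?thesis using *(1) by simp
    qed
  qed
  then show "\<forall>d\<in>delays \<sigma>. d \<le> 2 * T"
    by (auto simp: delays_def Let_def simp flip: ts_def simp del: length_append)
qed

definition enumerate_stack :: com where
  "enumerate_stack = While (Less (Reg r_level) (Reg r_best)) (Seq go_down (Seq deliver go_up))"

definition solver :: com where
  "solver = Seq init_queue (Seq bfs (Seq link (Seq find_best
     (Cond (Equal (Reg r_best) (Const 0)) Skip (Seq init_stack enumerate_stack)))))"

context problem
begin

lemma stack_inv_level:
  assumes "stack_inv depth \<sigma>" "mem \<tau> = mem \<sigma>" "\<And>r. r \<noteq> r_i \<Longrightarrow> reg \<tau> r = reg \<sigma> r"
  shows "stack_inv depth \<tau>"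
  using assms(1) unfolding stack_inv_def mem_eq_simps[OF assms(2)] assms(2) by (simp add: assms(3))

text \<open>Each round delivers the head of \<open>remaining\<close> and keeps its tail, so the
  length of \<open>remaining\<close> is a measure and the outputs follow the order of the initial
  list.\<close>

lemma wp_enumerate_stack:
  assumes inv: "stack_inv depth \<sigma>" and level: "reg \<sigma> r_level = depth" and todo: "todo \<sigma> depth \<noteq> []"
    and out: "pending \<sigma> = []" "outputs \<sigma> = []"
    and T: "T = 310 * (1 + (\<Sum>m\<in>{1..depth}. level_cost m))"
  shows "wp x enumerate_stack (\<lambda>\<tau>. pending \<tau> = [] \<and> map snd (outputs \<tau>) = map word (todo \<sigma> depth) \<and>
    timely (clock \<sigma>) (T + 4) \<tau>) \<sigma>"
  unfolding enumerate_stack_def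
\<comment> \<open>The last evaluation of the guard costs 4 after the final round; the invariant
  keeps this reserve by admitting up to 4 further ticks, hence \<open>T + 4\<close>. Before any
  output no tick is added, since the clock must still be within that of the start.\<close>
proof (rule wp_While[where f = "\<lambda>\<tau>. length (remaining depth \<tau> (reg \<tau> r_level))" and
    I = "\<lambda>\<tau>. stack_inv depth \<tau> \<and> pending \<tau> = [] \<and> reg \<tau> r_level \<le> Suc depth \<and>
      (reg \<tau> r_level \<le> depth \<longrightarrow> todo \<tau> (reg \<tau> r_level) \<noteq> []) \<and>
      map snd (outputs \<tau>) @ map word (remaining depth \<tau> (reg \<tau> r_level)) = map word (todo \<sigma> depth) \<and>
      (\<forall>n\<le>4. timely (clock \<sigma>) (T + 4) (if outputs \<tau> = [] then \<tau> else tick n \<tau>))"], goal_cases)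
  case 1
  have "remaining depth \<sigma> depth = map ((@) (chosen depth \<sigma> depth)) (todo \<sigma> depth)"
    by (simp add: remaining_step remaining_top)
  also have "\<dots> = todo \<sigma> depth" by (simp add: chosen_def map_idI)
  finally show ?case using assms by (simp add: timely_def)
next
  case (2 \<tau>)
  let ?\<tau> = "tick (Suc (bcost (Less (Reg r_level) (Reg r_best)))) \<tau>"
  have best: "reg \<tau> r_best = Suc depth" using 2 by (simp add: stack_inv_def)
  have level: "reg \<tau> r_level \<le> depth" using 2 best by simp
  note I = 2
  \<comment> \<open>Delivery takes time linear in the depth; it is absorbed into the level costs,
    each being at least 1.\<close>
  have depth: "depth \<le> (\<Sum>m\<in>{1..depth}. level_cost m)"
  proof -
    have "(\<Sum>m\<in>{1..depth}. 1) \<le> (\<Sum>m\<in>{1..depth}. level_cost m)"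
      by (rule sum_mono) (simp add: level_cost_def)
    then show ?thesis by simp
  qed
  show ?case
    unfolding wp_simps
  proof (rule wp_mono[OF wp_clock[OF wp_go_down[where depth = depth]]], goal_cases)
    case 1
    show ?case using I by simp
  next
    case 2
    show ?case using level by simp
  next
    case 3
    show ?case using I level by simp
  next
    case (4 \<rho>)
    note \<rho> = 4
    show ?case
    proof (rule wp_mono[OF wp_clock[OF wp_deliver[where depth = depth and \<sigma> = \<rho>]]], goal_cases)
      case (4 \<upsilon>)
      note \<upsilon> = 4
      have inv\<upsilon>: "stack_inv depth \<upsilon>" by (rule stack_inv_level[of depth \<rho>]) (use \<rho> \<upsilon> in auto)
      show ?case
      proof (rule wp_mono[OF wp_clock[OF wp_go_up[where depth = depth and \<sigma> = \<upsilon>]]], goal_cases)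
        case (3 \<omega>)
        have "remaining depth \<rho> 0 = chosen depth \<rho> 0 # remaining depth \<rho> 1"
          by (simp add: remaining_step todo_def rest_def)
        moreover have "remaining depth \<upsilon> = remaining depth \<rho>" by (rule mem_eq_simps) (use \<upsilon> in simp)
        ultimately have rem: "remaining depth \<tau> (reg \<tau> r_level) =
            chosen depth \<rho> 0 # remaining depth \<omega> (reg \<omega> r_level)"
          using 3 \<rho> by simp
        have outputs: "outputs \<omega> = outputs \<tau> @ [(clock \<upsilon>, word (chosen depth \<rho> 0))]"
          using 3 \<rho> \<upsilon> by simp
        have clocks: "clock \<tau> \<le> clock \<upsilon>" "clock \<upsilon> \<le> clock \<omega>" "clock \<omega> \<le> clock \<tau> + T"
          using 3 \<rho> \<upsilon> depth by (simp_all add: T)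
        have "timely (clock \<sigma>) (T + 4) \<tau>"
          using I by (auto simp: tick_0 split: if_splits dest: spec[of _ 0])
        then have "timely (clock \<sigma>) (T + 4) (tick n \<omega>)" if "n \<le> 4" for n
          by (rule timely_output) (use outputs clocks that in auto)
        then show ?case using 3 \<rho> \<upsilon> rem outputs I by simp
      qed (use \<rho> \<upsilon> inv\<upsilon> in auto)
    qed (use \<rho> I in auto)
  qed
next
  case (3 \<tau>)
  have "reg \<tau> r_best = Suc depth" using 3 by (simp add: stack_inv_def)
  then have "reg \<tau> r_level = Suc depth" using 3 by simp
  then have out: "map snd (outputs \<tau>) = map word (todo \<sigma> depth)" using 3 by (simp add: remaining_top)
  then have "outputs \<tau> \<noteq> []" using todo by auto
  then have "timely (clock \<sigma>) (T + 4) (tick 4 \<tau>)" using 3 by simp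
  then show ?case using 3 out by (simp add: eval_nat_numeral)
qed

text \<open>The constant 2000 is generous. With \<open>N\<close> for the product of the sizes and
  \<open>l\<close> for the shortest length, preprocessing takes at most \<open>980 * N + 370\<close>
  and a delay at most \<open>1240 * (l * nfa_size A) + 628\<close>.\<close>

lemma wp_solver:
  "wp x solver (\<lambda>\<tau>. enumerates \<tau> (shortest_walks D A s t) \<and>
     preprocessing_time \<tau> \<le> 2000 * (database_size D * nfa_size A + 1) \<and>
     (\<forall>d\<in>delays \<tau>. d \<le> 2000 * (shortest_length D A s t * nfa_size A + 1))) start"
proof -
  define Q where "Q \<tau> \<longleftrightarrow> enumerates \<tau> (shortest_walks D A s t) \<and>
     preprocessing_time \<tau> \<le> 2000 * (database_size D * nfa_size A + 1) \<and>
     (\<forall>d\<in>delays \<tau>. d \<le> 2000 * (shortest_length D A s t * nfa_size A + 1))" for \<tau>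
  define N where "N = database_size D * nfa_size A"
  \<comment> \<open>The loops over initial and final states take time linear in the number of
    states, which fits because \<open>s\<close> makes the vertex set nonempty.\<close>
  have "card (states A) \<le> card (verts D) * card (states A)"
    using s finite_input(1) by (simp add: Suc_le_eq card_gt_0_iff) blast
  then have states: "card (states A) \<le> N"
    using size_bounds unfolding N_def by linarith
  have "card (initials A) \<le> card (states A)"
    using nfa finite_input(3) by (intro card_mono) (auto simp: nfa_def)
  with states have initials: "card (initials A) \<le> N" by simp
  show ?thesis
    unfolding solver_def wp_simps Q_def[symmetric]
  proof (rule wp_mono[OF wp_init_queue], elim conjE)
    fix \<sigma>1 assume 1: "bfs_inv {} \<sigma>1" "reg \<sigma>1 r_head = 0" "clock \<sigma>1 \<le> 40 * card (initials A) + 10"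
    show "wp x bfs (wp x link (wp x find_best (\<lambda>\<sigma>. if bval x \<sigma> (Equal (Reg r_best) (Const 0))
        then Q (tick (Suc 0) (tick (Suc (bcost (Equal (Reg r_best) (Const 0)))) \<sigma>))
        else wp x init_stack (wp x enumerate_stack Q) (tick (Suc (bcost (Equal (Reg r_best) (Const 0)))) \<sigma>)))) \<sigma>1"
      (is "wp x bfs (wp x link (wp x find_best ?rest)) \<sigma>1")
    proof (rule wp_mono[OF wp_bfs[OF 1(1,2)]], elim conjE)
      fix \<sigma>2 assume 2: "bfs_inv (processed \<sigma>2) \<sigma>2" "reg \<sigma>2 r_head = reg \<sigma>2 r_tail"
        "clock \<sigma>2 \<le> clock \<sigma>1 + 170 * (database_size D * nfa_size A) + 10"
      note final = bfs_final[OF 2(1,2)]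
      show "wp x link (wp x find_best ?rest) \<sigma>2"
      proof (rule wp_mono[OF wp_link[OF 2(1,2)]], elim conjE)
        fix \<sigma>3 assume 3: "frame {r_head, r_v, r_q, r_j, r_i, r_k, r_e} {m_next} \<sigma>2 \<sigma>3"
          "\<forall>v q k i. lev k v q \<longrightarrow> i < length (in_arr x v) \<longrightarrow> mem \<sigma>3 m_next (in_arr x v ! i) q = nxt v {q} i"
          "clock \<sigma>3 \<le> clock \<sigma>2 + 50 * (database_size D * nfa_size A) + 6"
        have frame2: "frame bfs_regs bfs_arrays start \<sigma>2" using 2 by (simp add: bfs_inv_def)
        have frame3: "frame bfs_regs (insert m_next bfs_arrays) start \<sigma>3"
          by (rule frame_trans[OF frame2 3(1)]) auto
        have dist: "mem \<sigma>3 m_dist t q = Suc k \<longleftrightarrow> lev k t q" for q k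
          using final(2) frame_mem[OF 3(1), of m_dist] by simp
        have best: "reg \<sigma>3 r_best = 0" using frame_reg[OF frame3, of r_best] by simp
        show "wp x find_best ?rest \<sigma>3"
        proof (rule wp_mono[OF wp_find_best[OF dist best]], elim conjE)
          fix \<sigma>4 assume 4: "frame {r_i, r_p, r_best} {} \<sigma>3 \<sigma>4"
            "if reg \<sigma>4 r_best = 0 then \<forall>q\<in>finals A. \<forall>k. \<not> lev k t q
             else (\<exists>q\<in>finals A. lev (reg \<sigma>4 r_best - 1) t q) \<and>
               (\<forall>q\<in>finals A. \<forall>k. lev k t q \<longrightarrow> reg \<sigma>4 r_best - 1 \<le> k)"
            "clock \<sigma>4 \<le> clock \<sigma>3 + 50 * card (states A) + 6"
          have frame4: "frame (insert r_best bfs_regs) (insert m_next bfs_arrays) start \<sigma>4"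
            by (rule frame_trans[OF frame3 4(1)]) auto
          \<comment> \<open>From the four phases so far: 310 is 40 + 170 + 50 + 50, and 32 is 10 +
            10 + 6 + 6.\<close>
          have clock4: "clock \<sigma>4 \<le> 310 * N + 32"
            using 1(3) 2(3) 3(3) 4(3) initials states unfolding N_def[symmetric] by simp
          have out4: "pending \<sigma>4 = []" "outputs \<sigma>4 = []" using frame_output[OF frame4] by auto
          show "?rest \<sigma>4"
          proof (cases "reg \<sigma>4 r_best")
            case 0
            have "shortest_walks D A s t = {}"
            proof (rule no_shortest_walks)
              fix q k assume "q \<in> finals A"
              then have "\<not> lev k t q" for k using 4(2) 0 by simp
              then show "\<not> reach k t q" using reach_lev by blast
            qed
            then show ?thesis
              using 0 out4 clock4 by (simp add: Q_def enumerates_def preprocessing_time_def delays_def N_def)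
          next
            case (Suc l)
            define S where "S = {q \<in> finals A. lev l t q}"
            obtain q where q: "q \<in> finals A" "lev l t q" using 4(2) Suc by auto
            have min: "l \<le> k" if "q \<in> finals A" "lev k t q" for q k using 4(2) Suc that by auto
            have shortest: "shortest_length D A s t = l"
              "shortest_walks D A s t = (\<lambda>es. (path es, rev es)) ` set (branches l t S)"
              unfolding S_def by (rule shortest_walks_eq[OF q min]; assumption)+
            have S: "S \<noteq> {}" "S \<subseteq> {q. lev l t q}" using q by (auto simp: S_def)
            let ?\<sigma>4 = "tick (Suc (bcost (Equal (Reg r_best) (Const 0)))) \<sigma>4"
            have "wp x init_stack (wp x enumerate_stack Q) ?\<sigma>4"
            proof (rule wp_mono[OF wp_init_stack[of _ l]], goal_cases)
              case 1
              show ?case using Suc by simp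
            next
              case (2 q k)
              show ?case using dist frame_mem[OF 4(1), of m_dist] by simp
            next
              case 3
              show ?case using frame_mem[OF frame4, of m_size] by simp
            next
              case (4 \<sigma>5)
              have frame5: "frame {r_i, r_p, r_level} {m_vert, m_set, m_size} \<sigma>4 \<sigma>5"
              proof (rule frame_trans[of "{}" "{}" \<sigma>4 ?\<sigma>4])
                show "frame {r_i, r_p, r_level} {m_vert, m_set, m_size} ?\<sigma>4 \<sigma>5" using 4 by blast
              qed auto
              have 5: "reg \<sigma>5 r_level = l" "mem \<sigma>5 m_vert l 0 = t" "bij_betw (mem \<sigma>5 m_set l) {..<mem \<sigma>5 m_size l 0} S"
                "clock \<sigma>5 \<le> clock \<sigma>4 + 50 * card (states A) + 24"
                using 4 by (simp_all add: S_def)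
              have "tables \<sigma>3" by (rule tables_frame[OF final(1) 3(1)]) simp
              then have "tables \<sigma>4" by (rule tables_frame[OF _ \<open>frame {r_i, r_p, r_best} {} \<sigma>3 \<sigma>4\<close>]) simp
              then have tables: "tables \<sigma>5" by (rule tables_frame[OF _ frame5]) simp
              have "links_ok \<sigma>3" using 3(2) by (simp only: links_ok_def)
              then have "links_ok \<sigma>4" by (rule links_frame[OF _ \<open>frame {r_i, r_p, r_best} {} \<sigma>3 \<sigma>4\<close>]) simp
              then have links: "links_ok \<sigma>5" by (rule links_frame[OF _ frame5]) simp
              have lset: "lset \<sigma>5 l = S" using 5(3) by (simp add: lset_def bij_betw_def)
              have ok: "level_ok \<sigma>5 l" using 5 S lset by (simp add: level_ok_def bij_betw_def)
              have zero: "mem \<sigma>5 m_mark = (\<lambda>_ _. 0)" "mem \<sigma>5 m_index = (\<lambda>_ _. 0)"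
                using frame_mem[OF frame5] frame_mem[OF frame4] by auto
              have inv: "stack_inv l \<sigma>5"
                using tables links ok zero 5 Suc frame_reg[OF frame5, of r_best] unfolding stack_inv_def
                by (auto dest: le_antisym)
              have todo: "todo \<sigma>5 l = branches l t S"
                using zero 5 lset by (simp add: todo_def rest_zero)
              define T where "T = 310 * (1 + (\<Sum>m\<in>{1..l}. level_cost m))"
              have out5: "pending \<sigma>5 = []" "outputs \<sigma>5 = []" using frame_output[OF frame5] out4 by auto
              show ?case
              proof (rule wp_mono[OF wp_enumerate_stack[OF inv 5(1) _ out5 T_def]], goal_cases)
                case 1
                show ?case unfolding todo by (rule branches_nonempty[OF S])
              next
                case (2 \<tau>)
                note bounds = timely_bounds[of "clock \<sigma>5" "T + 4" \<tau>]
                have T: "T \<le> 310 + 620 * N" "T \<le> 310 + 620 * (l * nfa_size A)"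
                  using sum_level_cost[OF q(2)] by (simp_all add: T_def N_def)
                have "enumerates \<tau> (shortest_walks D A s t)"
                  unfolding enumerates_def shortest(2)
                proof (intro conjI exI[of _ "map (\<lambda>es. (path es, rev es)) (branches l t S)"])
                  show "distinct (map snd (map (\<lambda>es. (path es, rev es)) (branches l t S)))"
                    using distinct_branches[OF S] by (simp add: comp_def distinct_map inj_on_def)
                qed (use 2 todo in \<open>simp_all add: word_def\<close>)
                moreover have "preprocessing_time \<tau> \<le> 2000 * (database_size D * nfa_size A + 1)"
                  using bounds(1) 2 T(1) clock4 5(4) states unfolding N_def[symmetric] by simp
                moreover have "\<forall>d\<in>delays \<tau>. d \<le> 2000 * (shortest_length D A s t * nfa_size A + 1)"
                  using bounds(2) 2 T(2) unfolding shortest(1) by fastforce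
                ultimately show ?case unfolding Q_def by blast
              qed
            qed
            then show ?thesis using Suc by simp
          qed
        qed
      qed
    qed
  qed
qed

end

theorem theorem1p2:
  shows "\<exists>(P :: com) (C\<^sub>1 :: nat) (C\<^sub>2 :: nat).
    \<forall>(D :: (nat, nat, nat) database) (A :: (nat, nat) nfa) (s :: nat) (t :: nat) (x :: input).
      database D \<and> nfa A \<and> alphabet A = labels D \<and> s \<in> verts D \<and> t \<in> verts D \<and>
      presents x D A s t \<longrightarrow>
      (\<exists>\<sigma>. exec x P start \<sigma> \<and>
           enumerates \<sigma> (shortest_walks D A s t) \<and>
           preprocessing_time \<sigma> \<le> C\<^sub>1 * (database_size D * nfa_size A + 1) \<and>
           (\<forall>d\<in>delays \<sigma>. d \<le> C\<^sub>2 * (shortest_length D A s t * nfa_size A + 1)))"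
proof (rule exI[of _ solver], rule exI[of _ 2000], rule exI[of _ 2000], intro allI impI)
  fix D :: "(nat, nat, nat) database" and A :: "(nat, nat) nfa" and s t :: nat and x :: input
  assume "database D \<and> nfa A \<and> alphabet A = labels D \<and> s \<in> verts D \<and> t \<in> verts D \<and> presents x D A s t"
  then interpret problem x D A s t by unfold_locales auto
  show "\<exists>\<sigma>. exec x solver start \<sigma> \<and>
           enumerates \<sigma> (shortest_walks D A s t) \<and>
           preprocessing_time \<sigma> \<le> 2000 * (database_size D * nfa_size A + 1) \<and>
           (\<forall>d\<in>delays \<sigma>. d \<le> 2000 * (shortest_length D A s t * nfa_size A + 1))"
    using wp_solver unfolding wp_def .
qed

end
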